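(* Suppose that a finitely generated group $G$ acts geometrically on a proper $\mathrm{CAT}(0)$ space $X$. Assume that $G$ contains a rank-one isometry (of $X$) and that $G$ is not virtually cyclic. Then for every non-principal ultrafilter $\omega$ on $\mathbb{N}$, every unbounded non-decreasing sequence $(d_n)$ of positive reals, and every sublinear function $\kappa$, $$\ker\left(G \curvearrowright \mathrm{Cone}_{\omega}(G,d_n)\right) = \ker\left(G \curvearrowright \partial_v X\right) = K(G) = \mathrm{FC}(G) = \mathcal{A}(G) = \ker\left(G \curvearrowright \partial_\kappa X\right) = \ker\left(G \curvearrowright \partial_* X\right),$$ where $\partial_v X$, $\partial_* X$ and $\partial_\kappa X$ are the visual, contracting (Morse) and sublinearly Morse ($\kappa$-Morse) boundaries of $X$, respectively.
   Context: Asymptotic cones. Let $G$ be a finitely generated group with finite generating set $S$ and word length $\|\cdot\|_S$, $\omega$ a non-principal ultrafilter on $\mathbb{N}$, and $(d_n)$ an unbounded non-decreasing sequence of positive reals. $\mathrm{Cone}_\omega(G,d_n)$ is the ultralimit of $(\Gamma(G,S), \frac{1}{d_n}d_S, e)$; its points are represented by sequences $\{x_n\}$ in $G$ with $\|x_n\|_S/d_n$ bounded (admissible sequences), where $\{x_n\}=\{y_n\}$ iff $\lim_\omega \|x_n^{-1}y_n\|_S/d_n=0$. $G$ acts isometrically by $g\cdot\{x_n\}=\{gx_n\}$. The kernel is the set of $g \in G$ with $\lim_\omega \|x_n^{-1}gx_n\|_S/d_n=0$ for all admissible $\{x_n\}$. $\mathrm{CAT}(0)$ notions. An action is geometric if it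 is isometric, properly discontinuous and cocompact. An isometry $g$ of $X$ is hyperbolic (axial) if it translates non-trivially some geodesic line (an axis of $g$); it is rank-one if it is hyperbolic and some (equivalently every) axis does not bound a flat half-plane (an isometrically, totally geodesically embedded Euclidean half-plane). Virtually cyclic means containing a finite-index subgroup isomorphic to $\mathbb{Z}$. Boundaries. $\partial_v X$ is the set of geodesic rays $c:[0,\infty)\to X$ modulo $c\sim c'$ iff $d(c(t),c'(t))$ is bounded. A geodesic $c$ is Morse if for all $A\ge1$, $B\ge0$ there is a constant $M(A,B)$ such that every $(A,B)$-quasi-geodesic with endpoints on $c$ lies in the $M(A,B)$-neighbourhood of $c$ (equivalently in a $\mathrm{CAT}(0)$ space, $c$ is contracting); $\partial_* X\subset\partial_v X$ is the subset of classes of Morse geodesic rays. Here a sublinear function $\kappa:[0,\infty)\to[1,\infty)$ is a monotone increasing, concave function with $\lim_{t\to\infty}\kappa(t)/t=0$. For a quasi-geodesic ray $c$ and a constant $a$, $\mathcal{N}_\kappa(c,a)=\{x\in X: d(x,c)\le a\,\kappa(d(c(0),x))\}$. Two quasi-geodesic rays $c_1,c_2$ $\kappa$-fellow travel if $c_1\subset\mathcal{N}_\kappa(c_2,\epsilon)$ and $c_2\subset\mathcal{N}_\kappa(c_1,\epsilon)$ for some $\epsilon$ (an equivalence relation). A quasi-geodesic ray $c$ is $\kappa$-Morse if there is $m_c:\mathbb{R}_+^2\to\mathbb{R}_+$ such that every $(q,Q)$-quasi-geodesic $\alpha:[s,t]\to X$ with endpoints on $c$ satisfies $\alpha([s,t])\subset\mathcal{N}_\kappa(c,m_c(q,Q))$.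 $\partial_\kappa X$ is the set of $\kappa$-fellow travelling classes of $\kappa$-Morse quasi-geodesic rays. $G$ acts on each boundary by $g\cdot[c]=[g\circ c]$. Subgroups. $K(G)$ is the unique maximal finite normal subgroup (the finite normal subgroup containing all finite normal subgroups; it exists for the groups considered here). $\mathrm{FC}(G)=\{g\in G: |\{x^{-1}gx: x\in G\}|<\infty\}$. $\mathcal{A}(G)$ is the amenable radical, i.e. the unique maximal amenable normal subgroup of $G$. *)

theory Defs
  imports "HOL-Analysis.Analysis" "HOL-Algebra.Algebra"
begin

section \<open>Kernels of actions\<close>

definition action_kernel ::
    "('g, 'b) monoid_scheme \<Rightarrow> ('g \<Rightarrow> 'e \<Rightarrow> 'e) \<Rightarrow> 'e set \<Rightarrow> 'g set"
  where "action_kernel G act E = {g \<in> carrier G. \<forall>\<xi>\<in>E. act g \<xi> = \<xi>}"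

text \<open>The map \<open>[p] \<mapsto> [f p]\<close> on equivalence classes of \<open>R\<close>, for \<open>f\<close> compatible with \<open>R\<close>.\<close>

definition quotient_map_by :: "('p \<times> 'p) set \<Rightarrow> ('p \<Rightarrow> 'p) \<Rightarrow> 'p set \<Rightarrow> 'p set"
  where "quotient_map_by R f \<xi> = (\<Union>p\<in>\<xi>. R `` {f p})"


section \<open>Groups\<close>

definition generating_set :: "('g, 'b) monoid_scheme \<Rightarrow> 'g set \<Rightarrow> bool"
  where "generating_set G S \<longleftrightarrow> S \<subseteq> carrier G \<and> generate G S = carrier G"

definition word_length :: "('g, 'b) monoid_scheme \<Rightarrow> 'g set \<Rightarrow> 'g \<Rightarrow> nat"
  where "word_length G S g =
    (LEAST n. \<exists>ws. length ws = n \<and> set ws \<subseteq> S \<union> m_inv G ` S \<and>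
                   foldr (mult G) ws \<one>\<^bsub>G\<^esub> = g)"

definition virtually_cyclic :: "('g, 'b) monoid_scheme \<Rightarrow> bool"
  where "virtually_cyclic G \<longleftrightarrow>
    (\<exists>H. subgroup H G \<and> finite (rcosets\<^bsub>G\<^esub> H) \<and> G\<lparr>carrier := H\<rparr> \<cong> integer_group)"

text \<open>Amenability of a discrete group, in von Neumann's form: there is a left-invariant finitely
  additive probability measure defined on all subsets of the group.\<close>

definition amenable :: "('g, 'b) monoid_scheme \<Rightarrow> bool"
  where "amenable G \<longleftrightarrow>
    (\<exists>\<mu> :: 'g set \<Rightarrow> real.
       (\<forall>A\<subseteq>carrier G. 0 \<le> \<mu> A) \<and>
       \<mu> (carrier G) = 1 \<and>
       (\<forall>A\<subseteq>carrier G. \<forall>B\<subseteq>carrier G. A \<inter> B = {} \<longrightarrow> \<mu> (A \<union> B) = \<mu> A + \<mu> B) \<and>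
       (\<forall>g\<in>carrier G. \<forall>A\<subseteq>carrier G. \<mu> (g <#\<^bsub>G\<^esub> A) = \<mu> A))"

text \<open>In the next two definitions \<open>GREATEST\<close> refers to inclusion of sets: the subgroup has
  the stated property and contains every subgroup that has it.\<close>

definition finite_radical :: "('g, 'b) monoid_scheme \<Rightarrow> 'g set"
  where "finite_radical G = (GREATEST N. N \<lhd> G \<and> finite N)"

definition amenable_radical :: "('g, 'b) monoid_scheme \<Rightarrow> 'g set"
  where "amenable_radical G = (GREATEST N. N \<lhd> G \<and> amenable (G\<lparr>carrier := N\<rparr>))"

definition FC_center :: "('g, 'b) monoid_scheme \<Rightarrow> 'g set"
  where "FC_center G =
    {g \<in> carrier G. finite {inv\<^bsub>G\<^esub> x \<otimes>\<^bsub>G\<^esub> g \<otimes>\<^bsub>G\<^esub> x | x. x \<in> carrier G}}"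


section \<open>Asymptotic cones\<close>

definition nonprincipal_ultrafilter :: "nat filter \<Rightarrow> bool"
  where "nonprincipal_ultrafilter \<omega> \<longleftrightarrow>
    \<omega> \<noteq> bot \<and>
    (\<forall>P. eventually P \<omega> \<or> eventually (\<lambda>n. \<not> P n) \<omega>) \<and>
    (\<forall>n. \<omega> \<noteq> principal {n})"

definition admissible ::
    "('g, 'b) monoid_scheme \<Rightarrow> 'g set \<Rightarrow> (nat \<Rightarrow> real) \<Rightarrow> (nat \<Rightarrow> 'g) set"
  where "admissible G S d =
    {x. (\<forall>n. x n \<in> carrier G) \<and> (\<exists>C. \<forall>n. real (word_length G S (x n)) / d n \<le> C)}"

definition cone_rel ::
    "('g, 'b) monoid_scheme \<Rightarrow> 'g set \<Rightarrow> nat filter \<Rightarrow> (nat \<Rightarrow> real) \<Rightarrow>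
     ((nat \<Rightarrow> 'g) \<times> (nat \<Rightarrow> 'g)) set"
  where "cone_rel G S \<omega> d =
    {(x, y). x \<in> admissible G S d \<and> y \<in> admissible G S d \<and>
       ((\<lambda>n. real (word_length G S (inv\<^bsub>G\<^esub> x n \<otimes>\<^bsub>G\<^esub> y n)) / d n) \<longlongrightarrow> 0) \<omega>}"

text \<open>The point set of the ultralimit of the Cayley graph with metric rescaled by \<open>1 / d n\<close> and
  based at the identity; vertices suffice, since every point of the Cayley graph is at distance
  at most \<open>1/2\<close> from a vertex and \<open>d\<close> is unbounded and monotone.\<close>

definition asymptotic_cone ::
    "('g, 'b) monoid_scheme \<Rightarrow> 'g set \<Rightarrow> nat filter \<Rightarrow> (nat \<Rightarrow> real) \<Rightarrow> (nat \<Rightarrow> 'g) set set"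
  where "asymptotic_cone G S \<omega> d = admissible G S d // cone_rel G S \<omega> d"

definition cone_action ::
    "('g, 'b) monoid_scheme \<Rightarrow> 'g set \<Rightarrow> nat filter \<Rightarrow> (nat \<Rightarrow> real) \<Rightarrow>
     'g \<Rightarrow> (nat \<Rightarrow> 'g) set \<Rightarrow> (nat \<Rightarrow> 'g) set"
  where "cone_action G S \<omega> d g = quotient_map_by (cone_rel G S \<omega> d) (\<lambda>x n. g \<otimes>\<^bsub>G\<^esub> x n)"


text \<open>The action on the cone is well defined, and its kernel has the usual description in terms of
  admissible sequences (lemma \<open>cone_kernel_iff\<close> below).\<close>

context group
begin

lemma cancel_inv:
  "a \<in> carrier G \<Longrightarrow> b \<in> carrier G \<Longrightarrow> a \<otimes> (inv a \<otimes> b) = b"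
  "a \<in> carrier G \<Longrightarrow> b \<in> carrier G \<Longrightarrow> inv a \<otimes> (a \<otimes> b) = b"
  by (simp_all flip: m_assoc)

lemma foldr_mult_closed:
  "set ws \<subseteq> carrier G \<Longrightarrow> foldr (mult G) ws \<one> \<in> carrier G"
  by (induction ws) auto

lemma foldr_mult_append:
  "set us \<subseteq> carrier G \<Longrightarrow> set vs \<subseteq> carrier G \<Longrightarrow>
   foldr (mult G) (us @ vs) \<one> = foldr (mult G) us \<one> \<otimes> foldr (mult G) vs \<one>"
  by (induction us) (auto simp: m_assoc foldr_mult_closed)

lemma foldr_mult_inv:
  "set ws \<subseteq> carrier G \<Longrightarrow>
   foldr (mult G) (rev (map (m_inv G) ws)) \<one> = inv (foldr (mult G) ws \<one>)"
proof (induction ws)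
  case (Cons a ws)
  then have "set (rev (map (m_inv G) ws)) \<subseteq> carrier G" "a \<in> carrier G" by auto
  with Cons show ?case
    by (simp add: foldr_mult_append[of "rev (map (m_inv G) ws)" "[inv a]", simplified]
        inv_mult_group foldr_mult_closed)
qed simp

context
  fixes S
  assumes gen: "generating_set G S"
begin

lemma letters_closed: "S \<union> m_inv G ` S \<subseteq> carrier G"
  using gen by (auto simp: generating_set_def)

lemma word_ex:
  assumes "g \<in> carrier G"
  shows "\<exists>ws. set ws \<subseteq> S \<union> m_inv G ` S \<and> foldr (mult G) ws \<one> = g"
proof -
  have "g \<in> generate G S" using assms gen by (simp add: generating_set_def)
  then show ?thesis
  proof induction
    case one
    show ?case by (rule exI[of _ "[]"]) simp
  next
    case (incl h)
    then show ?case using letters_closed by (intro exI[of _ "[h]"]) auto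
  next
    case (inv h)
    then show ?case using letters_closed by (intro exI[of _ "[inv h]"]) auto
  next
    case (eng h1 h2)
    then obtain us vs where
      "set us \<subseteq> S \<union> m_inv G ` S" "foldr (mult G) us \<one> = h1"
      "set vs \<subseteq> S \<union> m_inv G ` S" "foldr (mult G) vs \<one> = h2" by blast
    then show ?case using letters_closed foldr_mult_append[of us vs]
      by (intro exI[of _ "us @ vs"]) auto
  qed
qed

lemma word_length_witness:
  assumes "g \<in> carrier G"
  shows "\<exists>ws. length ws = word_length G S g \<and> set ws \<subseteq> S \<union> m_inv G ` S \<and>
              foldr (mult G) ws \<one> = g"
  unfolding word_length_def by (rule LeastI_ex) (use word_ex[OF assms] in blast)

lemma word_length_le:
  "set ws \<subseteq> S \<union> m_inv G ` S \<Longrightarrow> foldr (mult G) ws \<one> = g \<Longrightarrow> word_length G S g \<le> length ws"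
  unfolding word_length_def by (rule Least_le) auto

lemma word_length_one: "word_length G S \<one> = 0"
  using word_length_le[of "[]"] by simp

lemma word_length_mult:
  assumes "g \<in> carrier G" "h \<in> carrier G"
  shows "word_length G S (g \<otimes> h) \<le> word_length G S g + word_length G S h"
proof -
  obtain us vs where
    u: "length us = word_length G S g" "set us \<subseteq> S \<union> m_inv G ` S" "foldr (mult G) us \<one> = g" and
    v: "length vs = word_length G S h" "set vs \<subseteq> S \<union> m_inv G ` S" "foldr (mult G) vs \<one> = h"
    using word_length_witness assms by metis
  then show ?thesis
    using word_length_le[of "us @ vs" "g \<otimes> h"] letters_closed foldr_mult_append[of us vs] by auto
qed

lemma word_length_inv_le:
  assumes "g \<in> carrier G"
  shows "word_length G S (inv g) \<le> word_length G S g"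
proof -
  obtain us where
    u: "length us = word_length G S g" "set us \<subseteq> S \<union> m_inv G ` S" "foldr (mult G) us \<one> = g"
    using word_length_witness assms by metis
  have "S \<subseteq> carrier G" using gen by (simp add: generating_set_def)
  then have "m_inv G ` (S \<union> m_inv G ` S) \<subseteq> S \<union> m_inv G ` S" by (auto simp: image_iff)
  then have "set (rev (map (m_inv G) us)) \<subseteq> S \<union> m_inv G ` S" using u(2) by (simp only: set_rev set_map) blast
  moreover have "foldr (mult G) (rev (map (m_inv G) us)) \<one> = inv g"
    using foldr_mult_inv[of us] u letters_closed by blast
  ultimately show ?thesis
    using word_length_le[of "rev (map (m_inv G) us)" "inv g"] u(1) by simp
qed

lemma word_length_inv: "g \<in> carrier G \<Longrightarrow> word_length G S (inv g) = word_length G S g"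
  using word_length_inv_le[of g] word_length_inv_le[of "inv g"] by simp

lemma equiv_cone_rel:
  assumes d: "\<And>n. 0 < d n"
  shows "equiv (admissible G S d) (cone_rel G S \<omega> d)"
proof (rule equivI)
  show "refl_on (admissible G S d) (cone_rel G S \<omega> d)"
    by (auto simp: refl_on_def cone_rel_def admissible_def word_length_one)
  show "cone_rel G S \<omega> d \<subseteq> admissible G S d \<times> admissible G S d"
    by (auto simp: cone_rel_def)
  have sym: "word_length G S (inv a \<otimes> b) = word_length G S (inv b \<otimes> a)"
    if "a \<in> carrier G" "b \<in> carrier G" for a b
    using word_length_inv[of "inv a \<otimes> b"] that by (simp add: inv_mult_group)
  then show "sym (cone_rel G S \<omega> d)"
    by (auto simp: sym_def cone_rel_def admissible_def)
  show "trans (cone_rel G S \<omega> d)"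
  proof (rule transI)
    fix x y z
    assume xy: "(x, y) \<in> cone_rel G S \<omega> d" and yz: "(y, z) \<in> cone_rel G S \<omega> d"
    let ?l = "\<lambda>u v n. real (word_length G S (inv u n \<otimes> v n)) / d n"
    have c: "x n \<in> carrier G" "y n \<in> carrier G" "z n \<in> carrier G" for n
      using xy yz by (auto simp: cone_rel_def admissible_def)
    have le: "?l x z n \<le> ?l x y n + ?l y z n" for n
    proof -
      have "inv x n \<otimes> z n = (inv x n \<otimes> y n) \<otimes> (inv y n \<otimes> z n)"
        using c[of n] by (simp add: m_assoc cancel_inv)
      then have "word_length G S (inv x n \<otimes> z n)
          \<le> word_length G S (inv x n \<otimes> y n) + word_length G S (inv y n \<otimes> z n)"
        using word_length_mult c[of n] by (metis inv_closed m_closed)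
      then show ?thesis using d[of n]
        by (simp add: divide_right_mono flip: add_divide_distrib of_nat_add)
    qed
    have lim: "((\<lambda>n. ?l x y n + ?l y z n) \<longlongrightarrow> 0) \<omega>"
      using xy yz tendsto_add_zero by (fastforce simp: cone_rel_def)
    have "(?l x z \<longlongrightarrow> 0) \<omega>"
    proof (rule tendsto_sandwich[OF _ _ tendsto_const lim])
      show "\<forall>\<^sub>F n in \<omega>. 0 \<le> ?l x z n"
        using d by (intro always_eventually allI divide_nonneg_pos) auto
      show "\<forall>\<^sub>F n in \<omega>. ?l x z n \<le> ?l x y n + ?l y z n"
        using le by (intro always_eventually allI)
    qed
    then show "(x, z) \<in> cone_rel G S \<omega> d"
      using xy yz by (auto simp: cone_rel_def)
  qed
qed

lemma admissible_translate:
  assumes d: "\<And>n. 0 < d n" "mono d" and g: "g \<in> carrier G" and x: "x \<in> admissible G S d"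
  shows "(\<lambda>n. g \<otimes> x n) \<in> admissible G S d"
proof -
  obtain C where C: "real (word_length G S (x n)) / d n \<le> C" for n
    using x by (auto simp: admissible_def)
  have c: "x n \<in> carrier G" for n using x by (auto simp: admissible_def)
  have "real (word_length G S (g \<otimes> x n)) / d n \<le> word_length G S g / d 0 + C" for n
  proof -
    have "real (word_length G S (g \<otimes> x n)) / d n
        \<le> (real (word_length G S g) + real (word_length G S (x n))) / d n"
      using word_length_mult[OF g c[of n]] d(1)[of n] by (intro divide_right_mono) auto
    also have "\<dots> = real (word_length G S g) / d n + real (word_length G S (x n)) / d n"
      by (rule add_divide_distrib)
    also have "real (word_length G S g) / d n \<le> real (word_length G S g) / d 0"
      using d(1)[of 0] monoD[OF d(2), of 0 n] by (intro divide_left_mono) (auto intro: mult_pos_pos d)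
    finally show ?thesis using C[of n] by linarith
  qed
  then show ?thesis using c g by (auto simp: admissible_def)
qed

lemma cone_rel_translate:
  assumes d: "\<And>n. 0 < d n" "mono d" and g: "g \<in> carrier G" and xy: "(x, y) \<in> cone_rel G S \<omega> d"
  shows "((\<lambda>n. g \<otimes> x n), (\<lambda>n. g \<otimes> y n)) \<in> cone_rel G S \<omega> d"
proof -
  have c: "x n \<in> carrier G" "y n \<in> carrier G" for n
    using xy by (auto simp: cone_rel_def admissible_def)
  have "inv (g \<otimes> x n) \<otimes> (g \<otimes> y n) = inv x n \<otimes> y n" for n
    using c[of n] g by (simp add: inv_mult_group m_assoc cancel_inv)
  then show ?thesis
    using xy admissible_translate[OF d g] by (auto simp: cone_rel_def)
qed

lemma cone_action_class:
  assumes d: "\<And>n. 0 < d n" "mono d" and g: "g \<in> carrier G" and x: "x \<in> admissible G S d"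
  shows "cone_action G S \<omega> d g (cone_rel G S \<omega> d `` {x}) =
         cone_rel G S \<omega> d `` {\<lambda>n. g \<otimes> x n}"
proof -
  note eq = equiv_cone_rel[where \<omega> = \<omega>, OF d(1)]
  have "(\<lambda>u. cone_rel G S \<omega> d `` {\<lambda>n. g \<otimes> u n}) respects cone_rel G S \<omega> d"
    by (rule congruentI) (rule equiv_class_eq[OF eq cone_rel_translate[OF d g]])
  then show ?thesis
    unfolding cone_action_def quotient_map_by_def by (rule UN_equiv_class[OF eq _ x])
qed

lemma cone_kernel_iff:
  assumes d: "\<And>n. 0 < d n" "mono d"
  shows "action_kernel G (cone_action G S \<omega> d) (asymptotic_cone G S \<omega> d) =
    {g \<in> carrier G. \<forall>x\<in>admissible G S d.
       ((\<lambda>n. real (word_length G S (inv x n \<otimes> g \<otimes> x n)) / d n) \<longlongrightarrow> 0) \<omega>}"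
proof -
  note eq = equiv_cone_rel[where \<omega> = \<omega>, OF d(1)]
  have *: "cone_action G S \<omega> d g (cone_rel G S \<omega> d `` {x}) = cone_rel G S \<omega> d `` {x} \<longleftrightarrow>
      ((\<lambda>n. real (word_length G S (inv x n \<otimes> g \<otimes> x n)) / d n) \<longlongrightarrow> 0) \<omega>"
    if g: "g \<in> carrier G" and x: "x \<in> admissible G S d" for g x
  proof -
    have c: "x n \<in> carrier G" for n using x by (auto simp: admissible_def)
    have gx: "(\<lambda>n. g \<otimes> x n) \<in> admissible G S d" by (rule admissible_translate[OF d g x])
    have "cone_action G S \<omega> d g (cone_rel G S \<omega> d `` {x}) = cone_rel G S \<omega> d `` {x} \<longleftrightarrow>
        (x, \<lambda>n. g \<otimes> x n) \<in> cone_rel G S \<omega> d"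
      unfolding cone_action_class[OF d g x] using eq_equiv_class_iff[OF eq x gx] by metis
    also have "\<dots> \<longleftrightarrow>
        ((\<lambda>n. real (word_length G S (inv x n \<otimes> g \<otimes> x n)) / d n) \<longlongrightarrow> 0) \<omega>"
      using x gx c g by (simp add: cone_rel_def m_assoc)
    finally show ?thesis .
  qed
  show ?thesis
    unfolding action_kernel_def asymptotic_cone_def using * by (auto simp: quotient_def)
qed

end

end


section \<open>CAT(0) spaces\<close>

definition geodesic_on :: "real set \<Rightarrow> (real \<Rightarrow> 'x::metric_space) \<Rightarrow> bool"
  where "geodesic_on I c \<longleftrightarrow> (\<forall>s\<in>I. \<forall>t\<in>I. dist (c s) (c t) = \<bar>s - t\<bar>)"

definition geodesic_segment :: "'x::metric_space \<Rightarrow> 'x \<Rightarrow> 'x set \<Rightarrow> bool"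
  where "geodesic_segment x y \<sigma> \<longleftrightarrow>
    (\<exists>c. geodesic_on {0..dist x y} c \<and> c 0 = x \<and> c (dist x y) = y \<and> \<sigma> = c ` {0..dist x y})"

text \<open>Pairs consisting of a point of a side \<open>\<sigma>\<close> from \<open>x\<close> to \<open>y\<close> and its comparison point on
  the corresponding side from \<open>x'\<close> to \<open>y'\<close> of the Euclidean comparison triangle.\<close>

definition comparison_side ::
    "'x::metric_space \<Rightarrow> 'x set \<Rightarrow> real^2 \<Rightarrow> real^2 \<Rightarrow> ('x \<times> (real^2)) set"
  where "comparison_side x \<sigma> x' y' =
    {(u, u'). u \<in> \<sigma> \<and> u' \<in> closed_segment x' y' \<and> dist x' u' = dist x u}"

definition cat0_space :: "'x::metric_space itself \<Rightarrow> bool"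
  where "cat0_space _ \<longleftrightarrow>
    (\<forall>x y :: 'x. \<exists>\<sigma>. geodesic_segment x y \<sigma>) \<and>
    (\<forall>(p :: 'x) q r \<sigma>\<^sub>1 \<sigma>\<^sub>2 \<sigma>\<^sub>3 p' q' r'.
       geodesic_segment p q \<sigma>\<^sub>1 \<and> geodesic_segment q r \<sigma>\<^sub>2 \<and> geodesic_segment r p \<sigma>\<^sub>3 \<and>
       dist p' q' = dist p q \<and> dist q' r' = dist q r \<and> dist r' p' = dist r p \<longrightarrow>
       (let \<Delta> = comparison_side p \<sigma>\<^sub>1 p' q' \<union> comparison_side q \<sigma>\<^sub>2 q' r' \<union>
                comparison_side r \<sigma>\<^sub>3 r' p'
        in \<forall>(u, u')\<in>\<Delta>. \<forall>(v, v')\<in>\<Delta>. dist u v \<le> dist u' v'))"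

definition proper_space :: "'x::metric_space itself \<Rightarrow> bool"
  where "proper_space _ \<longleftrightarrow> (\<forall>(x :: 'x) r. compact (cball x r))"

definition geometric_action ::
    "('g, 'b) monoid_scheme \<Rightarrow> ('g \<Rightarrow> 'x::metric_space \<Rightarrow> 'x) \<Rightarrow> bool"
  where "geometric_action G \<phi> \<longleftrightarrow>
    group_action G UNIV \<phi> \<and>
    (\<forall>g\<in>carrier G. \<forall>x y. dist (\<phi> g x) (\<phi> g y) = dist x y) \<and>
    (\<forall>K. compact K \<longrightarrow> finite {g \<in> carrier G. \<phi> g ` K \<inter> K \<noteq> {}}) \<and>
    (\<exists>K. compact K \<and> (\<Union>g\<in>carrier G. \<phi> g ` K) = UNIV)"

definition axis_of :: "('x::metric_space \<Rightarrow> 'x) \<Rightarrow> (real \<Rightarrow> 'x) \<Rightarrow> bool"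
  where "axis_of f c \<longleftrightarrow> geodesic_on UNIV c \<and> (\<exists>\<tau>. \<tau> \<noteq> 0 \<and> (\<forall>t. f (c t) = c (t + \<tau>)))"

definition bounds_flat_half_plane :: "(real \<Rightarrow> 'x::metric_space) \<Rightarrow> bool"
  where "bounds_flat_half_plane c \<longleftrightarrow>
    (\<exists>h :: real^2 \<Rightarrow> 'x.
       (\<forall>v\<in>{v. 0 \<le> v $ 2}. \<forall>w\<in>{v. 0 \<le> v $ 2}. dist (h v) (h w) = dist v w) \<and>
       h ` {v. v $ 2 = 0} = range c)"

definition rank_one_isometry :: "('x::metric_space \<Rightarrow> 'x) \<Rightarrow> bool"
  where "rank_one_isometry f \<longleftrightarrow>
    bij f \<and> (\<forall>x y. dist (f x) (f y) = dist x y) \<and>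
    (\<exists>c. axis_of f c \<and> \<not> bounds_flat_half_plane c)"


section \<open>Boundaries\<close>

text \<open>Rays are total functions \<open>real \<Rightarrow> 'x\<close> of which only the restriction to \<open>{0..}\<close> matters:
  the relations below do not see the values at negative arguments, so the equivalence classes are
  those of rays defined on \<open>{0..}\<close>.\<close>

definition geodesic_rays :: "(real \<Rightarrow> 'x::metric_space) set"
  where "geodesic_rays = {c. geodesic_on {0..} c}"

definition asymptotic_rel :: "((real \<Rightarrow> 'x::metric_space) \<times> (real \<Rightarrow> 'x)) set"
  where "asymptotic_rel =
    {(c, c'). c \<in> geodesic_rays \<and> c' \<in> geodesic_rays \<and>
       (\<exists>C. \<forall>t\<ge>0. dist (c t) (c' t) \<le> C)}"

definition visual_boundary :: "(real \<Rightarrow> 'x::metric_space) set set"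
  where "visual_boundary = geodesic_rays // asymptotic_rel"

definition visual_action ::
    "('g \<Rightarrow> 'x::metric_space \<Rightarrow> 'x) \<Rightarrow> 'g \<Rightarrow> (real \<Rightarrow> 'x) set \<Rightarrow> (real \<Rightarrow> 'x) set"
  where "visual_action \<phi> g = quotient_map_by asymptotic_rel (\<lambda>c. \<phi> g \<circ> c)"

definition quasi_geodesic_on ::
    "real \<Rightarrow> real \<Rightarrow> real set \<Rightarrow> (real \<Rightarrow> 'x::metric_space) \<Rightarrow> bool"
  where "quasi_geodesic_on q Q I \<alpha> \<longleftrightarrow>
    1 \<le> q \<and> 0 \<le> Q \<and>
    (\<forall>s\<in>I. \<forall>t\<in>I. \<bar>s - t\<bar> / q - Q \<le> dist (\<alpha> s) (\<alpha> t) \<and>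
                   dist (\<alpha> s) (\<alpha> t) \<le> q * \<bar>s - t\<bar> + Q)"

definition morse_ray :: "(real \<Rightarrow> 'x::metric_space) \<Rightarrow> bool"
  where "morse_ray c \<longleftrightarrow>
    (\<forall>A\<ge>1. \<forall>B\<ge>0. \<exists>M. \<forall>\<alpha> s t.
       s \<le> t \<and> quasi_geodesic_on A B {s..t} \<alpha> \<and> \<alpha> s \<in> c ` {0..} \<and> \<alpha> t \<in> c ` {0..} \<longrightarrow>
       \<alpha> ` {s..t} \<subseteq> {x. infdist x (c ` {0..}) \<le> M})"

definition morse_boundary :: "(real \<Rightarrow> 'x::metric_space) set set"
  where "morse_boundary = {\<xi> \<in> visual_boundary. \<exists>c\<in>\<xi>. morse_ray c}"

definition sublinear_function :: "(real \<Rightarrow> real) \<Rightarrow> bool"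
  where "sublinear_function \<kappa> \<longleftrightarrow>
    (\<forall>t\<ge>0. 1 \<le> \<kappa> t) \<and> mono_on {0..} \<kappa> \<and> concave_on {0..} \<kappa> \<and>
    ((\<lambda>t. \<kappa> t / t) \<longlongrightarrow> 0) at_top"

definition kappa_nbhd ::
    "(real \<Rightarrow> real) \<Rightarrow> (real \<Rightarrow> 'x::metric_space) \<Rightarrow> real \<Rightarrow> 'x set"
  where "kappa_nbhd \<kappa> c a = {x. infdist x (c ` {0..}) \<le> a * \<kappa> (dist (c 0) x)}"

definition kappa_morse_rays :: "(real \<Rightarrow> real) \<Rightarrow> (real \<Rightarrow> 'x::metric_space) set"
  where "kappa_morse_rays \<kappa> =
    {c. (\<exists>q Q. quasi_geodesic_on q Q {0..} c) \<and>
        (\<exists>m :: real \<Rightarrow> real \<Rightarrow> real.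
           (\<forall>q Q. 0 \<le> m q Q) \<and>
           (\<forall>q Q \<alpha> s t.
              s \<le> t \<and> quasi_geodesic_on q Q {s..t} \<alpha> \<and> \<alpha> s \<in> c ` {0..} \<and> \<alpha> t \<in> c ` {0..} \<longrightarrow>
              \<alpha> ` {s..t} \<subseteq> kappa_nbhd \<kappa> c (m q Q)))}"

definition kappa_fellow_rel ::
    "(real \<Rightarrow> real) \<Rightarrow> ((real \<Rightarrow> 'x::metric_space) \<times> (real \<Rightarrow> 'x)) set"
  where "kappa_fellow_rel \<kappa> =
    {(c, c'). c \<in> kappa_morse_rays \<kappa> \<and> c' \<in> kappa_morse_rays \<kappa> \<and>
       (\<exists>\<epsilon>. c ` {0..} \<subseteq> kappa_nbhd \<kappa> c' \<epsilon> \<and> c' ` {0..} \<subseteq> kappa_nbhd \<kappa> c \<epsilon>)}"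

definition kappa_boundary :: "(real \<Rightarrow> real) \<Rightarrow> (real \<Rightarrow> 'x::metric_space) set set"
  where "kappa_boundary \<kappa> = kappa_morse_rays \<kappa> // kappa_fellow_rel \<kappa>"

definition kappa_action ::
    "(real \<Rightarrow> real) \<Rightarrow> ('g \<Rightarrow> 'x::metric_space \<Rightarrow> 'x) \<Rightarrow> 'g \<Rightarrow>
     (real \<Rightarrow> 'x) set \<Rightarrow> (real \<Rightarrow> 'x) set"
  where "kappa_action \<kappa> \<phi> g = quotient_map_by (kappa_fellow_rel \<kappa>) (\<lambda>c. \<phi> g \<circ> c)"

end

theory Submission
  imports Defs
begin

text \<open>Let \<open>c\<close> be an axis of a rank-one element \<open>h\<close>. Suppose that, for every \<open>L\<close>, there are pairs of
  points arbitrarily far from \<open>c\<close>, at bounded distance from each other, whose projections to \<open>c\<close> are at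
  distance at least \<open>L\<close>. The ultralimit of the perpendiculars through these points bounds a flat half-strip
  of width at least \<open>L\<close> on \<open>c\<close>, and an ultralimit of translates of these half-strips by powers of \<open>h\<close> is a
  flat half-plane bounded by \<open>c\<close>. So the projection to \<open>c\<close> is strongly contracting far away from \<open>c\<close>. This makes
  \<open>c\<close> Morse, bounds the distance from \<open>c\<close> to its parallels, and gives Behrstock's inequality for \<open>c\<close>
  and any translate of \<open>c\<close> that shares no end with it.

  Let \<open>K\<close> be the normal subgroup of all elements with bounded displacement on every translate of \<open>c\<close>.
  Since displacement is convex along geodesics, an element with sublinear displacement along the
  translates of \<open>c\<close>, for instance one that fixes all their ends, lies in \<open>K\<close>. Every element of \<open>K\<close> moves
  \<open>c\<close> to a parallel of \<open>c\<close>. A normal subgroup with this property is finite: otherwise it contains a power of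
  \<open>h\<close>, the conjugates of that power are commensurable with it, all translates of \<open>c\<close> are parallel to \<open>c\<close>, and the
  group is virtually cyclic. Conversely, a finite normal subgroup has bounded displacement on the whole
  space. Finally, if an element of a normal subgroup maps no end of \<open>c\<close> to an end of \<open>c\<close>, then its
  conjugates by suitable powers of \<open>h\<close> map the complements of disjoint slabs into these slabs, which
  excludes an invariant mean.\<close>

section \<open>Geodesics in CAT(0) spaces\<close>

text \<open>The decisive point is the order of quantifiers in \<open>strong_contraction\<close>: the
  bound \<open>L\<close> on the jump of the projection is fixed before the step length
  \<open>D\<close>, and only the height \<open>R\<close> depends on \<open>D\<close>. A path far
  above the axis can therefore be cut into steps much longer than \<open>L\<close>, so that its
  projection advances by an arbitrarily small fraction of its length. The stability statements play
  this slow advance against the distance that a geodesic or quasi-geodesic has to cover. The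
  half-strips found for different widths are unrelated to each other, which is why a second
  ultralimit is needed to obtain a half-plane. The ultrafilter of the cone serves for both limits.
  On the group side, finiteness comes from a pigeonhole argument: modulo powers of \<open>h\<close>,
  only finitely many elements move the axis to a parallel, because parallels stay at a uniformly
  bounded distance and the action is proper.\<close>

lemma comparison_triangle_exists:
  fixes a b c :: real
  assumes "0 \<le> a" "0 \<le> b" "0 \<le> c" "a \<le> b + c" "b \<le> a + c" "c \<le> a + b"
  shows "\<exists>p q r :: real^2. dist p q = a \<and> dist q r = b \<and> dist r p = c"
proof (cases "a = 0")
  case True
  then have "b = c" using assms by simp
  then show ?thesis using True assms
    by (intro exI[of _ "0::real^2"] exI[of _ "vector [c, 0]::real^2"])
       (simp add: dist_norm norm_vec_def L2_set_def sum_2 dist_commute)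
next
  case False
  then have a: "a > 0" using assms by simp
  \<comment> \<open>With \<open>p\<close> at the origin and \<open>q\<close> at (a, 0), this is the
    first coordinate of \<open>r\<close> by the law of cosines. Heron's factorisation below shows
    that the square of the second coordinate is nonnegative.\<close>
  define x where "x = (a\<^sup>2 + c\<^sup>2 - b\<^sup>2) / (2 * a)"
  have ax: "2 * a * x = a\<^sup>2 + c\<^sup>2 - b\<^sup>2" using a by (simp add: x_def)
  have "(2 * a * c)\<^sup>2 - (2 * a * x)\<^sup>2 = (b + c - a) * (b + a - c) * ((a + c - b) * (a + b + c))"
    unfolding ax by (simp add: power2_eq_square algebra_simps)
  also have "\<dots> \<ge> 0" using assms by (intro mult_nonneg_nonneg) auto
  finally have "4 * a\<^sup>2 * (c\<^sup>2 - x\<^sup>2) \<ge> 0" by (simp add: power2_eq_square algebra_simps)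
  then have cx: "c\<^sup>2 - x\<^sup>2 \<ge> 0" using a by (simp add: zero_le_mult_iff)
  define y where "y = sqrt (c\<^sup>2 - x\<^sup>2)"
  have y2: "y\<^sup>2 = c\<^sup>2 - x\<^sup>2" using cx by (simp add: y_def)
  have b2: "(a - x)\<^sup>2 + y\<^sup>2 = b\<^sup>2" unfolding y2 using ax by (simp add: power2_eq_square algebra_simps)
  have c2: "x\<^sup>2 + y\<^sup>2 = c\<^sup>2" unfolding y2 by simp
  show ?thesis
    by (rule exI[of _ "vector [0, 0]"], rule exI[of _ "vector [a, 0]"], rule exI[of _ "vector [x, y]"])
       (use assms b2 c2 in \<open>simp add: dist_norm norm_vec_def L2_set_def sum_2\<close>)
qed

lemma stewart:
  fixes p y z :: "'a::real_inner"
  shows "(dist p (y + s *\<^sub>R (z - y)))\<^sup>2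
       = (1 - s) * (dist p y)\<^sup>2 + s * (dist p z)\<^sup>2 - s * (1 - s) * (dist y z)\<^sup>2"
  by (simp add: dist_norm power2_norm_eq_inner inner_diff_left inner_diff_right
      inner_add_left inner_add_right inner_commute algebra_simps)

text \<open>Geodesics are parametrised proportionally to arc length on [0, 1], so that points at
  equal ratios on different sides can be compared. \<open>CN\<close> is the Bruhat-Tits inequality
  at an arbitrary ratio, that is, Stewart's identity weakened to an inequality by comparison. All
  later curvature arguments start from it.\<close>

locale cat0_geodesics =
  fixes geo :: "'x::metric_space \<Rightarrow> 'x \<Rightarrow> real \<Rightarrow> 'x"
  assumes geo_0 [simp]: "geo x y 0 = x"
    and geo_1 [simp]: "geo x y 1 = y"
    and geo_dist: "0 \<le> s \<Longrightarrow> s \<le> 1 \<Longrightarrow> 0 \<le> t \<Longrightarrow> t \<le> 1 \<Longrightarrow>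
      dist (geo x y s) (geo x y t) = \<bar>s - t\<bar> * dist x y"
    and CN: "0 \<le> s \<Longrightarrow> s \<le> 1 \<Longrightarrow>
      (dist p (geo y z s))\<^sup>2 \<le> (1 - s) * (dist p y)\<^sup>2 + s * (dist p z)\<^sup>2 - s * (1 - s) * (dist y z)\<^sup>2"

lemma cat0_geodesics_exist:
  assumes "cat0_space TYPE('x::metric_space)"
  shows "\<exists>geo :: 'x \<Rightarrow> 'x \<Rightarrow> real \<Rightarrow> 'x. cat0_geodesics geo"
proof -
  have seg: "\<exists>\<sigma>. geodesic_segment x y \<sigma>" for x y :: 'x
    using assms by (auto simp: cat0_space_def)
  have "\<forall>x y :: 'x. \<exists>c. geodesic_on {0..dist x y} c \<and> c 0 = x \<and> c (dist x y) = y"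
    using seg unfolding geodesic_segment_def by blast
  then obtain c where c: "\<And>x y :: 'x. geodesic_on {0..dist x y} (c x y)"
      "\<And>x y :: 'x. c x y 0 = x" "\<And>x y :: 'x. c x y (dist x y) = y" by metis
  define geo where "geo x y s = c x y (s * dist x y)" for x y s
  have "cat0_geodesics geo"
  proof
    show "geo x y 0 = x" "geo x y 1 = y" for x y by (simp_all add: geo_def c)
    show geod: "dist (geo x y s) (geo x y t) = \<bar>s - t\<bar> * dist x y"
      if "0 \<le> s" "s \<le> 1" "0 \<le> t" "t \<le> 1" for s t x y
    proof -
      have "s * dist x y \<in> {0..dist x y}" "t * dist x y \<in> {0..dist x y}"
        using that by (auto simp: mult_left_le_one_le)
      then show ?thesis using c(1)[of x y] unfolding geodesic_on_def geo_def
        by (metis abs_mult abs_of_nonneg left_diff_distrib zero_le_dist)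
    qed
    fix s :: real and p y z :: 'x
    assume s: "0 \<le> s" "s \<le> 1"
    have sd: "s * dist y z \<in> {0..dist y z}" using s by (auto simp: mult_left_le_one_le)
    obtain p' y' z' :: "real^2" where
      d: "dist p' y' = dist p y" "dist y' z' = dist y z" "dist z' p' = dist z p"
      using comparison_triangle_exists[of "dist p y" "dist y z" "dist z p"] dist_triangle
      by (metis dist_commute zero_le_dist add.commute)
    obtain \<sigma>1 \<sigma>3 where \<sigma>: "geodesic_segment p y \<sigma>1" "geodesic_segment z p \<sigma>3" using seg by blast
    \<comment> \<open>This side must be the chosen geodesic, because \<open>geo y z s\<close> has to
      lie on it; the other two sides are arbitrary.\<close>
    define \<sigma>2 where "\<sigma>2 = c y z ` {0..dist y z}"
    have \<sigma>2: "geodesic_segment y z \<sigma>2" using c unfolding geodesic_segment_def \<sigma>2_def by blast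
    define u' where "u' = y' + s *\<^sub>R (z' - y')"
    have u': "u' \<in> closed_segment y' z'" unfolding closed_segment_def u'_def using s
      by (auto intro!: exI[of _ s] simp: algebra_simps)
    have "dist y' u' = s * dist y z" using s d(2) by (simp add: u'_def dist_norm norm_minus_commute)
    moreover have "dist y (geo y z s) = s * dist y z"
      using geod[of 0 s y z] s by (simp add: geo_def c)
    ultimately have 1: "(geo y z s, u') \<in> comparison_side y \<sigma>2 y' z'"
      using u' sd by (auto simp: comparison_side_def \<sigma>2_def geo_def)
    have 2: "(p, p') \<in> comparison_side p \<sigma>1 p' y'"
    proof -
      have "p \<in> \<sigma>1" using \<sigma>(1) by (force simp: geodesic_segment_def)
      then show ?thesis by (simp add: comparison_side_def)
    qed
    have "\<forall>(u, u')\<in>comparison_side p \<sigma>1 p' y' \<union> comparison_side y \<sigma>2 y' z' \<union> comparison_side z \<sigma>3 z' p'.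
       \<forall>(v, v')\<in>comparison_side p \<sigma>1 p' y' \<union> comparison_side y \<sigma>2 y' z' \<union> comparison_side z \<sigma>3 z' p'.
        dist u v \<le> dist u' v'"
      using assms \<sigma> \<sigma>2 d unfolding cat0_space_def Let_def by blast
    then have "dist p (geo y z s) \<le> dist p' u'" using 1 2 by blast
    then have "(dist p (geo y z s))\<^sup>2 \<le> (dist p' u')\<^sup>2" by (simp add: power_mono)
    also have "\<dots> = (1 - s) * (dist p y)\<^sup>2 + s * (dist p z)\<^sup>2 - s * (1 - s) * (dist y z)\<^sup>2"
      unfolding u'_def stewart using d by (simp add: dist_commute)
    finally show "(dist p (geo y z s))\<^sup>2 \<le> \<dots>" .
  qed
  then show ?thesis by blast
qed

context cat0_geodesics
begin

lemma dist_geo_left: "0 \<le> s \<Longrightarrow> s \<le> 1 \<Longrightarrow> dist x (geo x y s) = s * dist x y"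
  using geo_dist[of 0 s x y] by simp

lemma dist_geo_right: "0 \<le> s \<Longrightarrow> s \<le> 1 \<Longrightarrow> dist (geo x y s) y = (1 - s) * dist x y"
  using geo_dist[of s 1 x y] by simp

text \<open>With \<open>p = m\<close>, the right-hand side of \<open>CN\<close> is at most 0.
  Symmetry, subsegments and equivariance of \<open>geo\<close> all follow from this
  uniqueness.\<close>

lemma geo_unique:
  assumes s: "0 \<le> s" "s \<le> 1" and "dist x m \<le> s * dist x y" "dist m y \<le> (1 - s) * dist x y"
  shows "m = geo x y s"
proof -
  have "(dist m (geo x y s))\<^sup>2
      \<le> (1 - s) * (dist m x)\<^sup>2 + s * (dist m y)\<^sup>2 - s * (1 - s) * (dist x y)\<^sup>2"
    by (rule CN[OF s])
  also have "\<dots> \<le> (1 - s) * (s * dist x y)\<^sup>2 + s * ((1 - s) * dist x y)\<^sup>2 - s * (1 - s) * (dist x y)\<^sup>2"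
    using assms by (intro add_mono diff_right_mono mult_left_mono power_mono) (auto simp: dist_commute)
  also have "\<dots> = 0" by (simp add: power2_eq_square algebra_simps)
  finally show ?thesis by simp
qed

lemma geo_sym: "0 \<le> s \<Longrightarrow> s \<le> 1 \<Longrightarrow> geo y x (1 - s) = geo x y s"
  using dist_geo_left[of "1 - s" y x] dist_geo_right[of "1 - s" y x]
  by (intro geo_unique) (auto simp: dist_commute)

lemma geo_reparam:
  assumes "0 \<le> a" "a \<le> 1" "0 \<le> b" "b \<le> 1" "0 \<le> s" "s \<le> 1"
  shows "geo (geo x y a) (geo x y b) s = geo x y (a + s * (b - a))"
proof -
  have ab: "0 \<le> a + s * (b - a)" "a + s * (b - a) \<le> 1"
  proof -
    have "a + s * (b - a) = (1 - s) * a + s * b" by (simp add: algebra_simps)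
    then show "0 \<le> a + s * (b - a)" "a + s * (b - a) \<le> 1"
      using assms by (simp, metis convex_bound_le diff_add_cancel diff_ge_0_iff_ge)
  qed
  have 1: "dist (geo x y a) (geo x y (a + s * (b - a))) = s * dist (geo x y a) (geo x y b)"
    using assms ab by (subst (1 2) geo_dist) (auto simp: abs_mult abs_minus_commute)
  have "\<bar>a + s * (b - a) - b\<bar> = \<bar>(1 - s) * (b - a)\<bar>"
    by (simp add: algebra_simps abs_minus_commute)
  then have 2: "dist (geo x y (a + s * (b - a))) (geo x y b) = (1 - s) * dist (geo x y a) (geo x y b)"
    using assms ab by (subst (1 2) geo_dist) (auto simp: abs_mult abs_minus_commute)
  show ?thesis using 1 2 assms by (intro geo_unique[symmetric]) auto
qed

lemma geo_isometry:
  assumes "\<And>x y. dist (f x) (f y) = dist x y" "0 \<le> s" "s \<le> 1"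
  shows "f (geo x y s) = geo (f x) (f y) s"
  using assms by (intro geo_unique) (auto simp: dist_geo_left dist_geo_right)

lemma geo_geodesic_on:
  assumes "geodesic_on I c" "a \<in> I" "b \<in> I" "a + s * (b - a) \<in> I" "0 \<le> s" "s \<le> 1"
  shows "geo (c a) (c b) s = c (a + s * (b - a))"
proof -
  have "\<bar>a + s * (b - a) - b\<bar> = (1 - s) * \<bar>a - b\<bar>"
    using assms abs_mult[of "1 - s" "a - b"] by (simp add: algebra_simps)
  then show ?thesis using assms unfolding geodesic_on_def
    by (intro geo_unique[symmetric]) (auto simp: abs_mult abs_minus_commute)
qed

text \<open>Two applications of \<open>CN\<close>: from \<open>geo x y s\<close> to the side
  \<open>x z\<close>, then from \<open>z\<close> to the side \<open>x y\<close>. The terms in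
  \<open>dist x y\<close> and \<open>dist x z\<close> cancel.\<close>

lemma geo_thin:
  assumes s: "0 \<le> s" "s \<le> 1"
  shows "dist (geo x y s) (geo x z s) \<le> s * dist y z"
proof -
  define a b e where "a = dist x y" and "b = dist x z" and "e = dist y z"
  have "(dist (geo x y s) (geo x z s))\<^sup>2 \<le> (1 - s) * (dist (geo x y s) x)\<^sup>2
       + s * (dist (geo x y s) z)\<^sup>2 - s * (1 - s) * b\<^sup>2"
    unfolding b_def by (rule CN[OF s])
  also have "dist (geo x y s) x = s * a" using dist_geo_left[OF s] by (simp add: dist_commute a_def)
  also have "(1 - s) * (s * a)\<^sup>2 + s * (dist (geo x y s) z)\<^sup>2 - s * (1 - s) * b\<^sup>2
     \<le> (1 - s) * (s * a)\<^sup>2 + s * ((1 - s) * b\<^sup>2 + s * e\<^sup>2 - s * (1 - s) * a\<^sup>2) - s * (1 - s) * b\<^sup>2"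
    using CN[OF s, of z x y] s unfolding a_def b_def e_def
    by (intro diff_right_mono add_left_mono mult_left_mono) (auto simp: dist_commute)
  also have "\<dots> = (s * e)\<^sup>2" by (simp add: power2_eq_square algebra_simps)
  finally show ?thesis using s by (simp add: e_def power2_le_iff_abs_le)
qed

lemma geo_convex:
  assumes s: "0 \<le> s" "s \<le> 1"
  shows "dist (geo x y s) (geo x' y' s) \<le> (1 - s) * dist x x' + s * dist y y'"
proof -
  have "dist (geo x y s) (geo x y' s) \<le> s * dist y y'" by (rule geo_thin[OF s])
  moreover have "dist (geo x y' s) (geo x' y' s) \<le> (1 - s) * dist x x'"
    using geo_thin[of "1 - s" y' x x'] s by (simp add: geo_sym)
  ultimately show ?thesis using dist_triangle[of "geo x y s" "geo x' y' s" "geo x y' s"] by linarith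
qed

text \<open>Both \<open>b\<close> and \<open>d\<close> are compared with the midpoint of the
  diagonal from \<open>a\<close> to \<open>c\<close>. Equality holds for Euclidean parallelograms,
  and \<open>flat_half_strip\<close> uses the inequality to detect flatness.\<close>

lemma four_point:
  fixes a b c d :: 'x
  shows "(dist a c)\<^sup>2 + (dist b d)\<^sup>2 \<le> (dist a b)\<^sup>2 + (dist b c)\<^sup>2 + (dist c d)\<^sup>2 + (dist d a)\<^sup>2"
proof -
  define m where "m = geo a c (1/2)"
  have 1: "(dist b m)\<^sup>2 \<le> (dist b a)\<^sup>2 / 2 + (dist b c)\<^sup>2 / 2 - (dist a c)\<^sup>2 / 4"
    using CN[of "1/2" b a c] by (simp add: m_def)
  have 2: "(dist d m)\<^sup>2 \<le> (dist d a)\<^sup>2 / 2 + (dist d c)\<^sup>2 / 2 - (dist a c)\<^sup>2 / 4"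
    using CN[of "1/2" d a c] by (simp add: m_def)
  have "(dist b d)\<^sup>2 \<le> (dist b m + dist d m)\<^sup>2"
    by (intro power_mono) (auto simp: dist_triangle2)
  also have "\<dots> \<le> 2 * (dist b m)\<^sup>2 + 2 * (dist d m)\<^sup>2"
    using sum_squares_bound[of "dist b m" "dist d m"] by (simp add: power2_sum)
  finally show ?thesis using 1 2 by (simp add: dist_commute)
qed

section \<open>Nearest points in convex sets\<close>

definition gconvex :: "'x set \<Rightarrow> bool"
  where "gconvex K \<longleftrightarrow> (\<forall>x\<in>K. \<forall>y\<in>K. \<forall>s. 0 \<le> s \<and> s \<le> 1 \<longrightarrow> geo x y s \<in> K)"

definition nearest_in :: "'x set \<Rightarrow> 'x \<Rightarrow> 'x \<Rightarrow> bool"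
  where "nearest_in K x u \<longleftrightarrow> u \<in> K \<and> (\<forall>k\<in>K. dist x u \<le> dist x k)"

text \<open>The angle at a nearest point is at least a right angle. Moving from \<open>u\<close> by
  a ratio \<open>s\<close> towards \<open>k\<close> does not shorten the distance to
  \<open>x\<close>; by \<open>CN\<close> this is the claim up to an error
  \<open>s * (dist u k)\<^sup>2\<close>, which the choice of \<open>s\<close> keeps below
  \<open>e\<close>.\<close>

lemma nearest_pythagoras:
  assumes K: "gconvex K" and u: "nearest_in K x u" and k: "k \<in> K"
  shows "(dist x u)\<^sup>2 + (dist u k)\<^sup>2 \<le> (dist x k)\<^sup>2"
proof (rule field_le_epsilon)
  fix e :: real assume e: "e > 0"
  define s where "s = min 1 (e / (1 + (dist u k)\<^sup>2))"
  have s: "0 < s" "s \<le> 1" using e by (auto simp: s_def add_pos_nonneg)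
  have "s * (dist u k)\<^sup>2 \<le> e / (1 + (dist u k)\<^sup>2) * (dist u k)\<^sup>2"
    by (intro mult_right_mono) (auto simp: s_def)
  also have "\<dots> \<le> e" using e by (simp add: field_simps add_pos_nonneg)
  finally have se: "s * (dist u k)\<^sup>2 \<le> e" .
  have "geo u k s \<in> K" using K u k s by (auto simp: gconvex_def nearest_in_def)
  then have "dist x u \<le> dist x (geo u k s)" using u by (auto simp: nearest_in_def)
  then have "(dist x u)\<^sup>2 \<le> (dist x (geo u k s))\<^sup>2" by (intro power_mono) auto
  also have "\<dots> \<le> (1 - s) * (dist x u)\<^sup>2 + s * (dist x k)\<^sup>2 - s * (1 - s) * (dist u k)\<^sup>2"
    using s by (intro CN) auto
  finally have "0 \<le> s * ((dist x k)\<^sup>2 - (dist x u)\<^sup>2 - (1 - s) * (dist u k)\<^sup>2)"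
    by (simp add: algebra_simps)
  then have "0 \<le> (dist x k)\<^sup>2 - (dist x u)\<^sup>2 - (1 - s) * (dist u k)\<^sup>2"
    using s by (simp add: zero_le_mult_iff)
  then show "(dist x u)\<^sup>2 + (dist u k)\<^sup>2 \<le> (dist x k)\<^sup>2 + e" using se by (simp add: algebra_simps)
qed

text \<open>Pythagoras at both feet bounds the diagonals of the quadrilateral from below, and
  \<open>four_point\<close> bounds them from above.\<close>

lemma nearest_lipschitz:
  assumes K: "gconvex K" and u: "nearest_in K x u" and v: "nearest_in K y v"
  shows "dist u v \<le> dist x y"
proof -
  have "(dist x u)\<^sup>2 + (dist u v)\<^sup>2 \<le> (dist x v)\<^sup>2" "(dist y v)\<^sup>2 + (dist v u)\<^sup>2 \<le> (dist y u)\<^sup>2"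
    using nearest_pythagoras[OF K u] nearest_pythagoras[OF K v] u v by (auto simp: nearest_in_def)
  moreover have "(dist x v)\<^sup>2 + (dist y u)\<^sup>2
      \<le> (dist x y)\<^sup>2 + (dist y v)\<^sup>2 + (dist v u)\<^sup>2 + (dist u x)\<^sup>2"
    by (rule four_point)
  ultimately have "(dist u v)\<^sup>2 \<le> (dist x y)\<^sup>2"
    unfolding dist_commute[of v u] dist_commute[of u x] by linarith
  then show ?thesis by (rule power2_le_imp_le) simp
qed

end

section \<open>Projection to a geodesic line\<close>

locale cat0_line = cat0_geodesics geo for geo :: "'x::metric_space \<Rightarrow> 'x \<Rightarrow> real \<Rightarrow> 'x" +
  fixes c :: "real \<Rightarrow> 'x"
  assumes line: "geodesic_on UNIV c"
begin

lemma dist_line: "dist (c s) (c t) = \<bar>s - t\<bar>"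
  using line by (simp add: geodesic_on_def)

lemma geo_line: "0 \<le> s \<Longrightarrow> s \<le> 1 \<Longrightarrow> geo (c a) (c b) s = c (a + s * (b - a))"
  by (rule geo_geodesic_on[OF line]) auto

lemma gconvex_line: "gconvex (range c)"
  by (auto simp: gconvex_def geo_line)

lemma nearest_parameter_exists: "\<exists>t. \<forall>s. dist x (c t) \<le> dist x (c s)"
proof -
  \<comment> \<open>Outside this radius the line is at least as far from \<open>x\<close> as
    \<open>c 0\<close> is, so a minimum over the compact interval is a global one.\<close>
  define R where "R = 2 * dist x (c 0)"
  have "continuous_on UNIV c"
    by (rule continuous_on_iff[THEN iffD2]) (metis dist_line dist_real_def)
  then have "continuous_on {-R..R} (\<lambda>t. dist x (c t))"
    by (intro continuous_intros) (auto intro: continuous_on_subset)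
  moreover have "R \<ge> 0" by (simp add: R_def)
  ultimately obtain t where t: "t \<in> {-R..R}" "\<forall>s\<in>{-R..R}. dist x (c t) \<le> dist x (c s)"
    using continuous_attains_inf[of "{-R..R}" "\<lambda>t. dist x (c t)"] by auto
  have "dist x (c t) \<le> dist x (c s)" for s
  proof (cases "s \<in> {-R..R}")
    case False
    then have "2 * dist x (c 0) \<le> dist (c 0) (c s)" by (auto simp: dist_line R_def)
    also have "\<dots> \<le> dist x (c 0) + dist x (c s)" by (rule dist_triangle3)
    finally have "dist x (c 0) \<le> dist x (c s)" by simp
    moreover have "dist x (c t) \<le> dist x (c 0)" using t(2) \<open>R \<ge> 0\<close> by auto
    ultimately show ?thesis by simp
  qed (use t in auto)
  then show ?thesis by blast
qed

text \<open>The foot is recorded by its parameter on the line; \<open>pr_unique\<close> shows that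
  the choice is forced.\<close>

definition pr :: "'x \<Rightarrow> real"
  where "pr x = (SOME t. \<forall>s. dist x (c t) \<le> dist x (c s))"

definition ht :: "'x \<Rightarrow> real"
  where "ht x = dist x (c (pr x))"

lemma ht_le: "ht x \<le> dist x (c t)"
  unfolding ht_def pr_def using someI_ex[OF nearest_parameter_exists[of x]] by blast

lemma ht_nonneg [simp]: "0 \<le> ht x"
  by (simp add: ht_def)

lemma pr_pythagoras: "(ht x)\<^sup>2 + (t - pr x)\<^sup>2 \<le> (dist x (c t))\<^sup>2"
  using nearest_pythagoras[OF gconvex_line, of x "c (pr x)" "c t"] ht_le
  by (auto simp: nearest_in_def ht_def[symmetric] dist_line power2_commute)

lemma pr_unique:
  assumes "dist x (c t) \<le> ht x"
  shows "pr x = t"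
proof -
  have "(dist x (c t))\<^sup>2 \<le> (ht x)\<^sup>2" using assms by (intro power_mono) auto
  then have "(t - pr x)\<^sup>2 \<le> 0" using pr_pythagoras[of x t] by linarith
  then show ?thesis by simp
qed

lemma pr_line [simp]: "pr (c t) = t" and ht_line [simp]: "ht (c t) = 0"
  using ht_le[of "c t" t] ht_nonneg[of "c t"] pr_unique[of "c t" t] by simp_all

lemma pr_lipschitz: "\<bar>pr x - pr y\<bar> \<le> dist x y"
  using nearest_lipschitz[OF gconvex_line, of x "c (pr x)" y "c (pr y)"] ht_le
  by (auto simp: nearest_in_def ht_def[symmetric] dist_line)

lemma ht_lipschitz: "\<bar>ht x - ht y\<bar> \<le> dist x y"
proof -
  have "ht a \<le> dist a b + ht b" for a b
    using ht_le[of a "pr b"] dist_triangle[of a "c (pr b)" b] by (simp add: ht_def[of b])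
  from this[of x y] this[of y x] show ?thesis by (simp add: dist_commute)
qed

lemma dist_le_ht: "dist x (c t) \<le> ht x + \<bar>pr x - t\<bar>"
  using dist_triangle[of x "c t" "c (pr x)"] by (simp add: ht_def dist_line)

lemma dist_ge_pr: "\<bar>pr x - t\<bar> \<le> dist x (c t)"
  using pr_lipschitz[of x "c t"] by simp

lemma dist_le_ht_ht: "dist x y \<le> ht x + ht y + \<bar>pr x - pr y\<bar>"
  using dist_triangle[of x y "c (pr y)"] dist_le_ht[of x "pr y"]
  by (simp add: ht_def[of y] dist_commute)

lemma ht_convex:
  assumes "0 \<le> s" "s \<le> 1"
  shows "ht (geo x y s) \<le> (1 - s) * ht x + s * ht y"
proof -
  have "ht (geo x y s) \<le> dist (geo x y s) (geo (c (pr x)) (c (pr y)) s)"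
    unfolding geo_line[OF assms] by (rule ht_le)
  also have "\<dots> \<le> (1 - s) * ht x + s * ht y"
    unfolding ht_def by (rule geo_convex[OF assms])
  finally show ?thesis .
qed

lemma gconvex_ht: "gconvex {x. ht x \<le> r}"
  unfolding gconvex_def
proof clarsimp
  fix x y and s :: real assume "ht x \<le> r" "ht y \<le> r" "0 \<le> s" "s \<le> 1"
  then show "ht (geo x y s) \<le> r" using ht_convex[of s x y]
    convex_bound_le[of "ht x" r "ht y" "1 - s" s] by simp
qed

lemma nearest_ht:
  assumes "ht u \<le> r" "dist x u \<le> ht x - r"
  shows "nearest_in {x. ht x \<le> r} x u"
proof -
  have "dist x u \<le> dist x k" if "ht k \<le> r" for k
    using that assms ht_lipschitz[of x k] by linarith
  then show ?thesis using assms(1) by (auto simp: nearest_in_def)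
qed

text \<open>The point at height \<open>r\<close> on the perpendicular from the line to
  \<open>x\<close>. If \<open>ht x = 0\<close>, division by zero makes the ratio 0, and the value is
  the foot.\<close>

definition perp :: "'x \<Rightarrow> real \<Rightarrow> 'x"
  where "perp x r = geo (c (pr x)) x (r / ht x)"

lemma
  assumes "0 \<le> r" "r \<le> ht x"
  shows dist_perp: "dist x (perp x r) = ht x - r"
    and ht_perp: "ht (perp x r) = r"
    and pr_perp: "pr (perp x r) = pr x"
proof -
  have s: "0 \<le> r / ht x" "r / ht x \<le> 1" using assms by (auto simp: divide_le_eq)
  have 1: "dist (c (pr x)) (perp x r) = r" using dist_geo_left[OF s, of "c (pr x)" x] assms
    by (cases "ht x = 0") (auto simp: perp_def ht_def[of x] dist_commute)
  show 2: "dist x (perp x r) = ht x - r" using dist_geo_right[OF s, of "c (pr x)" x] assms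
    by (cases "ht x = 0") (auto simp: perp_def ht_def[of x] dist_commute field_simps)
  show 3: "ht (perp x r) = r"
    using 1 2 ht_le[of "perp x r" "pr x"] ht_lipschitz[of x "perp x r"] by (simp add: dist_commute)
  show "pr (perp x r) = pr x" using 1 3 by (intro pr_unique) (simp add: dist_commute)
qed

lemma nearest_perp:
  assumes "0 \<le> r" "r \<le> ht x"
  shows "nearest_in {x. ht x \<le> r} x (perp x r)"
  using assms by (intro nearest_ht) (auto simp: ht_perp dist_perp)

lemma perp_lipschitz:
  assumes "0 \<le> r" "r \<le> ht x" "r \<le> ht y"
  shows "dist (perp x r) (perp y r) \<le> dist x y"
  using assms by (intro nearest_lipschitz[OF gconvex_ht[of r]] nearest_perp)

lemma dist_perp_perp:
  assumes "0 \<le> r" "r \<le> ht x" "0 \<le> s" "s \<le> ht x"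
  shows "dist (perp x r) (perp x s) = \<bar>r - s\<bar>"
proof (cases "ht x = 0")
  case False
  then have h: "ht x > 0" using ht_nonneg[of x] by linarith
  then have "\<bar>r / ht x - s / ht x\<bar> * ht x = \<bar>r - s\<bar>"
    by (simp flip: diff_divide_distrib)
  then show ?thesis unfolding perp_def using assms h
    by (subst geo_dist) (auto simp: ht_def[symmetric] dist_commute[of "c (pr x)"])
qed (use assms in auto)

text \<open>\<open>H\<close> interpolates horizontally between the two perpendicular rays, and every
  curvature inequality is forced to be an equality. Lower bounds come from projecting to the convex
  sets where \<open>ht\<close> is at most \<open>r\<close>; upper bounds come from
  \<open>four_point\<close>.\<close>

lemma flat_half_strip:
  assumes ab: "a < b"
    and ray: "geodesic_on {0..} \<rho>" "geodesic_on {0..} \<rho>'"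
    and h: "\<And>r. 0 \<le> r \<Longrightarrow> ht (\<rho> r) = r" "\<And>r. 0 \<le> r \<Longrightarrow> ht (\<rho>' r) = r"
    and p: "\<And>r. 0 \<le> r \<Longrightarrow> pr (\<rho> r) = a" "\<And>r. 0 \<le> r \<Longrightarrow> pr (\<rho>' r) = b"
    and d: "\<And>r. 0 \<le> r \<Longrightarrow> dist (\<rho> r) (\<rho>' r) = b - a"
  shows "\<exists>H. (\<forall>u\<in>{a..b}. H u 0 = c u) \<and>
     (\<forall>u\<in>{a..b}. \<forall>u'\<in>{a..b}. \<forall>r\<ge>0. \<forall>r'\<ge>0.
        (dist (H u r) (H u' r'))\<^sup>2 = (u - u')\<^sup>2 + (r - r')\<^sup>2)"
proof -
  define l where "l u = (u - a) / (b - a)" for u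
  define H where "H u r = geo (\<rho> r) (\<rho>' r) (l u)" for u r
  have l: "0 \<le> l u" "l u \<le> 1" if "u \<in> {a..b}" for u
    using that ab by (auto simp: l_def)
  have lba: "l u * (b - a) = u - a" for u using ab by (simp add: l_def)
  have rr: "dist (\<rho> r) (\<rho> r') = \<bar>r - r'\<bar>" "dist (\<rho>' r) (\<rho>' r') = \<bar>r - r'\<bar>"
    if "r \<ge> 0" "r' \<ge> 0" for r r' using ray that by (auto simp: geodesic_on_def)
  have horiz: "dist (H u r) (H u' r) = \<bar>u - u'\<bar>" if "u \<in> {a..b}" "u' \<in> {a..b}" "r \<ge> 0" for u u' r
  proof -
    have "\<bar>l u - l u'\<bar> * (b - a) = \<bar>(l u - l u') * (b - a)\<bar>" using ab by (simp add: abs_mult)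
    also have "\<dots> = \<bar>u - u'\<bar>" by (simp add: left_diff_distrib lba)
    finally show ?thesis
      unfolding H_def using geo_dist[OF l[OF that(1)] l[OF that(2)]] that(3) by (simp add: d)
  qed
  have vert_le: "dist (H u r) (H u r') \<le> \<bar>r - r'\<bar>" if "u \<in> {a..b}" "r \<ge> 0" "r' \<ge> 0" for u r r'
    using geo_convex[OF l[OF that(1)], of "\<rho> r" "\<rho>' r" "\<rho> r'" "\<rho>' r'"] that
    by (simp add: H_def rr algebra_simps)
  have base: "H u 0 = c u" if u: "u \<in> {a..b}" for u
  proof -
    have "\<rho> 0 = c a" "\<rho>' 0 = c b" using h[of 0] p[of 0] by (simp_all add: ht_def)
    then show ?thesis unfolding H_def using geo_line[OF l[OF u]] lba by simp
  qed
  \<comment> \<open>Pythagoras at the two lower corners bounds each diagonal from below;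
    \<open>four_point\<close> bounds the sum of their squares by exactly the sum of these
    bounds.\<close>
  have diag: "(dist (\<rho> r') (\<rho>' r))\<^sup>2 = (r' - r)\<^sup>2 + (b - a)\<^sup>2" if r: "0 \<le> r" "r \<le> r'" for r r'
  proof -
    have "nearest_in {x. ht x \<le> r} (\<rho> r') (\<rho> r)" "nearest_in {x. ht x \<le> r} (\<rho>' r') (\<rho>' r)"
      using r by (auto intro!: nearest_ht simp: h rr)
    from this[THEN nearest_pythagoras[OF gconvex_ht]]
    have "(dist (\<rho> r') (\<rho> r))\<^sup>2 + (dist (\<rho> r) (\<rho>' r))\<^sup>2 \<le> (dist (\<rho> r') (\<rho>' r))\<^sup>2"
       "(dist (\<rho>' r') (\<rho>' r))\<^sup>2 + (dist (\<rho>' r) (\<rho> r))\<^sup>2 \<le> (dist (\<rho>' r') (\<rho> r))\<^sup>2"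
      using r by (auto simp: h)
    moreover have "(dist (\<rho> r') (\<rho>' r))\<^sup>2 + (dist (\<rho>' r') (\<rho> r))\<^sup>2 \<le>
        (dist (\<rho> r') (\<rho>' r'))\<^sup>2 + (dist (\<rho>' r') (\<rho>' r))\<^sup>2 + (dist (\<rho>' r) (\<rho> r))\<^sup>2 + (dist (\<rho> r) (\<rho> r'))\<^sup>2"
      by (rule four_point)
    ultimately show ?thesis using r d[of r] d[of r'] by (simp add: rr dist_commute power2_commute)
  qed
  have side: "(dist (H u r) (\<rho> r'))\<^sup>2 \<le> (u - a)\<^sup>2 + (r' - r)\<^sup>2"
    if u: "u \<in> {a..b}" and r: "0 \<le> r" "r \<le> r'" for u r r'
  proof -
    have "(dist (\<rho> r') (H u r))\<^sup>2 \<le> (1 - l u) * (r' - r)\<^sup>2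
        + l u * ((r' - r)\<^sup>2 + (b - a)\<^sup>2) - l u * (1 - l u) * (b - a)\<^sup>2"
      unfolding H_def using CN[OF l[OF u], of "\<rho> r'" "\<rho> r" "\<rho>' r"] r by (simp add: rr diag d)
    also have "\<dots> = (l u * (b - a))\<^sup>2 + (r' - r)\<^sup>2" by (simp add: power2_eq_square algebra_simps)
    finally show ?thesis by (simp add: lba dist_commute)
  qed
  \<comment> \<open>A Busemann type estimate: \<open>\<rho> (t + r)\<close> is at distance at least
    \<open>t + r\<close> from \<open>c u\<close>, whereas its distance to \<open>H u r\<close>
    exceeds \<open>t\<close> by an arbitrarily small amount when \<open>t\<close> is large. The
    chosen \<open>t\<close> satisfies \<open>w \<le> 2 * t * e\<close>.\<close>
  have vert_ge: "r \<le> dist (c u) (H u r)" if u: "u \<in> {a..b}" and r: "0 \<le> r" for u r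
  proof (rule field_le_epsilon)
    fix e :: real assume e: "e > 0"
    define w where "w = (u - a)\<^sup>2"
    define t where "t = w / e + 1"
    have w: "w \<ge> 0" by (simp add: w_def)
    have t: "t > 0" using e w by (simp add: t_def add_nonneg_pos)
    have "(t + r)\<^sup>2 \<le> (dist (\<rho> (t + r)) (c u))\<^sup>2"
      using pr_pythagoras[of "\<rho> (t + r)" u] h(1)[of "t + r"] r t
      by (smt (verit) zero_le_power2)
    then have "t + r \<le> dist (\<rho> (t + r)) (c u)" by (rule power2_le_imp_le) simp
    also have "\<dots> \<le> dist (c u) (H u r) + dist (H u r) (\<rho> (t + r))"
      using dist_triangle[of "c u" "\<rho> (t + r)" "H u r"] by (simp add: dist_commute)
    also have "dist (H u r) (\<rho> (t + r)) \<le> t + e"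
    proof (rule power2_le_imp_le)
      have "(dist (H u r) (\<rho> (t + r)))\<^sup>2 \<le> w + t\<^sup>2" using side[OF u r, of "t + r"] t by (simp add: w_def)
      also have "w \<le> 2 * t * e" using e w by (simp add: t_def field_simps)
      also have "2 * t * e + t\<^sup>2 \<le> (t + e)\<^sup>2" by (simp add: power2_sum)
      finally show "(dist (H u r) (\<rho> (t + r)))\<^sup>2 \<le> (t + e)\<^sup>2" by simp
    qed (use t e in auto)
    finally show "r \<le> dist (c u) (H u r) + e" by simp
  qed
  have prH: "pr (H u r) = u" if u: "u \<in> {a..b}" and r: "0 \<le> r" for u r
  proof -
    have "H a r = \<rho> r" "H b r = \<rho>' r" using ab by (simp_all add: H_def l_def)
    then have "dist (H u r) (\<rho> r) = u - a" "dist (H u r) (\<rho>' r) = b - u"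
      using horiz[OF u _ r, of a] horiz[OF u _ r, of b] u ab by auto
    then show ?thesis
      using pr_lipschitz[of "H u r" "\<rho> r"] pr_lipschitz[of "H u r" "\<rho>' r"] p r by auto
  qed
  have htH: "ht (H u r) = r" if u: "u \<in> {a..b}" and r: "0 \<le> r" for u r
    using prH[OF u r] vert_ge[OF u r] vert_le[OF u r, of 0] base[OF u] r
    by (simp add: ht_def dist_commute)
  have lower: "(u - u')\<^sup>2 + (r - r')\<^sup>2 \<le> (dist (H u r) (H u' r'))\<^sup>2"
    if u: "u \<in> {a..b}" "u' \<in> {a..b}" and r: "0 \<le> r" "r \<le> r'" for u u' r r'
  proof -
    have n: "nearest_in {x. ht x \<le> r} (H u' r') (H u' r)"
      using vert_le[of u' r r'] u r by (intro nearest_ht) (auto simp: htH dist_commute)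
    have "(r - r')\<^sup>2 \<le> (dist (H u' r') (H u' r))\<^sup>2"
      unfolding power2_commute[of r]
      using ht_lipschitz[of "H u' r'" "H u' r"] u r by (intro power_mono) (auto simp: htH)
    moreover have "(dist (H u' r') (H u' r))\<^sup>2 + (u - u')\<^sup>2 \<le> (dist (H u r) (H u' r'))\<^sup>2"
      using nearest_pythagoras[OF gconvex_ht n, of "H u r"] u r horiz[of u' u r]
      by (simp add: htH dist_commute power2_commute)
    ultimately show ?thesis by linarith
  qed
  have eq: "(dist (H u r) (H u' r'))\<^sup>2 = (u - u')\<^sup>2 + (r - r')\<^sup>2"
    if u: "u \<in> {a..b}" "u' \<in> {a..b}" and r: "0 \<le> r" "r \<le> r'" for u u' r r'
  proof -
    have "(dist (H u r) (H u' r'))\<^sup>2 + (dist (H u' r) (H u r'))\<^sup>2 \<le>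
       (dist (H u r) (H u' r))\<^sup>2 + (dist (H u' r) (H u' r'))\<^sup>2
       + (dist (H u' r') (H u r'))\<^sup>2 + (dist (H u r') (H u r))\<^sup>2"
      by (rule four_point)
    moreover have "(dist (H u' r) (H u' r'))\<^sup>2 \<le> (r - r')\<^sup>2" "(dist (H u r') (H u r))\<^sup>2 \<le> (r - r')\<^sup>2"
      using vert_le[of u' r r'] vert_le[of u r' r] u r
      by (auto simp: power2_commute[of r r'] intro!: power_mono)
    ultimately show ?thesis using lower[OF u r] lower[OF u(2,1) r] horiz[of u u' r] horiz[of u' u r'] u r
      by (simp add: power2_commute[of u' u])
  qed
  show ?thesis
  proof (intro exI[of _ H] conjI ballI allI impI)
    fix u u' r r' :: real assume *: "u \<in> {a..b}" "u' \<in> {a..b}" "0 \<le> r" "0 \<le> r'"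
    show "(dist (H u r) (H u' r'))\<^sup>2 = (u - u')\<^sup>2 + (r - r')\<^sup>2"
    proof (cases "r \<le> r'")
      case False
      then show ?thesis using eq[of u' u r' r] * by (simp add: dist_commute power2_commute)
    qed (use * eq in auto)
  qed (rule base)
qed

end

section \<open>Limits along ultrafilters\<close>

lemma ultrafilter_limit:
  assumes u: "nonprincipal_ultrafilter \<omega>" and K: "compact K" and ev: "eventually (\<lambda>n. f n \<in> K) \<omega>"
  shows "\<exists>l. (f \<longlongrightarrow> l) \<omega>"
proof -
  have ne: "\<omega> \<noteq> bot" and um: "\<And>P. eventually P \<omega> \<or> eventually (\<lambda>n. \<not> P n) \<omega>"
    using u by (auto simp: nonprincipal_ultrafilter_def)
  have "filtermap f \<omega> \<noteq> bot" using ne by (simp add: filtermap_bot_iff)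
  moreover have "eventually (\<lambda>x. x \<in> K) (filtermap f \<omega>)" using ev by (simp add: eventually_filtermap)
  ultimately obtain l where l: "l \<in> K" "inf (nhds l) (filtermap f \<omega>) \<noteq> bot"
    using K unfolding compact_filter by blast
  have "eventually (\<lambda>n. f n \<in> U) \<omega>" if U: "open U" "l \<in> U" for U
  proof (rule ccontr)
    assume "\<not> ?thesis"
    then have "eventually (\<lambda>n. f n \<notin> U) \<omega>" using um by blast
    then have "eventually (\<lambda>x. x \<notin> U) (filtermap f \<omega>)" by (simp add: eventually_filtermap)
    moreover have "eventually (\<lambda>x. x \<in> U) (nhds l)" using U eventually_nhds by blast
    ultimately have "eventually (\<lambda>x. False) (inf (nhds l) (filtermap f \<omega>))"
      unfolding eventually_inf by blast
    then show False using l(2) by (simp add: eventually_False)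
  qed
  then show ?thesis by (auto simp: tendsto_def)
qed

lemma nonprincipal_le_sequentially:
  assumes u: "nonprincipal_ultrafilter \<omega>"
  shows "\<omega> \<le> sequentially"
proof -
  have ne: "\<omega> \<noteq> bot" and um: "\<And>P. eventually P \<omega> \<or> eventually (\<lambda>n. \<not> P n) \<omega>"
    and np: "\<And>n. \<omega> \<noteq> principal {n}"
    using u by (auto simp: nonprincipal_ultrafilter_def)
  have *: "eventually (\<lambda>n. n \<noteq> k) \<omega>" for k
  proof (rule ccontr)
    assume "\<not> ?thesis"
    then have k: "eventually (\<lambda>n. n = k) \<omega>" using um[of "\<lambda>n. n = k"] by simp
    have "principal {k} \<le> \<omega>"
    proof (rule filter_leI)
      fix P assume P: "eventually P \<omega>"
      have "P k" using eventually_happens'[OF ne eventually_conj[OF P k]] by blast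
      then show "eventually P (principal {k})" by (simp add: eventually_principal)
    qed
    moreover have "\<omega> \<le> principal {k}" using k by (simp add: le_principal)
    ultimately have "\<omega> = principal {k}" by (rule order.antisym[rotated])
    then show False using np by blast
  qed
  have "eventually (\<lambda>n. k \<le> n) \<omega>" for k
  proof (induction k)
    case (Suc k)
    from eventually_conj[OF Suc *[of k]] show ?case by (rule eventually_mono) auto
  qed simp
  then show ?thesis
    by (intro filter_leI) (metis (mono_tags, lifting) eventually_mono eventually_sequentially)
qed

section \<open>Periodic lines that do not bound a flat half-plane\<close>

text \<open>\<open>T i\<close> will be the action of \<open>h [^] i\<close>. It enters only through
  its being isometric and its effect on \<open>c\<close>, so that the reversed line with
  \<open>T (- i)\<close> is again an instance, and statements about one end hold for the
  other.\<close>

locale periodic_line = cat0_line geo c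
  for geo :: "'x::metric_space \<Rightarrow> 'x \<Rightarrow> real \<Rightarrow> 'x" and c +
  fixes T :: "int \<Rightarrow> 'x \<Rightarrow> 'x" and \<tau> :: real and \<omega> :: "nat filter"
  assumes T_isom: "dist (T i x) (T i y) = dist x y"
    and T_line: "T i (c t) = c (t + of_int i * \<tau>)"
    and period_pos: "0 < \<tau>"
    and ultra: "nonprincipal_ultrafilter \<omega>"
    and proper: "proper_space TYPE('x)"
    and no_half_plane: "\<not> bounds_flat_half_plane c"
begin

lemma ultra_ne: "\<omega> \<noteq> bot"
  using ultra by (simp add: nonprincipal_ultrafilter_def)

lemma ultra_ge: "eventually (\<lambda>n. r \<le> real n) \<omega>"
proof -
  have "eventually (\<lambda>n. nat \<lceil>r\<rceil> \<le> n) \<omega>"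
    using nonprincipal_le_sequentially[OF ultra] eventually_ge_at_top filter_leD by blast
  then show ?thesis by (rule eventually_mono) linarith
qed

lemma bounded_ultra_limit:
  assumes "eventually (\<lambda>n. dist (f n) p \<le> R) \<omega>"
  shows "\<exists>l :: 'x. (f \<longlongrightarrow> l) \<omega>"
proof (rule ultrafilter_limit[OF ultra])
  show "compact (cball p R)" using proper by (simp add: proper_space_def)
  show "eventually (\<lambda>n. f n \<in> cball p R) \<omega>" using assms by (simp add: dist_commute)
qed

lemma T_ht_pr: "ht (T i x) = ht x" "pr (T i x) = pr x + of_int i * \<tau>"
proof -
  have *: "dist (T i x) (c t) = dist x (c (t - of_int i * \<tau>))" for t
    using T_isom[of i x "c (t - of_int i * \<tau>)"] by (simp add: T_line)
  have le: "ht x \<le> ht (T i x)" unfolding ht_def[of "T i x"] * by (rule ht_le)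
  have ge: "dist (T i x) (c (pr x + of_int i * \<tau>)) = ht x" unfolding * by (simp add: ht_def)
  show "pr (T i x) = pr x + of_int i * \<tau>" using le ge by (intro pr_unique) simp
  show "ht (T i x) = ht x" using le ge ht_le[of "T i x" "pr x + of_int i * \<tau>"] by simp
qed

lemma translate_into_period: "\<exists>i. 0 \<le> t + of_int i * \<tau> \<and> t + of_int i * \<tau> \<le> \<tau>"
proof -
  have "of_int \<lfloor>t / \<tau>\<rfloor> * \<tau> \<le> t / \<tau> * \<tau>" "t / \<tau> * \<tau> \<le> (of_int \<lfloor>t / \<tau>\<rfloor> + 1) * \<tau>"
    using period_pos by (intro mult_right_mono; linarith)+
  then show ?thesis using period_pos
    by (intro exI[of _ "- \<lfloor>t / \<tau>\<rfloor>"]) (simp add: algebra_simps)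
qed

lemma tendsto_ht: "(f \<longlongrightarrow> l) F \<Longrightarrow> ((\<lambda>n. ht (f n)) \<longlongrightarrow> ht l) F"
  and tendsto_pr: "(f \<longlongrightarrow> l) F \<Longrightarrow> ((\<lambda>n. pr (f n)) \<longlongrightarrow> pr l) F"
  by (erule metric_tendsto_imp_tendsto, simp add: dist_real_def ht_lipschitz pr_lipschitz)+

section \<open>Flat half-strips as ultralimits, and contraction\<close>

lemma tendsto_dist_eqI:
  assumes "(f \<longlongrightarrow> x) \<omega>" "(Y \<longlongrightarrow> y) \<omega>" "eventually (\<lambda>n. dist (f n) (Y n) = r) \<omega>"
  shows "dist x y = r"
  using tendsto_unique[OF ultra_ne tendsto_dist[OF assms(1,2)] tendsto_eventually[OF assms(3)]] .

lemma wide_half_strip: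
  assumes L: "L > 0"
    and bad: "\<And>r. \<exists>z z'. r \<le> ht z \<and> r \<le> ht z' \<and> dist z z' \<le> D \<and> L \<le> \<bar>pr z - pr z'\<bar>"
  shows "\<exists>a b H. L \<le> b - a \<and> (\<forall>u\<in>{a..b}. H u 0 = c u) \<and>
     (\<forall>u\<in>{a..b}. \<forall>u'\<in>{a..b}. \<forall>r\<ge>0. \<forall>r'\<ge>0.
        (dist (H u r) (H u' r'))\<^sup>2 = (u - u')\<^sup>2 + (r - r')\<^sup>2)"
proof -
  \<comment> \<open>A power of the translation brings the foot of \<open>z\<close> into one period.
    The feet then stay in compact intervals, and the perpendiculars stay bounded at each fixed
    height.\<close>
  have "\<exists>z z'. r \<le> ht z \<and> r \<le> ht z' \<and> dist z z' \<le> D \<and> L \<le> pr z' - pr z \<and> 0 \<le> pr z \<and> pr z \<le> \<tau>" for r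
  proof -
    obtain z z' where z: "r \<le> ht z" "r \<le> ht z'" "dist z z' \<le> D" "L \<le> pr z' - pr z"
      using bad[of r] by (metis abs_real_def dist_commute minus_diff_eq)
    obtain i where "0 \<le> pr z + of_int i * \<tau>" "pr z + of_int i * \<tau> \<le> \<tau>"
      using translate_into_period by blast
    then show ?thesis using z by (intro exI[of _ "T i z"] exI[of _ "T i z'"]) (simp add: T_ht_pr T_isom)
  qed
  then obtain Z Z' where Z: "r \<le> ht (Z r)" "r \<le> ht (Z' r)" "dist (Z r) (Z' r) \<le> D"
      "L \<le> pr (Z' r) - pr (Z r)" "0 \<le> pr (Z r)" "pr (Z r) \<le> \<tau>" for r
    by metis
  have pZ': "pr (Z' r) \<in> {0..\<tau> + D}" for r
    using Z[of r] pr_lipschitz[of "Z r" "Z' r"] L by auto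
  obtain a where a: "((\<lambda>n. pr (Z (real n))) \<longlongrightarrow> a) \<omega>"
    using ultrafilter_limit[OF ultra, of "{0..\<tau>}" "\<lambda>n. pr (Z (real n))"] Z by auto
  obtain b where b: "((\<lambda>n. pr (Z' (real n))) \<longlongrightarrow> b) \<omega>"
    using ultrafilter_limit[OF ultra, of "{0..\<tau> + D}" "\<lambda>n. pr (Z' (real n))"] pZ' by auto
  have ab: "L \<le> b - a"
    by (rule tendsto_lowerbound[OF tendsto_diff[OF b a] _ ultra_ne]) (use Z in auto)
  have lim: "\<exists>l. 0 \<le> r \<longrightarrow> ((\<lambda>n. perp (Y (real n)) r) \<longlongrightarrow> l) \<omega>"
    if Y: "\<And>n. n \<le> ht (Y n)" "\<And>n. pr (Y n) \<in> {0..M}" for Y :: "real \<Rightarrow> 'x" and M r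
  proof (cases "0 \<le> r")
    case True
    have "eventually (\<lambda>n. dist (perp (Y (real n)) r) (c 0) \<le> r + M) \<omega>"
      using ultra_ge[of r]
    proof (rule eventually_mono)
      fix n assume "r \<le> real n"
      then have r: "r \<le> ht (Y (real n))" using Y(1)[of "real n"] by simp
      show "dist (perp (Y (real n)) r) (c 0) \<le> r + M"
        using dist_le_ht[of "perp (Y (real n)) r" 0] True r Y(2)[of "real n"]
        by (simp add: ht_perp pr_perp)
    qed
    then show ?thesis using bounded_ultra_limit[of "\<lambda>n. perp (Y (real n)) r"] by blast
  qed simp
  obtain \<rho> where \<rho>: "\<And>r. 0 \<le> r \<Longrightarrow> ((\<lambda>n. perp (Z (real n)) r) \<longlongrightarrow> \<rho> r) \<omega>"
    using lim[of Z \<tau>] Z by (metis atLeastAtMost_iff)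
  obtain \<rho>' where \<rho>': "\<And>r. 0 \<le> r \<Longrightarrow> ((\<lambda>n. perp (Z' (real n)) r) \<longlongrightarrow> \<rho>' r) \<omega>"
    using lim[of Z' "\<tau> + D"] Z pZ' by metis
  have props: "geodesic_on {0..} \<sigma> \<and> (\<forall>r\<ge>0. ht (\<sigma> r) = r \<and> pr (\<sigma> r) = p)"
    if Y: "\<And>n. n \<le> ht (Y n)" and p: "((\<lambda>n. pr (Y (real n))) \<longlongrightarrow> p) \<omega>"
      and \<sigma>: "\<And>r. 0 \<le> r \<Longrightarrow> ((\<lambda>n. perp (Y (real n)) r) \<longlongrightarrow> \<sigma> r) \<omega>"
    for Y :: "real \<Rightarrow> 'x" and p \<sigma>
  proof (intro conjI allI impI)
    have ev: "eventually (\<lambda>n. r \<le> ht (Y (real n))) \<omega>" for r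
      by (rule eventually_mono[OF ultra_ge[of r]]) (use Y order_trans in blast)
    show "geodesic_on {0..} \<sigma>" unfolding geodesic_on_def
    proof (intro ballI)
      fix s t :: real assume st: "s \<in> {0..}" "t \<in> {0..}"
      show "dist (\<sigma> s) (\<sigma> t) = \<bar>s - t\<bar>"
      proof (rule tendsto_dist_eqI)
        show "eventually (\<lambda>n. dist (perp (Y (real n)) s) (perp (Y (real n)) t) = \<bar>s - t\<bar>) \<omega>"
          using eventually_conj[OF ev[of s] ev[of t]]
          by (rule eventually_mono) (use st dist_perp_perp in auto)
      qed (use st \<sigma> in auto)
    qed
    fix r :: real assume r: "0 \<le> r"
    have "eventually (\<lambda>n. ht (perp (Y (real n)) r) = r) \<omega>"
      using ev[of r] by (rule eventually_mono) (use r ht_perp in auto)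
    from tendsto_unique[OF ultra_ne tendsto_ht[OF \<sigma>[OF r]] tendsto_eventually[OF this]]
    show "ht (\<sigma> r) = r" .
    have "eventually (\<lambda>n. pr (perp (Y (real n)) r) = pr (Y (real n))) \<omega>"
      using ev[of r] by (rule eventually_mono) (use r pr_perp in auto)
    from tendsto_cong[OF this] p have "((\<lambda>n. pr (perp (Y (real n)) r)) \<longlongrightarrow> p) \<omega>"
      by simp
    from tendsto_unique[OF ultra_ne tendsto_pr[OF \<sigma>[OF r]] this] show "pr (\<sigma> r) = p" .
  qed
  have P: "geodesic_on {0..} \<rho>" "\<And>r. 0 \<le> r \<Longrightarrow> ht (\<rho> r) = r" "\<And>r. 0 \<le> r \<Longrightarrow> pr (\<rho> r) = a"
    using props[of Z, OF _ a \<rho>] Z by auto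
  have P': "geodesic_on {0..} \<rho>'" "\<And>r. 0 \<le> r \<Longrightarrow> ht (\<rho>' r) = r" "\<And>r. 0 \<le> r \<Longrightarrow> pr (\<rho>' r) = b"
    using props[of Z', OF _ b \<rho>'] Z by auto
  have dD: "dist (\<rho> r) (\<rho>' r) \<le> D" if r: "0 \<le> r" for r
  proof (rule tendsto_upperbound[OF tendsto_dist[OF \<rho>[OF r] \<rho>'[OF r]] _ ultra_ne])
    show "eventually (\<lambda>n. dist (perp (Z (real n)) r) (perp (Z' (real n)) r) \<le> D) \<omega>"
      using ultra_ge[of r]
    proof (rule eventually_mono)
      fix n assume "r \<le> real n"
      then show "dist (perp (Z (real n)) r) (perp (Z' (real n)) r) \<le> D"
        using perp_lipschitz[OF r, of "Z (real n)" "Z' (real n)"] Z[of "real n"] by linarith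
    qed
  qed
  \<comment> \<open>The projection gives the lower bound. For the upper bound, the distance between
    the rays is convex and bounded by \<open>D\<close>, so it cannot exceed its initial value
    \<open>b - a\<close>; \<open>R\<close> is so large that the chord up to \<open>R\<close>
    contributes at most \<open>e\<close> at \<open>r\<close>.\<close>
  have d: "dist (\<rho> r) (\<rho>' r) = b - a" if r: "0 \<le> r" for r
  proof (rule antisym)
    show "b - a \<le> dist (\<rho> r) (\<rho>' r)"
      using pr_lipschitz[of "\<rho> r" "\<rho>' r"] P(3)[OF r] P'(3)[OF r] by simp
    have "\<rho> 0 = c a" "\<rho>' 0 = c b" using P(2,3)[of 0] P'(2,3)[of 0] by (simp_all add: ht_def)
    then have d0: "dist (\<rho> 0) (\<rho>' 0) = b - a" using ab L by (simp add: dist_line)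
    show "dist (\<rho> r) (\<rho>' r) \<le> b - a"
    proof (rule field_le_epsilon)
      fix e :: real assume e: "e > 0"
      have D: "D \<ge> 0" using dD[of 0] d0 ab L by simp
      define R where "R = r * D / e + r + 1"
      have R: "R > 0" "r \<le> R" "r * D \<le> e * R"
        using r D e by (auto simp: R_def distrib_left intro!: add_nonneg_pos)
      have s: "0 \<le> r / R" "r / R \<le> 1" using R r by auto
      have "geo (\<rho> 0) (\<rho> R) (r / R) = \<rho> r" "geo (\<rho>' 0) (\<rho>' R) (r / R) = \<rho>' r"
        using geo_geodesic_on[OF P(1), of 0 R "r / R"] geo_geodesic_on[OF P'(1), of 0 R "r / R"] R r s
        by auto
      then have "dist (\<rho> r) (\<rho>' r) \<le> (1 - r / R) * dist (\<rho> 0) (\<rho>' 0) + r / R * dist (\<rho> R) (\<rho>' R)"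
        using geo_convex[OF s] by metis
      also have "\<dots> \<le> 1 * (b - a) + r / R * D"
        using s dD[of R] R ab L unfolding d0 by (intro add_mono mult_mono) auto
      also have "r / R * D \<le> e" using R by (simp add: field_simps)
      finally show "dist (\<rho> r) (\<rho>' r) \<le> b - a + e" by simp
    qed
  qed
  have "a < b" using ab L by simp
  from flat_half_strip[OF this P(1) P'(1) P(2) P'(2) P(3) P'(3) d] ab show ?thesis by blast
qed

lemma strong_contraction:
  "\<exists>L>0. \<forall>D. \<exists>R>0. \<forall>z z'. R \<le> ht z \<and> R \<le> ht z' \<and> dist z z' \<le> D \<longrightarrow> \<bar>pr z - pr z'\<bar> < L"
proof (rule ccontr)
  assume neg: "\<not> ?thesis"
  have bad: "\<exists>D. \<forall>r. \<exists>z z'. r \<le> ht z \<and> r \<le> ht z' \<and> dist z z' \<le> D \<and> L \<le> \<bar>pr z - pr z'\<bar>" if L: "L > 0" for L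
  proof -
    obtain D where D: "\<And>R. R > 0 \<Longrightarrow>
        \<exists>z z'. R \<le> ht z \<and> R \<le> ht z' \<and> dist z z' \<le> D \<and> L \<le> \<bar>pr z - pr z'\<bar>"
      using neg L by (metis not_less)
    have "\<exists>z z'. r \<le> ht z \<and> r \<le> ht z' \<and> dist z z' \<le> D \<and> L \<le> \<bar>pr z - pr z'\<bar>" for r
      using D[of "max r 1"] by (meson max.boundedE max.strict_coboundedI2 zero_less_one)
    then show ?thesis by blast
  qed
  have "\<exists>H. (\<forall>u\<in>{-n..n}. H u 0 = c u) \<and>
     (\<forall>u\<in>{-n..n}. \<forall>u'\<in>{-n..n}. \<forall>r\<ge>0. \<forall>r'\<ge>0.
        (dist (H u r) (H u' r'))\<^sup>2 = (u - u')\<^sup>2 + (r - r')\<^sup>2)" if n: "0 \<le> n" for n :: real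
  proof -
    \<comment> \<open>The centre of the strip can only be moved into the interval from 0 to
      \<open>\<tau>\<close>; the additional half-width \<open>\<tau>\<close> makes the strip cover
      \<open>{-n..n}\<close> nevertheless.\<close>
    have pos: "2 * n + 2 * \<tau> > 0" using n period_pos by simp
    obtain a b H where H: "2 * n + 2 * \<tau> \<le> b - a" "\<forall>u\<in>{a..b}. H u 0 = c u"
     "\<forall>u\<in>{a..b}. \<forall>u'\<in>{a..b}. \<forall>r\<ge>0. \<forall>r'\<ge>0.
        (dist (H u r) (H u' r'))\<^sup>2 = (u - u')\<^sup>2 + (r - r')\<^sup>2"
      using bad[OF pos] wide_half_strip[OF pos] by metis
    obtain i where i: "0 \<le> (a + b) / 2 + of_int i * \<tau>" "(a + b) / 2 + of_int i * \<tau> \<le> \<tau>"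
      using translate_into_period by blast
    define H' where "H' u r = T i (H (u - of_int i * \<tau>) r)" for u r
    have in_ab: "u - of_int i * \<tau> \<in> {a..b}" if "u \<in> {-n..n}" for u
      using that H(1) i by (auto simp: field_simps)
    show ?thesis
      by (rule exI[of _ H']) (use H in_ab in \<open>auto simp: H'_def T_isom T_line\<close>)
  qed
  then obtain H where H: "\<And>n u. 0 \<le> n \<Longrightarrow> u \<in> {-n..n} \<Longrightarrow> H n u 0 = c u"
     "\<And>n u u' r r'. 0 \<le> n \<Longrightarrow> u \<in> {-n..n} \<Longrightarrow> u' \<in> {-n..n} \<Longrightarrow> 0 \<le> r \<Longrightarrow> 0 \<le> r' \<Longrightarrow>
        (dist (H n u r) (H n u' r'))\<^sup>2 = (u - u')\<^sup>2 + (r - r')\<^sup>2"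
    by metis
  have H2: "dist (H n u r) (H n u' r') = sqrt ((u - u')\<^sup>2 + (r - r')\<^sup>2)"
    if "0 \<le> n" "u \<in> {-n..n}" "u' \<in> {-n..n}" "0 \<le> r" "0 \<le> r'" for n u u' r r'
    using H(2)[OF that] by (metis real_sqrt_unique zero_le_dist)
  \<comment> \<open>The strips for different \<open>n\<close> need not agree on their common part,
    so the half-plane is a pointwise ultralimit of them and not a union.\<close>
  define F where "F u r = (SOME l. ((\<lambda>n. H (real n) u r) \<longlongrightarrow> l) \<omega>)" for u r
  have F: "((\<lambda>n. H (real n) u r) \<longlongrightarrow> F u r) \<omega>" if r: "0 \<le> r" for u r
  proof -
    have "eventually (\<lambda>n. dist (H (real n) u r) (c 0) \<le> sqrt (u\<^sup>2 + r\<^sup>2)) \<omega>"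
      using ultra_ge[of "\<bar>u\<bar>"]
    proof (rule eventually_mono)
      fix n assume "\<bar>u\<bar> \<le> real n"
      then have "u \<in> {- real n..real n}" by auto
      then show "dist (H (real n) u r) (c 0) \<le> sqrt (u\<^sup>2 + r\<^sup>2)"
        using H(1)[of "real n" 0] H2[of "real n" u 0 r 0] r by auto
    qed
    from someI_ex[OF bounded_ultra_limit[OF this]] show ?thesis by (simp add: F_def)
  qed
  have F_dist: "dist (F u r) (F u' r') = sqrt ((u - u')\<^sup>2 + (r - r')\<^sup>2)" if "0 \<le> r" "0 \<le> r'" for u u' r r'
  proof (rule tendsto_dist_eqI[OF F[OF that(1)] F[OF that(2)]])
    show "eventually (\<lambda>n. dist (H (real n) u r) (H (real n) u' r') = sqrt ((u - u')\<^sup>2 + (r - r')\<^sup>2)) \<omega>"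
      using eventually_conj[OF ultra_ge[of "\<bar>u\<bar>"] ultra_ge[of "\<bar>u'\<bar>"]]
    proof (rule eventually_mono)
      fix n assume "\<bar>u\<bar> \<le> real n \<and> \<bar>u'\<bar> \<le> real n"
      then have "u \<in> {- real n..real n}" "u' \<in> {- real n..real n}" by auto
      then show "dist (H (real n) u r) (H (real n) u' r') = sqrt ((u - u')\<^sup>2 + (r - r')\<^sup>2)"
        using that by (intro H2) auto
    qed
  qed
  have F_base: "F u 0 = c u" for u
  proof -
    have "eventually (\<lambda>n. H (real n) u 0 = c u) \<omega>"
      using ultra_ge[of "\<bar>u\<bar>"] by (rule eventually_mono) (intro H(1), auto)
    from tendsto_unique[OF ultra_ne F tendsto_eventually[OF this]] show ?thesis by simp
  qed
  have "bounds_flat_half_plane c" unfolding bounds_flat_half_plane_def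
  proof (intro exI[of _ "\<lambda>v. F (v $ 1) (v $ 2)"] conjI)
    show "\<forall>v\<in>{v::real^2. 0 \<le> v $ 2}. \<forall>w\<in>{v. 0 \<le> v $ 2}.
        dist (F (v $ 1) (v $ 2)) (F (w $ 1) (w $ 2)) = dist v w"
      by (auto simp: F_dist dist_norm norm_vec_def L2_set_def sum_2)
    have "c u \<in> (\<lambda>v::real^2. F (v $ 1) (v $ 2)) ` {v. v $ 2 = 0}" for u
      by (rule image_eqI[of _ _ "vector [u, 0]"]) (simp_all add: F_base)
    then show "(\<lambda>v::real^2. F (v $ 1) (v $ 2)) ` {v. v $ 2 = 0} = range c"
      by (auto simp: F_base)
  qed
  then show False using no_half_plane by simp
qed

text \<open>The form of contraction for paths that need not be continuous. Because \<open>L\<close>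
  does not depend on \<open>D\<close>, long steps make the projection advance at the small rate
  \<open>L / D\<close>.\<close>

lemma chain_contraction:
  "\<exists>L>0. \<forall>D. \<exists>R>0. \<forall>n z. (\<forall>i\<le>n. R \<le> ht (z i)) \<and> (\<forall>i<n. dist (z i) (z (Suc i)) \<le> D) \<longrightarrow>
     \<bar>pr (z 0) - pr (z n)\<bar> \<le> real n * L"
proof -
  obtain L where L: "L > 0" "\<And>D. \<exists>R>0. \<forall>z z'. R \<le> ht z \<and> R \<le> ht z' \<and> dist z z' \<le> D \<longrightarrow> \<bar>pr z - pr z'\<bar> < L"
    using strong_contraction by blast
  have "\<exists>R>0. \<forall>n z. (\<forall>i\<le>n. R \<le> ht (z i)) \<and> (\<forall>i<n. dist (z i) (z (Suc i)) \<le> D) \<longrightarrow>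
     \<bar>pr (z 0) - pr (z n)\<bar> \<le> real n * L" for D
  proof -
    obtain R where R: "R > 0" "\<And>z z'. R \<le> ht z \<Longrightarrow> R \<le> ht z' \<Longrightarrow> dist z z' \<le> D \<Longrightarrow> \<bar>pr z - pr z'\<bar> < L"
      using L(2) by blast
    have "\<bar>pr (z 0) - pr (z n)\<bar> \<le> real n * L"
      if "\<forall>i\<le>n. R \<le> ht (z i)" "\<forall>i<n. dist (z i) (z (Suc i)) \<le> D" for n z
      using that
    proof (induction n)
      case (Suc n)
      then have "\<bar>pr (z 0) - pr (z n)\<bar> \<le> real n * L" by simp
      moreover have "\<bar>pr (z n) - pr (z (Suc n))\<bar> < L" using Suc.prems by (intro R(2)) auto
      ultimately show ?case by (simp add: algebra_simps)
    qed simp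
    then show ?thesis using R(1) by blast
  qed
  then show ?thesis using L(1) by blast
qed

text \<open>The segment is cut into steps of length at most \<open>K * L\<close>, each of which
  advances the projection by at most \<open>L\<close>. Rounding the number of steps up costs the
  additive \<open>L\<close>.\<close>

lemma geodesic_contraction:
  "\<exists>L>0. \<forall>K>0. \<exists>R>0. \<forall>x y. (\<forall>s\<in>{0..1}. R \<le> ht (geo x y s)) \<longrightarrow>
     \<bar>pr x - pr y\<bar> \<le> dist x y / K + L"
proof -
  obtain L where L: "L > 0" "\<And>D. \<exists>R>0. \<forall>n z. (\<forall>i\<le>n. R \<le> ht (z i)) \<and>
      (\<forall>i<n. dist (z i) (z (Suc i)) \<le> D) \<longrightarrow> \<bar>pr (z 0) - pr (z n)\<bar> \<le> real n * L"
    using chain_contraction by blast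
  have "\<exists>R>0. \<forall>x y. (\<forall>s\<in>{0..1}. R \<le> ht (geo x y s)) \<longrightarrow> \<bar>pr x - pr y\<bar> \<le> dist x y / K + L"
    if K: "K > 0" for K
  proof -
    obtain R where R: "R > 0" "\<And>n z. (\<forall>i\<le>n. R \<le> ht (z i)) \<and>
      (\<forall>i<n. dist (z i) (z (Suc i)) \<le> K * L) \<longrightarrow> \<bar>pr (z 0) - pr (z n)\<bar> \<le> real n * L"
      using L(2) by blast
    have "\<bar>pr x - pr y\<bar> \<le> dist x y / K + L" if h: "\<forall>s\<in>{0..1}. R \<le> ht (geo x y s)" for x y
    proof (cases "x = y")
      case False
      define n where "n = nat \<lceil>dist x y / (K * L)\<rceil>"
      have q: "dist x y / (K * L) > 0" using False K L by simp
      have n: "n > 0" "dist x y / (K * L) \<le> real n" "real n \<le> dist x y / (K * L) + 1"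
        using q by (auto simp: n_def; linarith)+
      define z where "z i = geo x y (real i / real n)" for i
      have "R \<le> ht (z i)" if "i \<le> n" for i using h that n by (auto simp: z_def)
      moreover have "dist (z i) (z (Suc i)) \<le> K * L" if i: "i < n" for i
      proof -
        have "dist (z i) (z (Suc i)) = \<bar>real i / real n - real (Suc i) / real n\<bar> * dist x y"
          unfolding z_def using i by (intro geo_dist) auto
        also have "\<dots> = dist x y / real n" by (simp flip: diff_divide_distrib)
        also have "\<dots> \<le> K * L" using n K L by (simp add: field_simps)
        finally show ?thesis .
      qed
      ultimately have "\<bar>pr (z 0) - pr (z n)\<bar> \<le> real n * L" using R(2)[of n z] by blast
      also have "\<dots> \<le> (dist x y / (K * L) + 1) * L" using n L by (intro mult_right_mono) auto
      also have "\<dots> = dist x y / K + L" using L K by (simp add: field_simps)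
      finally show ?thesis using n by (simp add: z_def)
    qed (use L in simp)
    then show ?thesis using R(1) by blast
  qed
  then show ?thesis using L(1) by blast
qed

end

section \<open>Convex functions of slow growth\<close>

lemma convex_sublinear_le:
  fixes F :: "real \<Rightarrow> real"
  assumes cv: "convex_on {0..} F" and F0: "0 \<le> F 0"
    and sub: "\<And>e T. e > 0 \<Longrightarrow> \<exists>t\<ge>T. F t \<le> e * t" and s: "0 \<le> s"
  shows "F s \<le> F 0"
proof (rule field_le_epsilon)
  fix e :: real assume e: "e > 0"
  \<comment> \<open>The chord from 0 to a far point is nearly horizontal; the factor
    \<open>1 / (s + 1)\<close> makes its rise at \<open>s\<close> at most \<open>e\<close>.
    Smallness at arbitrarily large times suffices, which is all that the scales \<open>d n\<close>
    of a cone provide.\<close>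
  obtain t where t: "t \<ge> s + 1" "F t \<le> e / (s + 1) * t"
    using sub[of "e / (s + 1)" "s + 1"] e s by auto
  have l: "0 \<le> s / t" "s / t \<le> 1" using s t by auto
  have "F s = F ((1 - s / t) *\<^sub>R 0 + (s / t) *\<^sub>R t)" using t s by simp
  also have "\<dots> \<le> (1 - s / t) * F 0 + s / t * F t"
    using l s t by (intro convex_onD[OF cv]) auto
  also have "\<dots> \<le> 1 * F 0 + s / t * (e / (s + 1) * t)"
    using l t F0 by (intro add_mono mult_right_mono mult_left_mono) auto
  also have "s / t * (e / (s + 1) * t) \<le> e" using s t e by (simp add: field_simps)
  finally show "F s \<le> F 0 + e" by simp
qed

lemma convex_bounded_const:
  fixes F :: "real \<Rightarrow> real"
  assumes cv: "convex_on UNIV F" and pos: "\<And>t. 0 \<le> F t" and bd: "\<And>t. F t \<le> B"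
  shows "F s \<le> F t"
proof -
  \<comment> \<open>The sign for which the ray starting at \<open>t\<close> runs through
    \<open>s\<close>.\<close>
  define e :: real where "e = (if t \<le> s then 1 else - 1)"
  have "convex_on {0..} (\<lambda>u. F (t + e * u))"
  proof (rule convex_onI)
    fix l x y :: real assume l: "0 < l" "l < 1"
    have "t + e * ((1 - l) *\<^sub>R x + l *\<^sub>R y) = (1 - l) *\<^sub>R (t + e * x) + l *\<^sub>R (t + e * y)"
      by (simp add: algebra_simps)
    then show "F (t + e * ((1 - l) *\<^sub>R x + l *\<^sub>R y)) \<le> (1 - l) * F (t + e * x) + l * F (t + e * y)"
      using convex_onD[OF cv, of l "t + e * x" "t + e * y"] l by simp
  qed simp
  then have "F (t + e * \<bar>s - t\<bar>) \<le> F (t + e * 0)"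
  proof (rule convex_sublinear_le)
    fix d T :: real assume d: "d > 0"
    have "F (t + e * max T (B / d)) \<le> d * max T (B / d)"
    proof -
      have "B \<le> d * max T (B / d)" using d by (simp add: max_def field_simps)
      then show ?thesis using bd order_trans by blast
    qed
    then show "\<exists>u\<ge>T. F (t + e * u) \<le> d * u" by (intro exI[of _ "max T (B / d)"]) auto
  qed (use pos in auto)
  then show ?thesis by (simp add: e_def split: if_splits)
qed

context cat0_geodesics
begin

lemma convex_on_dist_geodesics:
  fixes \<gamma> \<gamma>' :: "real \<Rightarrow> 'x"
  assumes I: "convex I" and g: "geodesic_on I \<gamma>" "geodesic_on I \<gamma>'"
  shows "convex_on I (\<lambda>t. dist (\<gamma> t) (\<gamma>' t))"
proof (rule convex_onI[OF _ I])
  fix l x y :: real assume l: "0 < l" "l < 1" and xy: "x \<in> I" "y \<in> I"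
  have z: "(1 - l) *\<^sub>R x + l *\<^sub>R y = x + l * (y - x)" by (simp add: algebra_simps)
  then have "x + l * (y - x) \<in> I" using I l xy convexD_alt[of I x y l] by (simp add: z)
  then have "geo (\<gamma> x) (\<gamma> y) l = \<gamma> (x + l * (y - x))" "geo (\<gamma>' x) (\<gamma>' y) l = \<gamma>' (x + l * (y - x))"
    using geo_geodesic_on[OF g(1), of x y l] geo_geodesic_on[OF g(2), of x y l] xy l by auto
  then show "dist (\<gamma> ((1 - l) *\<^sub>R x + l *\<^sub>R y)) (\<gamma>' ((1 - l) *\<^sub>R x + l *\<^sub>R y))
      \<le> (1 - l) * dist (\<gamma> x) (\<gamma>' x) + l * dist (\<gamma> y) (\<gamma>' y)"
    unfolding z using geo_convex[of l "\<gamma> x" "\<gamma> y" "\<gamma>' x" "\<gamma>' y"] l by simp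
qed

end

section \<open>Parallel lines, and geodesics that end on the line\<close>

context periodic_line
begin

text \<open>The height of such a line is bounded and convex, hence constant. Above \<open>R\<close>,
  a step of length \<open>2 * L\<close> would advance the projection by at most \<open>L\<close>,
  although at constant height the projection has to keep pace with arc length up to an additive
  error.\<close>

lemma parallel_line_height:
  "\<exists>R. \<forall>\<gamma> B. geodesic_on UNIV \<gamma> \<and> (\<forall>t. ht (\<gamma> t) \<le> B) \<longrightarrow> (\<forall>t. ht (\<gamma> t) \<le> R)"
proof -
  obtain L where L: "L > 0" "\<And>D. \<exists>R>0. \<forall>n z. (\<forall>i\<le>n. R \<le> ht (z i)) \<and>
      (\<forall>i<n. dist (z i) (z (Suc i)) \<le> D) \<longrightarrow> \<bar>pr (z 0) - pr (z n)\<bar> \<le> real n * L"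
    using chain_contraction by blast
  obtain R where R: "R > 0" "\<And>n z. (\<forall>i\<le>n. R \<le> ht (z i)) \<and>
      (\<forall>i<n. dist (z i) (z (Suc i)) \<le> 2 * L) \<longrightarrow> \<bar>pr (z 0) - pr (z n)\<bar> \<le> real n * L"
    using L(2) by blast
  have "ht (\<gamma> t) \<le> R" if g: "geodesic_on UNIV \<gamma>" and B: "\<forall>t. ht (\<gamma> t) \<le> B" for \<gamma> B t
  proof (rule ccontr)
    assume neg: "\<not> ht (\<gamma> t) \<le> R"
    have "convex_on UNIV (\<lambda>t. ht (\<gamma> t))"
    proof (rule convex_onI)
      fix l x y :: real assume l: "0 < l" "l < 1"
      have "geo (\<gamma> x) (\<gamma> y) l = \<gamma> ((1 - l) *\<^sub>R x + l *\<^sub>R y)"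
        using geo_geodesic_on[OF g, of x y l] l by (simp add: algebra_simps)
      then show "ht (\<gamma> ((1 - l) *\<^sub>R x + l *\<^sub>R y)) \<le> (1 - l) * ht (\<gamma> x) + l * ht (\<gamma> y)"
        using ht_convex[of l "\<gamma> x" "\<gamma> y"] l by simp
    qed simp
    then have const: "ht (\<gamma> s) \<le> ht (\<gamma> t)" for s t
      by (rule convex_bounded_const) (use B in auto)
    define z where "z i = \<gamma> (2 * L * real i)" for i
    have dz: "dist (z i) (z j) = 2 * L * \<bar>real i - real j\<bar>" for i j
    proof -
      have "2 * L * real i - 2 * L * real j = 2 * L * (real i - real j)" by (simp add: algebra_simps)
      then show ?thesis using g L by (simp add: z_def geodesic_on_def abs_mult)
    qed
    have "\<bar>pr (z 0) - pr (z n)\<bar> \<le> real n * L" for n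
    proof -
      have "R \<le> ht (z i)" for i using const[of t "2 * L * real i"] neg by (simp add: z_def)
      then show ?thesis using R(2)[of n z] L by (simp add: dz)
    qed
    moreover have "2 * L * real n \<le> 2 * ht (\<gamma> t) + \<bar>pr (z 0) - pr (z n)\<bar>" for n
    proof -
      have "ht (z 0) \<le> ht (\<gamma> t)" "ht (z n) \<le> ht (\<gamma> t)" using const by (auto simp: z_def)
      then show ?thesis using dist_le_ht_ht[of "z 0" "z n"] by (simp add: dz)
    qed
    ultimately have "2 * L * real n \<le> 2 * ht (\<gamma> t) + real n * L" for n
      by (meson add_left_mono order_trans)
    then have *: "L * real n \<le> 2 * ht (\<gamma> t)" for n by (simp add: algebra_simps)
    obtain n where "real n > 2 * ht (\<gamma> t) / L" using reals_Archimedean2 by blast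
    then show False using *[of n] L by (simp add: field_simps)
  qed
  then show ?thesis by blast
qed

text \<open>Up to a point \<open>q\<close> of height \<open>R\<close> the geodesic runs at height at
  least \<open>R\<close>, so its projection advances slowly and the feet of \<open>q\<close> and
  \<open>x\<close> should be close. The difficulty is a very high \<open>x\<close>: the advance is
  bounded only by a fraction of the length.\<close>

lemma geodesic_to_line_passes_foot:
  "\<exists>C\<ge>0. \<forall>x t. \<exists>l\<in>{0..1}. dist (geo x (c t) l) (c (pr x)) \<le> C"
proof -
  obtain L where L: "L > 0" "\<And>K. K > 0 \<Longrightarrow> \<exists>R>0. \<forall>x y. (\<forall>s\<in>{0..1}. R \<le> ht (geo x y s)) \<longrightarrow>
     \<bar>pr x - pr y\<bar> \<le> dist x y / K + L"
    using geodesic_contraction by blast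
  \<comment> \<open>The rate 1/20 is small enough for the linear inequalities of both cases below to
    bound \<open>u\<close>.\<close>
  obtain R where R: "R > 0" "\<And>x y. (\<forall>s\<in>{0..1}. R \<le> ht (geo x y s)) \<Longrightarrow>
     \<bar>pr x - pr y\<bar> \<le> dist x y / 20 + L"
    using L(2)[of 20] by auto
  have "\<exists>l\<in>{0..1}. dist (geo x (c t) l) (c (pr x)) \<le> 2 * R + 3 * L" for x t
  proof (cases "ht x \<le> R")
    case True
    then show ?thesis using R L by (intro bexI[of _ 0]) (auto simp: ht_def)
  next
    case False
    have "continuous_on {0..1} (\<lambda>l. ht (geo x (c t) l))"
    proof (rule continuous_on_iff[THEN iffD2], intro ballI allI impI)
      fix a e :: real assume a: "a \<in> {0..1}" and e: "0 < e"
      show "\<exists>d>0. \<forall>b\<in>{0..1}. dist b a < d \<longrightarrow> dist (ht (geo x (c t) b)) (ht (geo x (c t) a)) < e"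
      proof (intro exI[of _ "e / (dist x (c t) + 1)"] conjI ballI impI)
        show "0 < e / (dist x (c t) + 1)" using e by (simp add: add_nonneg_pos)
        fix b :: real assume b: "b \<in> {0..1}" "dist b a < e / (dist x (c t) + 1)"
        have "dist (ht (geo x (c t) b)) (ht (geo x (c t) a)) \<le> \<bar>b - a\<bar> * dist x (c t)"
          using ht_lipschitz[of "geo x (c t) b" "geo x (c t) a"] geo_dist[of b a x "c t"] a b
          by (simp add: dist_real_def)
        also have "\<dots> \<le> dist b a * (dist x (c t) + 1)"
          unfolding dist_real_def by (intro mult_left_mono) auto
        also have "\<dots> < e" using b(2) by (subst (asm) pos_less_divide_eq) (simp_all add: add_nonneg_pos)
        finally show "dist (ht (geo x (c t) b)) (ht (geo x (c t) a)) < e" .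
      qed
    qed
    then obtain l0 where l0: "0 \<le> l0" "l0 \<le> 1" "ht (geo x (c t) l0) = R"
      using IVT2'[of "\<lambda>l. ht (geo x (c t) l)" 1 R 0] False R by auto
    have "l0 < 1" using l0 R by (metis geo_1 ht_line less_eq_real_def less_irrefl)
    define q where "q = geo x (c t) l0"
    have htq: "ht q = R" by (simp add: q_def l0)
    \<comment> \<open>\<open>q\<close> lies between the given point and \<open>c t\<close>, which
      has height 0, so by convexity the given point is at least as high as \<open>q\<close>.\<close>
    have above: "R \<le> ht (geo x q s)" if s: "0 \<le> s" "s \<le> 1" for s
    proof -
      have sl: "0 \<le> s * l0" "s * l0 \<le> l0" using s l0 by (auto simp: mult_left_le_one_le)
      with \<open>l0 < 1\<close> have sl1: "s * l0 < 1" by simp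
      have e: "geo x q s = geo x (c t) (s * l0)"
        using geo_reparam[of 0 l0 s x "c t"] s l0 by (simp add: q_def)
      define th where "th = (l0 - s * l0) / (1 - s * l0)"
      have th: "0 \<le> th" "th \<le> 1" using sl sl1 l0 by (auto simp: th_def divide_le_eq)
      have "geo (geo x (c t) (s * l0)) (geo x (c t) 1) th = geo x (c t) (s * l0 + th * (1 - s * l0))"
        using sl sl1 th by (intro geo_reparam) auto
      also have "s * l0 + th * (1 - s * l0) = l0" using sl1 by (simp add: th_def)
      finally have "ht q \<le> (1 - th) * ht (geo x q s) + th * ht (c t)"
        using ht_convex[OF th, of "geo x q s" "c t"] by (simp add: q_def[symmetric] e)
      also have "\<dots> \<le> ht (geo x q s)" using th by (simp add: mult_left_le_one_le)
      finally show ?thesis by (simp add: htq)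
    qed
    define u where "u = \<bar>pr x - pr q\<bar>"
    have "u \<le> R + 3 * L"
    \<comment> \<open>If \<open>ht x\<close> is comparable with \<open>u\<close>, so is
      \<open>dist x q\<close>, and slow advance gives the bound directly. Otherwise the triangle
      with vertices \<open>x\<close>, \<open>q\<close> and \<open>w\<close> is cut at height
      \<open>M\<close> on its perpendicular side, and the cut part has size comparable with
      \<open>u\<close>.\<close>
    proof (cases "ht x \<le> 2 * (u + 2 * R)")
      case True
      have "u \<le> dist x q / 20 + L" unfolding u_def using above by (intro R(2)) auto
      moreover have "dist x q \<le> ht x + R + u" using dist_le_ht_ht[of x q] by (simp add: htq u_def)
      ultimately show ?thesis using True L R by argo
    next
      case big: False
      \<comment> \<open>Twice the bound that thin triangles give for \<open>dist q' w'\<close>, so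
        that the segment from \<open>q'\<close> to \<open>w'\<close> stays above height
        \<open>R\<close>.\<close>
      define M where "M = 2 * (u + 2 * R)"
      define s where "s = (ht x - M) / (ht x - R)"
      have u0: "u \<ge> 0" by (simp add: u_def)
      have M: "R \<le> M" "M \<le> ht x" "0 \<le> M" using big u0 R by (auto simp: M_def)
      have s: "0 \<le> s" "s \<le> 1" using M False by (auto simp: s_def divide_le_eq)
      have s': "s * (ht x - R) = ht x - M" using False by (simp add: s_def)
      define w where "w = perp x R"
      have w: "ht w = R" "pr w = pr x" using False R by (auto simp: w_def ht_perp pr_perp)
      define w' where "w' = perp x M"
      have w': "ht w' = M" "pr w' = pr x" using M by (auto simp: w'_def ht_perp pr_perp)
      define q' where "q' = geo x q s"
      have "dist x w = ht x - R" "dist x w' = ht x - M" "dist w' w = M - R"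
        unfolding w_def w'_def using M R False by (auto simp: dist_perp dist_perp_perp)
      then have "w' = geo x w s"
        using s s' by (intro geo_unique) (auto simp: left_diff_distrib)
      then have "dist q' w' \<le> s * dist q w" using geo_thin[OF s] by (simp add: q'_def)
      also have "\<dots> \<le> dist q w" using s by (simp add: mult_left_le_one_le)
      also have "\<dots> \<le> u + 2 * R"
        using dist_le_ht_ht[of q w] by (simp add: htq w u_def abs_minus_commute)
      finally have qw: "dist q' w' \<le> u + 2 * R" .
      have 1: "\<bar>pr q' - pr w'\<bar> \<le> dist q' w' / 20 + L"
      proof (rule R(2), intro ballI)
        fix r :: real assume "r \<in> {0..1}"
        then have "dist (geo q' w' r) w' \<le> dist q' w'"
          using dist_geo_right[of r q' w'] by (simp add: mult_left_le_one_le)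
        then show "R \<le> ht (geo q' w' r)"
          using ht_lipschitz[of "geo q' w' r" w'] qw w' u0 R by (simp add: M_def)
      qed
      have 2: "\<bar>pr q' - pr q\<bar> \<le> dist q' q / 20 + L"
      proof (rule R(2), intro ballI)
        fix r :: real assume r: "r \<in> {0..1}"
        have "s + r * (1 - s) = (1 - r) * s + r" by (simp add: algebra_simps)
        then have "0 \<le> s + r * (1 - s)" "s + r * (1 - s) \<le> 1"
          using s r convex_bound_le[of s 1 1 "1 - r" r] by auto
        then show "R \<le> ht (geo q' q r)"
          using geo_reparam[of s 1 r x q] s r above by (simp add: q'_def)
      qed
      have 3: "dist q' q \<le> ht q' + R + \<bar>pr q' - pr q\<bar>"
        using dist_le_ht_ht[of q' q] by (simp add: htq)
      have 4: "ht q' \<le> M + (u + 2 * R)" using ht_lipschitz[of q' w'] qw w' by simp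
      have 5: "u \<le> \<bar>pr q' - pr q\<bar> + \<bar>pr q' - pr w'\<bar>" using w' by (simp add: u_def)
      show ?thesis using 1 2 3 4 5 qw L R M_def by argo
    qed
    then have "dist q (c (pr x)) \<le> 2 * R + 3 * L"
      using dist_le_ht[of q "pr x"] by (simp add: htq u_def abs_minus_commute)
    then show ?thesis using l0 by (intro bexI[of _ l0]) (auto simp: q_def)
  qed
  then show ?thesis using R L by (intro exI[of _ "2 * R + 3 * L"]) auto
qed

text \<open>The geodesic passes within \<open>C\<close> of the foot of \<open>x\<close>, and before
  that it follows the line by thinness of triangles. One \<open>C\<close> is due to thinness, the
  other to the difference between \<open>\<bar>pr x\<bar>\<close> and the arc length up to the point
  near the foot.\<close>

lemma geodesic_to_base_fellow_travels:
  "\<exists>C\<ge>0. \<forall>x v. 0 \<le> v \<and> v < \<bar>pr x\<bar> \<longrightarrow>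
      dist (geo (c 0) x (v / dist x (c 0))) (c (sgn (pr x) * v)) \<le> C"
proof -
  obtain C where C: "C \<ge> 0" "\<And>x t. \<exists>l\<in>{0..1}. dist (geo x (c t) l) (c (pr x)) \<le> C"
    using geodesic_to_line_passes_foot by blast
  have "dist (geo (c 0) x (v / dist x (c 0))) (c (sgn (pr x) * v)) \<le> 2 * C"
    if v: "0 \<le> v" "v < \<bar>pr x\<bar>" for x v
  proof -
    define s where "s = pr x"
    define a where "a = dist x (c 0)"
    have s: "\<bar>s\<bar> > 0" "v < \<bar>s\<bar>" using v by (auto simp: s_def)
    have a: "\<bar>s\<bar> \<le> a" "a > 0" using dist_ge_pr[of x 0] s by (auto simp: a_def s_def)
    obtain l where l: "0 \<le> l" "l \<le> 1" "dist (geo x (c 0) l) (c s) \<le> C"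
      using C(2)[of x 0] by (auto simp: s_def)
    define q where "q = geo (c 0) x (1 - l)"
    have q: "dist q (c s) \<le> C" using l geo_sym[of l "c 0" x] by (simp add: q_def)
    have cq: "dist (c 0) q = (1 - l) * a" unfolding q_def a_def
      using l dist_geo_left[of "1 - l" "c 0" x] by (simp add: dist_commute)
    have al: "\<bar>(1 - l) * a - \<bar>s\<bar>\<bar> \<le> C"
      using abs_dist_diff_le[of q "c 0" "c s"] q by (simp add: cq[symmetric] dist_line dist_commute)
    define th where "th = v / \<bar>s\<bar>"
    have th: "0 \<le> th" "th \<le> 1" using v s by (auto simp: th_def)
    have 1: "geo (c 0) q th = geo (c 0) x (th * (1 - l))"
      using geo_reparam[of 0 "1 - l" th "c 0" x] l th by (simp add: q_def)
    have 2: "geo (c 0) (c s) th = c (sgn s * v)"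
      unfolding geo_line[OF th] using s by (simp add: th_def sgn_if abs_if)
    have 3: "dist (geo (c 0) x (th * (1 - l))) (c (sgn s * v)) \<le> C"
      unfolding 1[symmetric] 2[symmetric]
      using geo_thin[OF th, of "c 0" q "c s"] th q C(1) mult_left_le_one_le[of "dist q (c s)" th] by simp
    have "th * \<bar>s\<bar> = v" using s by (simp add: th_def)
    then have "v / a - th * (1 - l) = th * (\<bar>s\<bar> - (1 - l) * a) / a"
      using a by (simp add: field_simps)
    then have "\<bar>v / a - th * (1 - l)\<bar> * a = th * \<bar>(1 - l) * a - \<bar>s\<bar>\<bar>"
      using a th by (simp add: abs_mult abs_minus_commute)
    also have "\<dots> \<le> C" using th al mult_left_le_one_le[of "\<bar>(1 - l) * a - \<bar>s\<bar>\<bar>" th] by simp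
    finally have 4: "\<bar>v / a - th * (1 - l)\<bar> * a \<le> C" .
    have "0 \<le> th * (1 - l)" "th * (1 - l) \<le> 1" using th l by (auto intro: mult_le_one)
    then have "dist (geo (c 0) x (v / a)) (geo (c 0) x (th * (1 - l))) \<le> C"
      using geo_dist[of "v / a" "th * (1 - l)" "c 0" x] v a s 4 by (simp add: a_def dist_commute)
    then show ?thesis using 3
      dist_triangle[of "geo (c 0) x (v / a)" "c (sgn s * v)" "geo (c 0) x (th * (1 - l))"]
      by (simp add: a_def s_def)
  qed
  then show ?thesis using C(1) by (intro exI[of _ "2 * C"]) auto
qed

text \<open>Behrstock's inequality for the two lines \<open>c\<close> and \<open>g \<circ> c\<close>: the parameter of the
  projection of \<open>g y\<close> to \<open>g \<circ> c\<close> is \<open>pr y\<close>.\<close>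

lemma common_end_or_bounded_projection:
  assumes g: "\<And>x y. dist (g x) (g y) = dist x y"
  shows "(\<exists>e\<in>{1, - 1}. \<exists>e'\<in>{1, - 1}. \<exists>B. \<forall>v\<ge>0. dist (c (e * v)) (g (c (e' * v))) \<le> B) \<or>
     (\<exists>r. \<forall>y. \<bar>pr (g y)\<bar> \<le> r \<or> \<bar>pr y\<bar> \<le> r)"
proof (rule ccontr)
  assume neg: "\<not> ?thesis"
  obtain C where C: "C \<ge> 0" "\<And>x v. 0 \<le> v \<Longrightarrow> v < \<bar>pr x\<bar> \<Longrightarrow>
      dist (geo (c 0) x (v / dist x (c 0))) (c (sgn (pr x) * v)) \<le> C"
    using geodesic_to_base_fellow_travels by blast
  define \<delta> where "\<delta> = dist (c 0) (g (c 0))"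
  define B where "B = 2 * C + 2 * \<delta>"
  \<comment> \<open>The geodesics to \<open>g y\<close> from \<open>c 0\<close> and from
    \<open>g (c 0)\<close> follow \<open>c\<close> and \<open>g \<circ> c\<close> up to time
    \<open>v\<close>, which accounts for \<open>2 * C\<close>. Their starting points are
    \<open>\<delta>\<close> apart and their end is common: one \<open>\<delta>\<close> comes from
    convexity, the other from their different lengths.\<close>
  have key: "dist (c (sgn (pr (g y)) * v)) (g (c (sgn (pr y) * v))) \<le> B"
    if v: "0 \<le> v" "v < \<bar>pr (g y)\<bar>" "v < \<bar>pr y\<bar>" for y v
  proof -
    define a b where "a = dist (g y) (c 0)" and "b = dist y (c 0)"
    have ab: "v < a" "v < b" using v dist_ge_pr[of "g y" 0] dist_ge_pr[of y 0] by (auto simp: a_def b_def)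
    then have ab0: "a > 0" "b > 0" using v by auto
    have 1: "dist (geo (c 0) (g y) (v / a)) (c (sgn (pr (g y)) * v)) \<le> C"
      using C(2)[of v "g y"] v by (simp add: a_def)
    have "g (geo (c 0) y (v / b)) = geo (g (c 0)) (g y) (v / b)"
      using g ab v by (intro geo_isometry) auto
    then have 2: "dist (geo (g (c 0)) (g y) (v / b)) (g (c (sgn (pr y) * v))) \<le> C"
      using C(2)[of v y] v g by (metis b_def)
    have va: "0 \<le> v / a" "v / a \<le> 1" "0 \<le> v / b" "v / b \<le> 1" using ab v by auto
    have "dist (geo (c 0) (g y) (v / a)) (geo (g (c 0)) (g y) (v / a)) \<le> (1 - v / a) * \<delta>"
      using geo_convex[OF va(1,2), of "c 0" "g y" "g (c 0)" "g y"] by (simp add: \<delta>_def)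
    also have "\<dots> \<le> \<delta>" using va by (intro mult_left_le_one_le) (auto simp: \<delta>_def)
    finally have 3: "dist (geo (c 0) (g y) (v / a)) (geo (g (c 0)) (g y) (v / a)) \<le> \<delta>" .
    have bg: "b = dist (g (c 0)) (g y)" using g by (simp add: b_def dist_commute)
    have "dist (geo (g (c 0)) (g y) (v / a)) (geo (g (c 0)) (g y) (v / b)) = \<bar>v / a - v / b\<bar> * b"
      using geo_dist[OF va] bg by simp
    also have "\<dots> = (v / a) * \<bar>b - a\<bar>"
    proof -
      have "v / a - v / b = (v / a) * ((b - a) / b)" using ab0 by (simp add: field_simps)
      then show ?thesis using ab0 v by (simp add: abs_mult)
    qed
    also have "\<dots> \<le> \<bar>b - a\<bar>" using va by (intro mult_left_le_one_le) auto
    also have "\<dots> \<le> \<delta>"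
      using abs_dist_diff_le[of "g (c 0)" "g y" "c 0"] bg by (simp add: a_def \<delta>_def dist_commute)
    finally have 4: "dist (geo (g (c 0)) (g y) (v / a)) (geo (g (c 0)) (g y) (v / b)) \<le> \<delta>" .
    define x1 x2 x3 x4 x5 where "x1 = c (sgn (pr (g y)) * v)" and "x2 = geo (c 0) (g y) (v / a)"
      and "x3 = geo (g (c 0)) (g y) (v / a)" and "x4 = geo (g (c 0)) (g y) (v / b)"
      and "x5 = g (c (sgn (pr y) * v))"
    have "dist x1 x5 \<le> dist x2 x1 + dist x2 x3 + dist x3 x4 + dist x4 x5"
      using dist_triangle[of x1 x5 x2] dist_triangle[of x2 x5 x3] dist_triangle[of x3 x5 x4]
      by (simp add: dist_commute)
    then show ?thesis using 1 2 3 4 by (simp add: B_def flip: x1_def x2_def x3_def x4_def x5_def)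
  qed
  \<comment> \<open>A convex function that starts at or below \<open>B\<close> and once exceeds
    \<open>B\<close> stays above \<open>B\<close>. Hence one time \<open>v\<close> serves for all
    four choices of signs, and \<open>key\<close> at this time gives the contradiction.\<close>
  have far: "\<exists>w. \<forall>v\<ge>w. B < dist (c (e * v)) (g (c (e' * v)))" if e: "e \<in> {1, - 1}" "e' \<in> {1, - 1}" for e e'
  proof -
    define F where "F v = dist (c (e * v)) (g (c (e' * v)))" for v
    have "geodesic_on UNIV (\<lambda>v. c (e * v))" "geodesic_on UNIV (\<lambda>v. g (c (e' * v)))"
      using e by (auto simp: geodesic_on_def dist_line g)
    then have cv: "convex_on UNIV F" unfolding F_def by (intro convex_on_dist_geodesics) auto
    obtain w where w: "w \<ge> 0" "B < F w" using neg e unfolding F_def by (meson not_le)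
    have F0: "F 0 \<le> B" using C by (simp add: F_def B_def \<delta>_def)
    have "B < F v" if v: "w \<le> v" for v
    proof (rule ccontr)
      assume nv: "\<not> B < F v"
      have "w > 0" using w F0 by (metis less_eq_real_def not_less)
      then have l: "0 \<le> w / v" "w / v \<le> 1" "v > 0" using v by auto
      have "F w = F ((1 - w / v) *\<^sub>R 0 + (w / v) *\<^sub>R v)" using l by simp
      also have "\<dots> \<le> (1 - w / v) * F 0 + w / v * F v" using l by (intro convex_onD[OF cv]) auto
      also have "\<dots> \<le> B" using l F0 nv by (intro convex_bound_le) auto
      finally show False using w by simp
    qed
    then show ?thesis unfolding F_def by blast
  qed
  obtain w :: "real \<Rightarrow> real \<Rightarrow> real" where w: "\<And>e e' v. e \<in> {1, - 1} \<Longrightarrow> e' \<in> {1, - 1} \<Longrightarrow> w e e' \<le> v \<Longrightarrow>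
      B < dist (c (e * v)) (g (c (e' * v)))"
    using far by metis
  define v where "v = Max {0, w 1 1, w 1 (-1), w (-1) 1, w (-1) (-1)}"
  have v: "0 \<le> v" "w 1 1 \<le> v" "w 1 (-1) \<le> v" "w (-1) 1 \<le> v" "w (-1) (-1) \<le> v"
    by (auto simp: v_def)
  obtain y where y: "v < \<bar>pr (g y)\<bar>" "v < \<bar>pr y\<bar>" using neg by (meson not_le)
  have "sgn (pr (g y)) \<in> {1, - 1}" "sgn (pr y) \<in> {1, - 1}" using y v by (auto simp: sgn_if)
  moreover from this have "w (sgn (pr (g y))) (sgn (pr y)) \<le> v" using v by auto
  ultimately have "B < dist (c (sgn (pr (g y)) * v)) (g (c (sgn (pr y) * v)))" by (rule w)
  then show False using key[OF v(1) y] by simp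
qed

end

section \<open>Morse rays\<close>

lemma grid_exit_left:
  fixes N s x :: real
  assumes N: "0 < N" and sx: "s \<le> x" and P: "P s" "\<not> P x"
  shows "\<exists>n y. s \<le> y \<and> y \<le> x - real n * N \<and> x - real n * N - N \<le> y \<and> P y \<and>
    (\<forall>i\<le>n. s \<le> x - real i * N \<and> \<not> P (x - real i * N))"
proof -
  define Q where "Q k \<longleftrightarrow> x - real k * N < s \<or> P (x - real k * N)" for k
  obtain k0 :: nat where "(x - s) / N < real k0" using reals_Archimedean2 by blast
  then have "Q k0" using N by (simp add: Q_def field_simps)
  define k where "k = (LEAST k. Q k)"
  have Qk: "Q k" unfolding k_def by (rule LeastI[of Q, OF \<open>Q k0\<close>])
  have nQ: "\<not> Q i" if "i < k" for i using that not_less_Least unfolding k_def by blast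
  have "\<not> Q 0" using sx P by (simp add: Q_def)
  then obtain n where k: "k = Suc n" using Qk by (cases k) auto
  have inside: "\<forall>i\<le>n. s \<le> x - real i * N \<and> \<not> P (x - real i * N)"
    using nQ unfolding Q_def k by (meson less_Suc_eq_le not_le)
  \<comment> \<open>Quasi-geodesics may be discontinuous, so grid points replace the last time
    before \<open>x\<close> at which \<open>P\<close> holds. The maximum keeps the final step inside
    the interval, where \<open>P s\<close> is available.\<close>
  have "P (max s (x - real k * N))" using Qk P by (auto simp: Q_def max_def)
  then show ?thesis using inside N
    by (intro exI[of _ n] exI[of _ "max s (x - real k * N)"]) (auto simp: k algebra_simps)
qed

lemma grid_exit_right:
  fixes N t x :: real
  assumes N: "0 < N" and xt: "x \<le> t" and P: "P t" "\<not> P x"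
  shows "\<exists>n y. y \<le> t \<and> x + real n * N \<le> y \<and> y \<le> x + real n * N + N \<and> P y \<and>
    (\<forall>i\<le>n. x + real i * N \<le> t \<and> \<not> P (x + real i * N))"
proof -
  obtain n y where "- t \<le> y" "y \<le> - x - real n * N" "- x - real n * N - N \<le> y" "P (- y)"
    "\<forall>i\<le>n. - t \<le> - x - real i * N \<and> \<not> P (- (- x - real i * N))"
    using grid_exit_left[OF N, of "- t" "- x" "\<lambda>u. P (- u)"] xt P by auto
  then show ?thesis by (intro exI[of _ n] exI[of _ "- y"]) (auto simp: algebra_simps)
qed

context periodic_line
begin

lemma quasi_geodesic_height:
  assumes A: "1 \<le> A" and B: "0 \<le> B"
  shows "\<exists>M\<ge>0. \<forall>\<alpha> s t. quasi_geodesic_on A B {s..t} \<alpha> \<and> ht (\<alpha> s) = 0 \<and> ht (\<alpha> t) = 0 \<longrightarrow>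
    (\<forall>x\<in>{s..t}. ht (\<alpha> x) \<le> M)"
proof -
  obtain L where L: "L > 0" "\<And>D. \<exists>R>0. \<forall>n z. (\<forall>i\<le>n. R \<le> ht (z i)) \<and>
      (\<forall>i<n. dist (z i) (z (Suc i)) \<le> D) \<longrightarrow> \<bar>pr (z 0) - pr (z n)\<bar> \<le> real n * L"
    using chain_contraction by blast
  text \<open>With this step, \<open>n\<close> steps outside a large neighbourhood of the line advance the projection
    by at most \<open>n * L\<close>, while the quasi-geodesic moves by about \<open>2 * n * L\<close>.\<close>
  define N where "N = 2 * A * L"
  define D where "D = A * N + B"
  have N: "N > 0" using A L by (simp add: N_def)
  have D: "D \<ge> 0" using A N B by (simp add: D_def)
  obtain R where R: "R > 0" "\<And>n z. (\<forall>i\<le>n. R \<le> ht (z i)) \<and>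
      (\<forall>i<n. dist (z i) (z (Suc i)) \<le> D) \<longrightarrow> \<bar>pr (z 0) - pr (z n)\<bar> \<le> real n * L"
    using L(2) by blast
  \<comment> \<open>At most \<open>(2 * R + 2 * D + B) / L\<close> steps of length \<open>N\<close>,
    and one further step, lead from \<open>x\<close> to a time at which the height is below
    \<open>R\<close>. The constants \<open>A\<close> and \<open>B\<close> turn this time into a
    distance.\<close>
  define M where "M = R + A * (((2 * R + 2 * D + B) / L + 1) * N) + B"
  have "ht (\<alpha> x) \<le> M"
    if q: "quasi_geodesic_on A B {s..t} \<alpha>" and e: "ht (\<alpha> s) = 0" "ht (\<alpha> t) = 0" and x: "x \<in> {s..t}"
    for \<alpha> s t x
  proof (cases "ht (\<alpha> x) < R")
    case True
    moreover have "0 \<le> A * (((2 * R + 2 * D + B) / L + 1) * N)"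
      using A B D R L N by (intro mult_nonneg_nonneg add_nonneg_nonneg divide_nonneg_nonneg) auto
    ultimately show ?thesis using B by (simp add: M_def)
  next
    case False
    have qd: "\<bar>u - v\<bar> / A - B \<le> dist (\<alpha> u) (\<alpha> v)" "dist (\<alpha> u) (\<alpha> v) \<le> A * \<bar>u - v\<bar> + B"
      if "u \<in> {s..t}" "v \<in> {s..t}" for u v
      using q that by (auto simp: quasi_geodesic_on_def)
    have step: "dist (\<alpha> u) (\<alpha> v) \<le> D" if "u \<in> {s..t}" "v \<in> {s..t}" "\<bar>u - v\<bar> \<le> N" for u v
    proof -
      have "A * \<bar>u - v\<bar> \<le> A * N" using that(3) A by (intro mult_left_mono) auto
      then show ?thesis using qd(2)[OF that(1,2)] by (simp add: D_def)
    qed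
    obtain n y where n: "s \<le> y" "y \<le> x - real n * N" "x - real n * N - N \<le> y" "ht (\<alpha> y) < R"
        "\<forall>i\<le>n. s \<le> x - real i * N \<and> R \<le> ht (\<alpha> (x - real i * N))"
      using grid_exit_left[OF N, of s x "\<lambda>u. ht (\<alpha> u) < R"] False e x R by (auto simp: not_less)
    obtain n' y' where n': "y' \<le> t" "x + real n' * N \<le> y'" "y' \<le> x + real n' * N + N" "ht (\<alpha> y') < R"
        "\<forall>i\<le>n'. x + real i * N \<le> t \<and> R \<le> ht (\<alpha> (x + real i * N))"
      using grid_exit_right[OF N, of x t "\<lambda>u. ht (\<alpha> u) < R"] False e x R by (auto simp: not_less)
    define m where "m = n + n'"
    define p where "p i = x - real n * N + real i * N" for i
    have p: "p i \<in> {s..t}" "R \<le> ht (\<alpha> (p i))" if i: "i \<le> m" for i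
    proof -
      have "p i \<in> {s..t} \<and> R \<le> ht (\<alpha> (p i))"
      proof (cases "i \<le> n")
        case True
        then have pi: "p i = x - real (n - i) * N" by (simp add: p_def algebra_simps of_nat_diff)
        have "real (n - i) * N \<ge> 0" using N by simp
        then show ?thesis using n(5)[rule_format, of "n - i"] x unfolding pi by simp
      next
        case False
        then have pi: "p i = x + real (i - n) * N" by (simp add: p_def algebra_simps of_nat_diff)
        have "real (i - n) * N \<ge> 0" "i - n \<le> n'" using N i by (auto simp: m_def)
        then show ?thesis using n'(5)[rule_format, of "i - n"] x unfolding pi by simp
      qed
      then show "p i \<in> {s..t}" "R \<le> ht (\<alpha> (p i))" by auto
    qed
    have pp: "\<bar>p i - p j\<bar> = \<bar>real i - real j\<bar> * N" for i j
    proof -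
      have "p i - p j = (real i - real j) * N" by (simp add: p_def algebra_simps)
      then show ?thesis using N by (simp add: abs_mult)
    qed
    have "dist (\<alpha> (p i)) (\<alpha> (p (Suc i))) \<le> D" if "i < m" for i
      using that by (intro step p) (auto simp: pp)
    then have pr_le: "\<bar>pr (\<alpha> (p 0)) - pr (\<alpha> (p m))\<bar> \<le> real m * L"
      using R(2)[of m "\<lambda>i. \<alpha> (p i)"] p by auto
    have p0: "p 0 = x - real n * N" and pm: "p m = x + real n' * N"
      by (simp_all add: p_def m_def algebra_simps)
    have "dist (\<alpha> (p 0)) (\<alpha> y) \<le> D" "dist (\<alpha> (p m)) (\<alpha> y') \<le> D"
      using n n' x p(1)[of 0] p(1)[of m] unfolding p0 pm by (intro step; simp; fail)+
    then have h: "ht (\<alpha> (p 0)) \<le> R + D" "ht (\<alpha> (p m)) \<le> R + D"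
      using ht_lipschitz[of "\<alpha> (p 0)" "\<alpha> y"] ht_lipschitz[of "\<alpha> (p m)" "\<alpha> y'"] n(4) n'(4) by auto
    have "real m * N / A - B \<le> dist (\<alpha> (p 0)) (\<alpha> (p m))"
      using qd(1)[of "p 0" "p m"] p by (simp add: pp)
    also have "\<dots> \<le> 2 * (R + D) + real m * L" using dist_le_ht_ht[of "\<alpha> (p 0)" "\<alpha> (p m)"] h pr_le by simp
    also have "real m * N / A = 2 * (real m * L)" using A by (simp add: N_def)
    finally have "real m * L \<le> 2 * R + 2 * D + B" by (simp add: algebra_simps)
    moreover have "real n * L \<le> real m * L" using L by (intro mult_right_mono) (auto simp: m_def)
    ultimately have "real n * L \<le> 2 * R + 2 * D + B" by linarith
    then have "real n \<le> (2 * R + 2 * D + B) / L" using L by (simp add: pos_le_divide_eq)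
    then have "real n * N \<le> (2 * R + 2 * D + B) / L * N" using N by (intro mult_right_mono) auto
    moreover have nN: "0 \<le> real n * N" using N by simp
    ultimately have "real n * N + N \<le> ((2 * R + 2 * D + B) / L + 1) * N"
      by (simp add: distrib_right)
    then have "\<bar>x - y\<bar> \<le> ((2 * R + 2 * D + B) / L + 1) * N"
      using n(2,3) nN by linarith
    moreover have "y \<in> {s..t}" using n(1,2) nN x by auto
    then have "dist (\<alpha> x) (\<alpha> y) \<le> A * \<bar>x - y\<bar> + B" using qd(2) x by blast
    ultimately have "dist (\<alpha> x) (\<alpha> y) \<le> A * (((2 * R + 2 * D + B) / L + 1) * N) + B"
      using A by (smt (verit) mult_left_mono)
    then show ?thesis using ht_lipschitz[of "\<alpha> x" "\<alpha> y"] n(4) by (simp add: M_def)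
  qed
  moreover have "M \<ge> 0" using A B D R L N by (simp add: M_def)
  ultimately show ?thesis by blast
qed

text \<open>Height controls the distance to the whole line, while the ray is only half of it. A
  quasi-geodesic that projects behind \<open>c 0\<close> must pass near \<open>c 0\<close> before
  and after, and a quasi-geodesic with two nearby ends is short.\<close>

lemma morse_ray_line: "morse_ray c"
  unfolding morse_ray_def
proof (intro allI impI)
  fix A B :: real assume A: "1 \<le> A" and B: "0 \<le> B"
  obtain M where M: "M \<ge> 0" "\<And>\<alpha> s t x. quasi_geodesic_on A B {s..t} \<alpha> \<Longrightarrow> ht (\<alpha> s) = 0 \<Longrightarrow> ht (\<alpha> t) = 0 \<Longrightarrow>
      x \<in> {s..t} \<Longrightarrow> ht (\<alpha> x) \<le> M"
    using quasi_geodesic_height[OF A B] by blast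
  define D where "D = A + B"
  define M' where "M' = A * (A * (2 * (M + D) + B)) + B + (M + D)"
  have D: "D \<ge> 0" using A B by (simp add: D_def)
  have "infdist (\<alpha> x) (c ` {0..}) \<le> M'"
    if q: "quasi_geodesic_on A B {s..t} \<alpha>" and e: "\<alpha> s \<in> c ` {0..}" "\<alpha> t \<in> c ` {0..}" and x: "x \<in> {s..t}"
    for \<alpha> s t x
  proof -
    have h: "ht (\<alpha> u) \<le> M" if "u \<in> {s..t}" for u using M(2)[OF q _ _ that] e by auto
    have M': "M \<le> M'" using A B D M by (simp add: M'_def add_increasing)
    have qd: "\<bar>u - v\<bar> / A - B \<le> dist (\<alpha> u) (\<alpha> v)" "dist (\<alpha> u) (\<alpha> v) \<le> A * \<bar>u - v\<bar> + B"
      if "u \<in> {s..t}" "v \<in> {s..t}" for u v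
      using q that by (auto simp: quasi_geodesic_on_def)
    show ?thesis
    proof (cases "0 \<le> pr (\<alpha> x)")
      case True
      then have "infdist (\<alpha> x) (c ` {0..}) \<le> ht (\<alpha> x)" unfolding ht_def by (intro infdist_le) auto
      then show ?thesis using h[OF x] M' by simp
    next
      case False
      have step: "dist (\<alpha> u) (\<alpha> v) \<le> D" if "u \<in> {s..t}" "v \<in> {s..t}" "\<bar>u - v\<bar> \<le> 1" for u v
    proof -
      have "A * \<bar>u - v\<bar> \<le> A * 1" using that(3) A by (intro mult_left_mono) auto
      then show ?thesis using qd(2)[OF that(1,2)] by (simp add: D_def)
    qed
      text \<open>The parameters \<open>y \<le> x \<le> y'\<close> are times at which the quasi-geodesic is close to \<open>c 0\<close>.\<close>
      obtain n y where n: "s \<le> y" "y \<le> x - real n" "x - real n - 1 \<le> y" "0 \<le> pr (\<alpha> y)"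
          "s \<le> x - real n" "pr (\<alpha> (x - real n)) < 0"
        using grid_exit_left[of 1 s x "\<lambda>u. 0 \<le> pr (\<alpha> u)"] False e x by (auto simp: not_le)
      obtain n' y' where n': "y' \<le> t" "x + real n' \<le> y'" "y' \<le> x + real n' + 1" "0 \<le> pr (\<alpha> y')"
          "x + real n' \<le> t" "pr (\<alpha> (x + real n')) < 0"
        using grid_exit_right[of 1 x t "\<lambda>u. 0 \<le> pr (\<alpha> u)"] False e x by (auto simp: not_le)
      have yy: "y \<in> {s..t}" "y' \<in> {s..t}" "y \<le> x" "x \<le> y'" using n n' x by auto
      have "dist (\<alpha> y) (\<alpha> (x - real n)) \<le> D" "dist (\<alpha> y') (\<alpha> (x + real n')) \<le> D"
        using n n' x by (auto intro!: step)
      then have "\<bar>pr (\<alpha> y)\<bar> \<le> D" "\<bar>pr (\<alpha> y')\<bar> \<le> D"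
        using pr_lipschitz[of "\<alpha> y" "\<alpha> (x - real n)"] pr_lipschitz[of "\<alpha> y'" "\<alpha> (x + real n')"] n n' by auto
      then have 0: "dist (\<alpha> y) (c 0) \<le> M + D" "dist (\<alpha> y') (c 0) \<le> M + D"
        using dist_le_ht[of "\<alpha> y" 0] dist_le_ht[of "\<alpha> y'" 0] h[OF yy(1)] h[OF yy(2)] by auto
      have "\<bar>y - y'\<bar> / A - B \<le> (M + D) + (M + D)"
        using qd(1)[OF yy(1,2)] dist_triangle2[of "\<alpha> y" "\<alpha> y'" "c 0"] add_mono[OF 0]
        by (meson order_trans)
      then have "\<bar>y - y'\<bar> \<le> A * (2 * (M + D) + B)" using A by (simp add: field_simps)
      then have "A * \<bar>x - y\<bar> \<le> A * (A * (2 * (M + D) + B))"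
        using A yy by (intro mult_left_mono) auto
      then have "dist (\<alpha> x) (c 0) \<le> M'"
        using qd(2)[OF x yy(1)] 0(1) dist_triangle[of "\<alpha> x" "c 0" "\<alpha> y"] by (simp add: M'_def)
      then show ?thesis using infdist_le[of "c 0" "c ` {0..}" "\<alpha> x"] by auto
    qed
  qed
  then show "\<exists>M. \<forall>\<alpha> s t. s \<le> t \<and> quasi_geodesic_on A B {s..t} \<alpha> \<and> \<alpha> s \<in> c ` {0..} \<and> \<alpha> t \<in> c ` {0..} \<longrightarrow>
       \<alpha> ` {s..t} \<subseteq> {x. infdist x (c ` {0..}) \<le> M}"
    by (intro exI[of _ M']) blast
qed

lemma reverse_line: "periodic_line geo (\<lambda>t. c (- t)) (\<lambda>i. T (- i)) \<tau> \<omega>"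
proof
  show "geodesic_on UNIV (\<lambda>t. c (- t))" by (auto simp: geodesic_on_def dist_line)
  have "range (\<lambda>t. c (- t)) = range c"
    by (auto simp: image_iff) (metis minus_minus)
  then show "\<not> bounds_flat_half_plane (\<lambda>t. c (- t))"
    using no_half_plane by (simp add: bounds_flat_half_plane_def)
qed (use period_pos ultra proper in \<open>auto simp: T_isom T_line\<close>)

end

lemma geodesic_ray_quasi_geodesic:
  "c \<in> geodesic_rays \<Longrightarrow> quasi_geodesic_on 1 0 {0..} c"
  by (auto simp: geodesic_rays_def geodesic_on_def quasi_geodesic_on_def)

lemma morse_ray_kappa_morse:
  assumes c: "c \<in> geodesic_rays" "morse_ray c" and k: "sublinear_function \<kappa>"
  shows "c \<in> kappa_morse_rays \<kappa>"
proof -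
  \<comment> \<open>The gauge of a \<kappa>-Morse ray must be nonnegative for all real arguments;
    outside the range of quasi-geodesic constants \<open>W\<close> asks for nothing else.\<close>
  define W where "W q Q M \<longleftrightarrow> 0 \<le> M \<and> (1 \<le> q \<and> 0 \<le> Q \<longrightarrow> (\<forall>\<alpha> s t.
       s \<le> t \<and> quasi_geodesic_on q Q {s..t} \<alpha> \<and> \<alpha> s \<in> c ` {0..} \<and> \<alpha> t \<in> c ` {0..} \<longrightarrow>
       \<alpha> ` {s..t} \<subseteq> {x. infdist x (c ` {0..}) \<le> M}))" for q Q M
  have "\<exists>M. W q Q M" for q Q
  proof (cases "1 \<le> q \<and> 0 \<le> Q")
    case True
    then obtain M where M: "\<forall>\<alpha> s t.
       s \<le> t \<and> quasi_geodesic_on q Q {s..t} \<alpha> \<and> \<alpha> s \<in> c ` {0..} \<and> \<alpha> t \<in> c ` {0..} \<longrightarrow>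
       \<alpha> ` {s..t} \<subseteq> {x. infdist x (c ` {0..}) \<le> M}" using c(2) unfolding morse_ray_def by blast
    have "{x. infdist x (c ` {0..}) \<le> M} \<subseteq> {x. infdist x (c ` {0..}) \<le> max M 0}" by auto
    then show ?thesis using M unfolding W_def
      by (intro exI[of _ "max M 0"]) (meson max.cobounded2 subset_trans)
  qed (auto simp: W_def)
  from someI_ex[OF this] have "W q Q (SOME M. W q Q M)" for q Q .
  then obtain m where m: "\<And>q Q. W q Q (m q Q)" by (rule that)
  have nbhd: "x \<in> kappa_nbhd \<kappa> c (m q Q)" if "infdist x (c ` {0..}) \<le> m q Q" for x q Q
  proof -
    have "1 \<le> \<kappa> (dist (c 0) x)" using k by (simp add: sublinear_function_def)
    then have "m q Q * 1 \<le> m q Q * \<kappa> (dist (c 0) x)" using m by (intro mult_left_mono) (auto simp: W_def)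
    then show ?thesis using that by (simp add: kappa_nbhd_def)
  qed
  show ?thesis unfolding kappa_morse_rays_def
  proof (intro CollectI conjI)
    show "\<exists>q Q. quasi_geodesic_on q Q {0..} c" using geodesic_ray_quasi_geodesic[OF c(1)] by blast
    show "\<exists>m :: real \<Rightarrow> real \<Rightarrow> real. (\<forall>q Q. 0 \<le> m q Q) \<and>
           (\<forall>q Q \<alpha> s t.
              s \<le> t \<and> quasi_geodesic_on q Q {s..t} \<alpha> \<and> \<alpha> s \<in> c ` {0..} \<and> \<alpha> t \<in> c ` {0..} \<longrightarrow>
              \<alpha> ` {s..t} \<subseteq> kappa_nbhd \<kappa> c (m q Q))"
    proof (intro exI[of _ m] conjI allI impI)
      fix q Q \<alpha> s t
      assume h: "s \<le> t \<and> quasi_geodesic_on q Q {s..t} \<alpha> \<and> \<alpha> s \<in> c ` {0..} \<and> \<alpha> t \<in> c ` {0..}"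
      then have "1 \<le> q" "0 \<le> Q" by (auto simp: quasi_geodesic_on_def)
      then have "\<alpha> ` {s..t} \<subseteq> {x. infdist x (c ` {0..}) \<le> m q Q}"
        using h m[of q Q] unfolding W_def by blast
      then show "\<alpha> ` {s..t} \<subseteq> kappa_nbhd \<kappa> c (m q Q)" using nbhd by blast
    qed (use m W_def in auto)
  qed
qed

section \<open>Geometric actions\<close>

locale geometric_group_action = group G for G :: "('g, 'b) monoid_scheme" (structure) +
  fixes \<phi> :: "'g \<Rightarrow> 'x::metric_space \<Rightarrow> 'x"
  assumes geometric: "geometric_action G \<phi>"
    and proper_X: "proper_space TYPE('x)"
begin

lemma phi_isom: "g \<in> carrier G \<Longrightarrow> dist (\<phi> g x) (\<phi> g y) = dist x y"
  using geometric by (simp add: geometric_action_def)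

lemma phi_mult: "a \<in> carrier G \<Longrightarrow> b \<in> carrier G \<Longrightarrow> \<phi> (a \<otimes> b) x = \<phi> a (\<phi> b x)"
  using geometric group_action.composition_rule[of G UNIV \<phi> x a b] by (simp add: geometric_action_def)

lemma phi_one: "\<phi> \<one> x = x"
  using geometric group_action.id_eq_one[of G UNIV \<phi>] by (metis UNIV_I geometric_action_def restrict_apply)

lemma phi_inv: "g \<in> carrier G \<Longrightarrow> \<phi> g (\<phi> (inv g) x) = x" "g \<in> carrier G \<Longrightarrow> \<phi> (inv g) (\<phi> g x) = x"
  by (simp_all add: phi_mult[symmetric] phi_one)

lemma dist_phi_inv: "g \<in> carrier G \<Longrightarrow> dist (\<phi> (inv g) x) y = dist x (\<phi> g y)"
  using phi_isom[of g "\<phi> (inv g) x" y] by (simp add: phi_inv)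

lemma finite_displacement: "finite {g \<in> carrier G. dist (\<phi> g x) x \<le> r}"
proof (rule finite_subset)
  have "compact (cball x r)" using proper_X by (simp add: proper_space_def)
  then show "finite {g \<in> carrier G. \<phi> g ` cball x r \<inter> cball x r \<noteq> {}}"
    using geometric by (simp add: geometric_action_def)
  show "{g \<in> carrier G. dist (\<phi> g x) x \<le> r} \<subseteq> {g \<in> carrier G. \<phi> g ` cball x r \<inter> cball x r \<noteq> {}}"
  proof clarify
    fix g assume g: "g \<in> carrier G" "dist (\<phi> g x) x \<le> r" "\<phi> g ` cball x r \<inter> cball x r = {}"
    then have "0 \<le> r" by (meson order_trans zero_le_dist)
    then have "x \<in> cball x r" "\<phi> g x \<in> cball x r" using g by (auto simp: dist_commute)
    then show False using g by blast
  qed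
qed

text \<open>Cocompactness moves \<open>x\<close> into a compact set at the price of conjugating
  \<open>g\<close>, and the conjugate stays in the finite set \<open>N\<close>.\<close>

lemma finite_normal_displacement:
  assumes N: "N \<lhd> G" "finite N"
  shows "\<exists>D. \<forall>g\<in>N. \<forall>x. dist (\<phi> g x) x \<le> D"
proof -
  obtain K where K: "compact K" "(\<Union>g\<in>carrier G. \<phi> g ` K) = UNIV"
    using geometric unfolding geometric_action_def by blast
  interpret N: normal N G by (rule N)
  obtain p R where R: "\<And>y. y \<in> K \<Longrightarrow> dist p y \<le> R"
    using compact_imp_bounded[OF K(1)] unfolding bounded_def by blast
  define D where "D = Max ((\<lambda>a. dist (\<phi> a p) p) ` N)"
  have "dist (\<phi> g x) x \<le> D + 2 * R" if g: "g \<in> N" for g x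
  proof -
    obtain k y where k: "k \<in> carrier G" "y \<in> K" "x = \<phi> k y" using K(2) by blast
    have gc: "g \<in> carrier G" using g N.subset by blast
    define a where "a = inv k \<otimes> g \<otimes> k"
    have a: "a \<in> N" using N.inv_op_closed1[OF k(1) g] by (simp add: a_def)
    then have ac: "a \<in> carrier G" using N.subset by blast
    have "dist (\<phi> g x) x = dist (\<phi> a y) y"
      using k gc by (simp add: a_def phi_mult dist_phi_inv)
    also have "\<dots> \<le> dist (\<phi> a y) (\<phi> a p) + dist (\<phi> a p) p + dist p y"
      using dist_triangle[of "\<phi> a y" y "\<phi> a p"] dist_triangle[of "\<phi> a p" y p] by linarith
    also have "dist (\<phi> a p) p \<le> D" using N(2) a by (auto simp: D_def)
    finally show ?thesis using R[OF k(2)] phi_isom[OF ac, of y p] by (simp add: dist_commute)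
  qed
  then show ?thesis by blast
qed

end

section \<open>Elements that move the axis to a parallel\<close>

lemma same_value_exists:
  assumes "infinite A" "finite (f ` A)"
  obtains x y where "x \<in> A" "y \<in> A" "x \<noteq> y" "f x = f y"
  using assms finite_imageD unfolding inj_on_def by blast

locale rank_one_action = geometric_group_action G \<phi> + periodic_line geo c "\<lambda>i::int. \<phi> (h [^]\<^bsub>G\<^esub> i)" \<tau> \<omega>
  for G :: "('g, 'b) monoid_scheme" (structure) and \<phi> :: "'g \<Rightarrow> 'x::metric_space \<Rightarrow> 'x"
    and geo c and h :: 'g and \<tau> \<omega> +
  assumes h: "h \<in> carrier G" and not_vc: "\<not> virtually_cyclic G"
begin

lemma h_pow_inj:
  assumes "h [^] (i::int) = h [^] (j::int)"
  shows "i = j"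
proof -
  have "c (0 + of_int i * \<tau>) = c (0 + of_int j * \<tau>)"
    unfolding T_line[symmetric] assms ..
  then have "\<bar>of_int i * \<tau> - of_int j * \<tau>\<bar> = 0" using dist_line[of "of_int i * \<tau>" "of_int j * \<tau>"] by simp
  then show ?thesis using period_pos by simp
qed

text \<open>These elements map the axis to a line parallel to it, up to orientation. The bound may
  depend on \<open>g\<close>, but \<open>parallel_line_height\<close> makes it uniform.\<close>

definition near :: "'g set"
  where "near = {g \<in> carrier G. \<exists>B. \<forall>t. ht (\<phi> g (c t)) \<le> B}"

text \<open>Together with \<open>finite_displacement\<close> this covers \<open>near\<close> by
  finitely many cosets of the group generated by \<open>h\<close>, the source of every pigeonhole
  argument about \<open>near\<close>.\<close>

lemma near_displacement:
  "\<exists>r. \<forall>g\<in>near. \<exists>i::int. dist (\<phi> (h [^] i \<otimes> g) (c 0)) (c 0) \<le> r"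
proof -
  obtain R where R: "\<And>\<gamma> B t. geodesic_on UNIV \<gamma> \<Longrightarrow> (\<forall>t. ht (\<gamma> t) \<le> B) \<Longrightarrow> ht (\<gamma> t) \<le> R"
    using parallel_line_height by blast
  have "\<exists>i::int. dist (\<phi> (h [^] i \<otimes> g) (c 0)) (c 0) \<le> R + \<tau>" if g: "g \<in> near" for g
  proof -
    obtain B where gc: "g \<in> carrier G" and B: "\<forall>t. ht (\<phi> g (c t)) \<le> B" using g by (auto simp: near_def)
    have "geodesic_on UNIV (\<lambda>t. \<phi> g (c t))" using gc by (simp add: geodesic_on_def phi_isom dist_line)
    then have R': "ht (\<phi> g (c 0)) \<le> R" using B by (rule R)
    obtain i where i: "0 \<le> pr (\<phi> g (c 0)) + of_int i * \<tau>" "pr (\<phi> g (c 0)) + of_int i * \<tau> \<le> \<tau>"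
      using translate_into_period by blast
    show ?thesis
      using dist_le_ht[of "\<phi> (h [^] i) (\<phi> g (c 0))" 0] R' i gc h
      by (intro exI[of _ i]) (simp add: T_ht_pr phi_mult)
  qed
  then show ?thesis by blast
qed

text \<open>The relation makes the height of \<open>\<phi> g (c t)\<close> periodic in
  \<open>t\<close>, hence bounded.\<close>

lemma commensurating_near:
  assumes g: "g \<in> carrier G" and p: "p \<noteq> (0::int)" and eq: "h [^] p \<otimes> g = g \<otimes> h [^] (q::int)"
  shows "g \<in> near"
proof -
  define F where "F t = ht (\<phi> g (c t))" for t
  have "q \<noteq> 0"
  proof
    assume "q = 0"
    then have "h [^] p = \<one>" using eq g h r_cancel_one by simp
    then show False using h_pow_inj[of p 0] p by simp
  qed
  then have P: "\<bar>of_int q * \<tau>\<bar> > 0" (is "?P > 0") using period_pos by simp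
  have "F (t + of_int q * \<tau>) = F t" for t
  proof -
    have "\<phi> g (c (t + of_int q * \<tau>)) = \<phi> (h [^] p) (\<phi> g (c t))"
      using g h eq by (simp add: T_line[symmetric] phi_mult[symmetric])
    then show ?thesis by (simp add: F_def T_ht_pr)
  qed
  from this this[of "t - of_int q * \<tau>" for t] have per: "F (t + ?P) = F t" for t
    by (metis abs_if diff_add_cancel diff_conv_add_uminus)
  have perN: "F (t + real n * ?P) = F t" for t n
  proof (induction n)
    case (Suc n)
    then show ?case using per[of "t + real n * ?P"] by (simp add: algebra_simps)
  qed simp
  have "F t \<le> F 0 + ?P" for t
  proof -
    define m where "m = \<lfloor>t / ?P\<rfloor>"
    define t' where "t' = t - of_int m * ?P"
    have "of_int m * ?P \<le> t / ?P * ?P" "t / ?P * ?P \<le> (of_int m + 1) * ?P"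
      using P by (intro mult_right_mono; simp add: m_def; linarith)+
    then have t': "0 \<le> t'" "t' \<le> ?P" using P by (auto simp: t'_def algebra_simps)
    have "F t = F t'"
    proof (cases "0 \<le> m")
      case True
      then show ?thesis using perN[of t' "nat m"] by (simp add: t'_def)
    next
      case False
      then show ?thesis using perN[of t "nat (- m)"] by (simp add: t'_def)
    qed
    also have "F t' \<le> F 0 + dist (\<phi> g (c t')) (\<phi> g (c 0))"
      using ht_lipschitz[of "\<phi> g (c t')" "\<phi> g (c 0)"] by (simp add: F_def)
    finally show ?thesis using t' by (simp add: phi_isom[OF g] dist_line)
  qed
  then show ?thesis using g by (auto simp: near_def F_def)
qed

text \<open>Moving the common end back to the origin by powers of \<open>h\<close> gives elements
  \<open>f n\<close> that displace \<open>c 0\<close> by at most \<open>B\<close>. Properness makes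
  two of them equal, which is a commensuration relation.\<close>

lemma common_end_near:
  assumes g: "g \<in> carrier G" and e: "e \<in> {1, - 1}" "e' \<in> {1, - 1}"
    and B: "\<And>v. 0 \<le> v \<Longrightarrow> dist (c (e * v)) (\<phi> g (c (e' * v))) \<le> B"
  shows "g \<in> near"
proof -
  define s s' :: int where "s = (if e = 1 then 1 else - 1)" and "s' = (if e' = 1 then 1 else - 1)"
  have s: "e = of_int s" "e' = of_int s'" "s \<noteq> 0" using e by (auto simp: s_def s'_def)
  define f where "f n = h [^] (- s * int n) \<otimes> g \<otimes> h [^] (s' * int n)" for n
  have fc: "f n \<in> carrier G" for n using g h by (simp add: f_def)
  have "dist (\<phi> (f n) (c 0)) (c 0) \<le> B" for n
  proof -
    have *: "\<phi> (h [^] i) (c 0) = c (of_int i * \<tau>)" for i :: int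
      using T_line[of i 0] by simp
    have "dist (\<phi> (f n) (c 0)) (c 0) = dist (\<phi> g (c (e' * (real n * \<tau>)))) (\<phi> (h [^] (s * int n)) (c 0))"
      using g h s by (simp add: f_def phi_mult * int_pow_neg dist_phi_inv mult.assoc)
    also have "\<dots> = dist (c (e * (real n * \<tau>))) (\<phi> g (c (e' * (real n * \<tau>))))"
      using s by (simp add: * dist_commute mult.assoc)
    finally show ?thesis using B[of "real n * \<tau>"] period_pos by simp
  qed
  then have "finite (range f)"
    by (intro finite_subset[OF _ finite_displacement[of "c 0" B]]) (use fc in auto)
  then obtain i j where ij: "i \<noteq> j" "f i = f j"
    using same_value_exists[of "UNIV :: nat set" f] by auto
  have "h [^] (s * (int j - int i)) \<otimes> g = h [^] (s * int j) \<otimes> f i \<otimes> h [^] (- s' * int i)"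
    using g h by (simp add: f_def m_assoc[symmetric] int_pow_mult[symmetric] algebra_simps)
       (simp add: m_assoc int_pow_mult[symmetric])
  also have "\<dots> = g \<otimes> h [^] (s' * (int j - int i))"
    unfolding ij(2) using g h by (simp add: f_def m_assoc[symmetric] int_pow_mult[symmetric] algebra_simps)
       (simp add: m_assoc int_pow_mult[symmetric])
  finally show ?thesis using ij s by (intro commensurating_near[OF g]) auto
qed

lemma virtually_cyclic_if_near:
  assumes "carrier G \<subseteq> near"
  shows "virtually_cyclic G"
proof -
  obtain r where r: "\<And>g. g \<in> carrier G \<Longrightarrow> \<exists>i::int. dist (\<phi> (h [^] i \<otimes> g) (c 0)) (c 0) \<le> r"
    using near_displacement assms by blast
  define H where "H = range (\<lambda>i::int. h [^] i)"
  have H: "subgroup H G"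
  proof (rule subgroupI)
    show "H \<noteq> {}" "H \<subseteq> carrier G" using h by (auto simp: H_def)
    show "inv a \<in> H" if "a \<in> H" for a using that h by (auto simp: H_def int_pow_neg[symmetric])
    show "a \<otimes> b \<in> H" if "a \<in> H" "b \<in> H" for a b
      using that h by (auto simp: H_def int_pow_mult[symmetric])
  qed
  have "rcosets H \<subseteq> (\<lambda>g. H #> g) ` {g \<in> carrier G. dist (\<phi> g (c 0)) (c 0) \<le> r}"
  proof
    fix A assume "A \<in> rcosets H"
    then obtain g where g: "g \<in> carrier G" "A = H #> g" by (auto simp: RCOSETS_def)
    obtain i :: int where i: "dist (\<phi> (h [^] i \<otimes> g) (c 0)) (c 0) \<le> r" using r g by blast
    have "H #> (h [^] i \<otimes> g) = (H #> h [^] i) #> g"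
      using h g H subgroup.subset by (metis coset_mult_assoc int_pow_closed)
    also have "H #> h [^] i = H" using H h by (intro coset_join2) (auto simp: H_def)
    finally have "A = H #> (h [^] i \<otimes> g)" using g by simp
    then show "A \<in> (\<lambda>g. H #> g) ` {g \<in> carrier G. dist (\<phi> g (c 0)) (c 0) \<le> r}"
      using i g h by auto
  qed
  then have fin: "finite (rcosets H)"
    by (rule finite_subset) (intro finite_imageI finite_displacement)
  have "(\<lambda>i::int. h [^] i) \<in> iso integer_group (G\<lparr>carrier := H\<rparr>)"
    using h h_pow_inj by (auto simp: iso_def hom_def bij_betw_def inj_on_def H_def int_pow_mult)
  then have "integer_group \<cong> G\<lparr>carrier := H\<rparr>" by (auto simp: is_iso_def)
  then have "G\<lparr>carrier := H\<rparr> \<cong> integer_group" by (rule group.iso_sym[OF group_integer_group])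
  then show ?thesis using H fin by (auto simp: virtually_cyclic_def)
qed

text \<open>Two pigeonhole arguments modulo powers of \<open>h\<close>. Two elements of
  \<open>N\<close> in one coset put a nontrivial power of \<open>h\<close> into \<open>N\<close>.
  For any \<open>k\<close>, its conjugates \<open>a l\<close> again lie in \<open>N\<close>, and two
  of them in one coset show that \<open>k\<close> commensurates \<open>h\<close>.\<close>

lemma near_normal_finite:
  assumes N: "N \<lhd> G" and near: "N \<subseteq> near"
  shows "finite N"
proof (rule ccontr)
  assume inf: "infinite N"
  interpret N: normal N G by (rule N)
  obtain r where r: "\<And>g. g \<in> near \<Longrightarrow> \<exists>i::int. dist (\<phi> (h [^] i \<otimes> g) (c 0)) (c 0) \<le> r"
    using near_displacement by blast
  define F where "F = {g \<in> carrier G. dist (\<phi> g (c 0)) (c 0) \<le> r}"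
  have F: "finite F" unfolding F_def by (rule finite_displacement)
  have "\<exists>i::int. h [^] i \<otimes> g \<in> F" if "g \<in> N" for g
    using r[of g] that near N.subset h by (auto simp: F_def)
  then obtain i :: "'g \<Rightarrow> int" where i: "\<And>g. g \<in> N \<Longrightarrow> h [^] i g \<otimes> g \<in> F" by metis
  obtain m n where mn: "m \<in> N" "n \<in> N" "m \<noteq> n" "h [^] i m \<otimes> m = h [^] i n \<otimes> n"
    using same_value_exists[OF inf, of "\<lambda>g. h [^] i g \<otimes> g"] F i by (metis (mono_tags, lifting) finite_subset image_subsetI)
  have mnc: "m \<in> carrier G" "n \<in> carrier G" using mn N.subset by auto
  define p where "p = i n - i m"
  have "h [^] p = inv (h [^] i m) \<otimes> (h [^] i n \<otimes> n) \<otimes> inv n"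
    using h mnc by (simp add: p_def m_assoc int_pow_neg[symmetric] int_pow_mult[symmetric])
  also have "\<dots> = m \<otimes> inv n" unfolding mn(4)[symmetric] using h mnc by (simp add: cancel_inv)
  finally have hp: "h [^] p = m \<otimes> inv n" .
  then have pN: "h [^] p \<in> N" using mn by simp
  have p: "p \<noteq> 0"
  proof
    assume "p = 0"
    then have "m \<otimes> inv n = \<one>" using hp by simp
    then show False using mn(3) mnc by (metis inv_closed inv_equality inv_inv)
  qed
  have "k \<in> near" if k: "k \<in> carrier G" for k
  proof -
    define a where "a l = inv k \<otimes> h [^] (p * int l) \<otimes> k" for l
    have aN: "a l \<in> N" for l
    proof -
      have "h [^] (p * int l) = (h [^] p) [^] l" using h by (simp add: int_pow_pow[symmetric] int_pow_int)
      also have "\<dots> \<in> N" using pN by (induction l) auto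
      finally show ?thesis unfolding a_def by (rule N.inv_op_closed1[OF k])
    qed
    obtain u v where uv: "u \<noteq> v" "h [^] i (a u) \<otimes> a u = h [^] i (a v) \<otimes> a v"
      using same_value_exists[of "UNIV :: nat set" "\<lambda>l. h [^] i (a l) \<otimes> a l"] F i[OF aN]
      by (metis (mono_tags, lifting) finite_subset image_subsetI infinite_UNIV_nat)
    define j where "j = i (a v) - i (a u)"
    have ac: "a l \<in> carrier G" for l using h k by (simp add: a_def)
    have "h [^] (p * (int u - int v)) \<otimes> k = k \<otimes> (a u \<otimes> inv (a v))"
      using h k by (simp add: a_def m_assoc[symmetric] inv_mult_group int_pow_neg[symmetric])
        (simp add: m_assoc int_pow_mult[symmetric] algebra_simps)
    also have "a u \<otimes> inv (a v) = inv (h [^] i (a u)) \<otimes> (h [^] i (a u) \<otimes> a u) \<otimes> inv (a v)"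
      using h ac by (simp add: cancel_inv)
    also have "\<dots> = h [^] j"
      unfolding uv(2) using h ac
      by (simp add: j_def m_assoc int_pow_neg[symmetric] int_pow_mult[symmetric])
    finally show ?thesis using uv p by (intro commensurating_near[OF k, of "p * (int u - int v)"]) auto
  qed
  then show False using virtually_cyclic_if_near not_vc by blast
qed

lemma amenable_normal_near:
  assumes N: "N \<lhd> G" and am: "amenable (G\<lparr>carrier := N\<rparr>)"
  shows "N \<subseteq> near"
proof (rule ccontr)
  assume "\<not> N \<subseteq> near"
  then obtain n where n: "n \<in> N" "n \<notin> near" by blast
  interpret N: normal N G by (rule N)
  have nc: "n \<in> carrier G" using n N.subset by blast
  obtain r where r: "\<And>y. \<bar>pr (\<phi> n y)\<bar> \<le> r \<or> \<bar>pr y\<bar> \<le> r"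
    using common_end_or_bounded_projection[of "\<phi> n"] phi_isom[OF nc] common_end_near[OF nc] n(2)
    by blast
  \<comment> \<open>Slabs of half-width \<open>r\<close> around the multiples of
    \<open>of_int j * \<tau>\<close> are disjoint.\<close>
  obtain j0 :: nat where j0: "2 * r / \<tau> < real j0" using reals_Archimedean2 by blast
  define j where "j = int j0"
  have j: "2 * r < of_int j * \<tau>" using j0 period_pos by (simp add: j_def field_simps)
  have "\<exists>\<mu> :: 'g set \<Rightarrow> real. (\<forall>A\<subseteq>N. 0 \<le> \<mu> A) \<and> \<mu> N = 1 \<and>
      (\<forall>A\<subseteq>N. \<forall>B\<subseteq>N. A \<inter> B = {} \<longrightarrow> \<mu> (A \<union> B) = \<mu> A + \<mu> B) \<and>
      (\<forall>g\<in>N. \<forall>A\<subseteq>N. \<mu> (g <#\<^bsub>G\<lparr>carrier := N\<rparr>\<^esub> A) = \<mu> A)"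
    using am unfolding amenable_def by simp
  then obtain \<mu> :: "'g set \<Rightarrow> real" where m: "\<forall>A\<subseteq>N. 0 \<le> \<mu> A" "\<mu> N = 1"
      "\<forall>A\<subseteq>N. \<forall>B\<subseteq>N. A \<inter> B = {} \<longrightarrow> \<mu> (A \<union> B) = \<mu> A + \<mu> B"
      "\<forall>g\<in>N. \<forall>A\<subseteq>N. \<mu> (g <#\<^bsub>G\<lparr>carrier := N\<rparr>\<^esub> A) = \<mu> A"
    by (elim exE conjE) (rule that)
  note \<mu> = m(1)[rule_format] m(2) m(3)[rule_format] m(4)[rule_format]
  define A where "A i = {m \<in> N. \<bar>pr (\<phi> m (c 0)) - of_int (i * j) * \<tau>\<bar> \<le> r}" for i :: int
  have AN: "A i \<subseteq> N" for i by (auto simp: A_def)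
  have mono: "\<mu> B \<le> \<mu> C" if "B \<subseteq> C" "C \<subseteq> N" for B C
  proof -
    have "\<mu> (B \<union> (C - B)) = \<mu> B + \<mu> (C - B)" using that by (intro \<mu>(3)) auto
    moreover have "B \<union> (C - B) = C" using that by auto
    moreover have "0 \<le> \<mu> (C - B)" using that by (intro \<mu>(1)) auto
    ultimately show ?thesis by simp
  qed
  \<comment> \<open>\<open>b\<close> sends every point outside the slab around
    \<open>of_int (i * j) * \<tau>\<close> into it, so translation by \<open>b\<close> maps
    \<open>N - A i\<close> into \<open>A i\<close>, and invariance gives \<open>A i\<close> at least
    half of the mass. Three disjoint sets of this kind exceed the total mass; this takes the place
    of a free subgroup.\<close>
  have half: "1 / 2 \<le> \<mu> (A i)" for i
  proof -
    define a where "a = h [^] (i * j)"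
    define b where "b = a \<otimes> n \<otimes> inv a"
    have ac: "a \<in> carrier G" using h by (simp add: a_def)
    have ainv: "inv a = h [^] (- (i * j))" using h by (simp add: a_def int_pow_neg)
    have bN: "b \<in> N" unfolding b_def by (rule N.inv_op_closed2[OF ac n(1)])
    have "b <#\<^bsub>G\<lparr>carrier := N\<rparr>\<^esub> (N - A i) \<subseteq> A i"
    proof
      fix x assume "x \<in> b <#\<^bsub>G\<lparr>carrier := N\<rparr>\<^esub> (N - A i)"
      then obtain m where m: "m \<in> N" "m \<notin> A i" and x: "x = b \<otimes> m" by (auto simp: l_coset_def)
      have mc: "m \<in> carrier G" using m N.subset by blast
      define y where "y = \<phi> (inv a) (\<phi> m (c 0))"
      have "pr y = pr (\<phi> m (c 0)) - of_int (i * j) * \<tau>"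
        unfolding y_def ainv by (simp add: T_ht_pr del: of_int_mult)
      then have "\<not> \<bar>pr y\<bar> \<le> r" using m by (simp add: A_def)
      then have 1: "\<bar>pr (\<phi> n y)\<bar> \<le> r" using r by blast
      have "\<phi> x (c 0) = \<phi> a (\<phi> n y)"
        using ac nc mc by (simp add: x b_def y_def phi_mult)
      then have "pr (\<phi> x (c 0)) = pr (\<phi> n y) + of_int (i * j) * \<tau>" by (simp add: a_def T_ht_pr)
      then show "x \<in> A i" using 1 bN m x by (simp add: A_def)
    qed
    then have "\<mu> (b <#\<^bsub>G\<lparr>carrier := N\<rparr>\<^esub> (N - A i)) \<le> \<mu> (A i)" by (rule mono[OF _ AN])
    then have "\<mu> (N - A i) \<le> \<mu> (A i)" using \<mu>(4)[OF bN, of "N - A i"] by auto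
    moreover have "\<mu> (A i \<union> (N - A i)) = \<mu> (A i) + \<mu> (N - A i)" using AN by (intro \<mu>(3)) auto
    moreover have "A i \<union> (N - A i) = N" using AN[of i] by auto
    ultimately show ?thesis using \<mu>(2) by simp
  qed
  have disj: "A i \<inter> A i' = {}" if "i < i'" for i i'
  proof (rule ccontr)
    assume "\<not> ?thesis"
    then obtain m where "\<bar>pr (\<phi> m (c 0)) - of_int (i * j) * \<tau>\<bar> \<le> r" "\<bar>pr (\<phi> m (c 0)) - of_int (i' * j) * \<tau>\<bar> \<le> r"
      by (auto simp: A_def)
    then have "of_int (i' * j) * \<tau> - of_int (i * j) * \<tau> \<le> 2 * r" by linarith
    moreover have "of_int (i' * j) * \<tau> - of_int (i * j) * \<tau> = of_int (i' - i) * (of_int j * \<tau>)"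
      by (simp add: algebra_simps)
    moreover have "1 * (of_int j * \<tau>) \<le> of_int (i' - i) * (of_int j * \<tau>)"
      using that period_pos by (intro mult_right_mono) (auto simp: j_def)
    ultimately show False using j by linarith
  qed
  have "\<mu> (A 0 \<union> A 1 \<union> A 2) = \<mu> (A 0 \<union> A 1) + \<mu> (A 2)"
    using AN disj[of 0 2] disj[of 1 2] by (intro \<mu>(3)) auto
  also have "\<mu> (A 0 \<union> A 1) = \<mu> (A 0) + \<mu> (A 1)" using AN disj[of 0 1] by (intro \<mu>(3)) auto
  finally have "\<mu> (A 0 \<union> A 1 \<union> A 2) \<ge> 3 / 2" using half[of 0] half[of 1] half[of 2] by linarith
  moreover have "\<mu> (A 0 \<union> A 1 \<union> A 2) \<le> \<mu> N" using AN by (intro mono) auto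
  ultimately show False using \<mu>(2) by simp
qed

end

lemma (in group) finite_subgroup_amenable:
  assumes H: "subgroup H G" and fin: "finite H"
  shows "amenable (G\<lparr>carrier := H\<rparr>)"
proof -
  have ne: "H \<noteq> {}" using subgroup.one_closed[OF H] by blast
  have "card (g <#\<^bsub>G\<lparr>carrier := H\<rparr>\<^esub> A) = card A" if g: "g \<in> H" and A: "A \<subseteq> H" for g A
  proof -
    have "inj_on (\<lambda>x. g \<otimes> x) A"
      using g A subgroup.subset[OF H] by (intro inj_onI) (metis l_cancel subsetD)
    moreover have "g <#\<^bsub>G\<lparr>carrier := H\<rparr>\<^esub> A = (\<lambda>x. g \<otimes> x) ` A" by (auto simp: l_coset_def)
    ultimately show ?thesis by (simp add: card_image)
  qed
  moreover have "card (A \<union> B) = card A + card B" if "A \<subseteq> H" "B \<subseteq> H" "A \<inter> B = {}" for A B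
    using that fin by (intro card_Un_disjoint) (auto intro: finite_subset)
  ultimately show ?thesis unfolding amenable_def
    using fin ne by (intro exI[of _ "\<lambda>A. real (card A) / real (card H)"]) (auto simp: add_divide_distrib)
qed

section \<open>The boundaries and their kernels\<close>

text \<open>With its converse \<open>quotient_fixedD\<close>, this reduces fixing a class to
  relating a representative to its image, without a separate proof that the induced map is well
  defined.\<close>

lemma quotient_fixedI:
  assumes eq: "equiv A R" and f: "\<And>p. p \<in> A \<Longrightarrow> (p, f p) \<in> R" and \<xi>: "\<xi> \<in> A // R"
  shows "quotient_map_by R f \<xi> = \<xi>"
proof -
  obtain x where x: "x \<in> A" "\<xi> = R `` {x}" using \<xi> by (auto simp: quotient_def)
  have "R `` {f p} = \<xi>" if "p \<in> \<xi>" for p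
  proof -
    have xp: "(x, p) \<in> R" using that x by simp
    then have "p \<in> A" using eq by (auto simp: equiv_def)
    then have "(x, f p) \<in> R" using f xp eq by (meson equivE transE)
    then show ?thesis unfolding x(2) using equiv_class_eq[OF eq] by blast
  qed
  moreover have "x \<in> \<xi>" using x eq by (auto simp: equiv_def refl_on_def)
  ultimately show ?thesis unfolding quotient_map_by_def by blast
qed

lemma quotient_fixedD:
  assumes eq: "equiv A R" and p: "p \<in> A" "f p \<in> A" and fix_class: "quotient_map_by R f (R `` {p}) = R `` {p}"
  shows "(p, f p) \<in> R"
proof -
  have "(p, p) \<in> R" "(f p, f p) \<in> R" using eq p by (auto simp: equiv_def refl_on_def)
  then have "f p \<in> quotient_map_by R f (R `` {p})" unfolding quotient_map_by_def by blast
  then show ?thesis using fix_class by simp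
qed

lemma equiv_asymptotic_rel: "equiv geodesic_rays (asymptotic_rel :: ((real \<Rightarrow> 'x::metric_space) \<times> _) set)"
proof (rule equivI)
  show "refl_on geodesic_rays (asymptotic_rel :: ((real \<Rightarrow> 'x) \<times> _) set)"
    by (auto simp: refl_on_def asymptotic_rel_def)
  show "asymptotic_rel \<subseteq> geodesic_rays \<times> (geodesic_rays :: (real \<Rightarrow> 'x) set)"
    by (auto simp: asymptotic_rel_def)
  show "sym (asymptotic_rel :: ((real \<Rightarrow> 'x) \<times> _) set)"
    by (auto simp: sym_def asymptotic_rel_def dist_commute)
  show "trans (asymptotic_rel :: ((real \<Rightarrow> 'x) \<times> _) set)"
  proof (rule transI)
    fix a b c :: "real \<Rightarrow> 'x" assume ab: "(a, b) \<in> asymptotic_rel" and bc: "(b, c) \<in> asymptotic_rel"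
    obtain C D where "\<forall>t\<ge>0. dist (a t) (b t) \<le> C" "\<forall>t\<ge>0. dist (b t) (c t) \<le> D"
      using ab bc by (auto simp: asymptotic_rel_def)
    then have "\<forall>t\<ge>0. dist (a t) (c t) \<le> C + D"
      by (meson add_mono dist_triangle order_trans)
    then show "(a, c) \<in> asymptotic_rel" using ab bc by (auto simp: asymptotic_rel_def)
  qed
qed

section \<open>Sublinear neighbourhoods\<close>

lemma infdist_witness:
  assumes "A \<noteq> {}" "infdist x A < e"
  shows "\<exists>a\<in>A. dist x a < e"
proof (rule ccontr)
  assume "\<not> ?thesis"
  then have "e \<le> dist x a" if "a \<in> A" for a using that by (auto simp: not_less)
  then have "e \<le> infdist x A" unfolding infdist_notempty[OF assms(1)] by (intro cINF_greatest assms(1))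
  then show False using assms(2) by simp
qed

lemma infdist_isometry:
  assumes "\<And>x y. dist (f x) (f y) = dist x y"
  shows "infdist (f x) (f ` A) = infdist x A"
  by (simp add: infdist_def image_image assms)

context
  fixes \<kappa> :: "real \<Rightarrow> real"
  assumes \<kappa>: "sublinear_function \<kappa>"
begin

lemma kappa_ge_1: "0 \<le> t \<Longrightarrow> 1 \<le> \<kappa> t"
  using \<kappa> by (simp add: sublinear_function_def)

lemma kappa_mono: "0 \<le> s \<Longrightarrow> s \<le> t \<Longrightarrow> \<kappa> s \<le> \<kappa> t"
  using \<kappa> by (auto simp: sublinear_function_def mono_on_def)

text \<open>Concavity on the segment from 0 to \<open>a + b\<close>, used at the two complementary
  ratios; adding the results leaves the nonnegative term \<open>\<kappa> 0\<close>.\<close>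

lemma kappa_subadditive:
  assumes "0 \<le> a" "0 \<le> b"
  shows "\<kappa> (a + b) \<le> \<kappa> a + \<kappa> b"
proof (cases "a + b = 0")
  case True
  then have "a = 0" "b = 0" using assms by auto
  then show ?thesis using kappa_ge_1[of 0] by simp
next
  case False
  then have ab: "a + b > 0" using assms by simp
  have cc: "(1 - l) * \<kappa> 0 + l * \<kappa> (a + b) \<le> \<kappa> (l * (a + b))" if "0 \<le> l" "l \<le> 1" for l
  proof -
    have "convex_on {0..} (\<lambda>x. - \<kappa> x)" using \<kappa> by (simp add: sublinear_function_def concave_on_def)
    from convex_onD[OF this that, of 0 "a + b"] show ?thesis using ab by simp
  qed
  define l where "l = a / (a + b)"
  have l: "0 \<le> l" "l \<le> 1" "l * (a + b) = a" using assms ab by (auto simp: l_def)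
  then have "(1 - l) * (a + b) = b" by (simp add: left_diff_distrib)
  with cc[of l] cc[of "1 - l"] l have "(1 - l) * \<kappa> 0 + l * \<kappa> (a + b) \<le> \<kappa> a"
      "l * \<kappa> 0 + (1 - l) * \<kappa> (a + b) \<le> \<kappa> b" by simp_all
  then have "\<kappa> 0 + \<kappa> (a + b) \<le> \<kappa> a + \<kappa> b" by (simp add: algebra_simps)
  then show ?thesis using kappa_ge_1[of 0] by simp
qed

lemma kappa_scale: "0 \<le> t \<Longrightarrow> \<kappa> (real n * t) \<le> (real n + 1) * \<kappa> t"
proof (induction n)
  case 0
  then show ?case using kappa_mono[of 0 t] by simp
next
  case (Suc n)
  then show ?case using kappa_subadditive[of "real n * t" t] by (simp add: algebra_simps)
qed

lemma kappa_eventually_small: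
  assumes "e > 0"
  shows "\<exists>T>0. \<forall>t\<ge>T. \<kappa> t \<le> e * t"
proof -
  have "((\<lambda>t. \<kappa> t / t) \<longlongrightarrow> 0) at_top" using \<kappa> by (simp add: sublinear_function_def)
  then have "\<forall>\<^sub>F t in at_top. \<kappa> t / t < e" using assms by (rule order_tendstoD)
  then obtain T where T: "\<And>t. t \<ge> T \<Longrightarrow> \<kappa> t / t < e" by (auto simp: eventually_at_top_linorder)
  have "\<kappa> t \<le> e * t" if "t \<ge> max T 1" for t
    using T[of t] that by (simp add: divide_less_eq)
  then show ?thesis by (intro exI[of _ "max T 1"]) auto
qed

lemma kappa_nbhd_mono: "a \<le> b \<Longrightarrow> kappa_nbhd \<kappa> c a \<subseteq> kappa_nbhd \<kappa> c b"
proof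
  fix x assume "a \<le> b" and x: "x \<in> kappa_nbhd \<kappa> c a"
  then have "a * \<kappa> (dist (c 0) x) \<le> b * \<kappa> (dist (c 0) x)"
    using kappa_ge_1[of "dist (c 0) x"] by (intro mult_right_mono) auto
  then show "x \<in> kappa_nbhd \<kappa> c b" using x by (simp add: kappa_nbhd_def)
qed

text \<open>The two neighbourhoods measure distance from different origins and at different points.
  Since \<kappa> is subadditive and at most linear up to a constant, changing the origin and passing
  from \<open>x\<close> to a nearby \<open>y\<close> costs only a constant factor in
  \<kappa>.\<close>

lemma kappa_nbhd_trans:
  assumes 1: "A \<subseteq> kappa_nbhd \<kappa> b \<epsilon>" and 2: "b ` {0..} \<subseteq> kappa_nbhd \<kappa> c \<epsilon>'"
  shows "\<exists>e. A \<subseteq> kappa_nbhd \<kappa> c e"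
proof -
  define p q where "p = max \<epsilon> 0" and "q = max \<epsilon>' 0"
  have pq: "0 \<le> p" "0 \<le> q" by (auto simp: p_def q_def)
  have 1: "A \<subseteq> kappa_nbhd \<kappa> b p" and 2: "b ` {0..} \<subseteq> kappa_nbhd \<kappa> c q"
    using 1 2 kappa_nbhd_mono[of \<epsilon> p b] kappa_nbhd_mono[of \<epsilon>' q c] by (auto simp: p_def q_def)
  obtain T where T: "T > 0" "\<And>t. t \<ge> T \<Longrightarrow> \<kappa> t \<le> t" using kappa_eventually_small[of 1] by auto
  have lin: "\<kappa> t \<le> \<kappa> T + t" if "0 \<le> t" for t
  proof (cases "t \<ge> T")
    case True
    then show ?thesis using T(1) T(2)[of t] kappa_ge_1[of T] by linarith
  next
    case False
    then show ?thesis using kappa_mono[of t T] that by simp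
  qed
  define \<delta> where "\<delta> = dist (b 0) (c 0)"
  define P where "P = p * (1 + \<kappa> \<delta>)"
  have P: "0 \<le> P" using pq kappa_ge_1[of \<delta>] by (simp add: P_def \<delta>_def)
  \<comment> \<open>\<open>a\<close> and \<open>m\<close> are chosen so that the witness
    \<open>y\<close> on \<open>b\<close> satisfies \<open>dist (c 0) y \<le> a + real m * r\<close>;
    a natural number \<open>m\<close> is what \<open>kappa_scale\<close> accepts.\<close>
  define a where "a = 1 + P * \<kappa> T"
  have a: "0 \<le> a" using P T kappa_ge_1[of T] by (simp add: a_def)
  define m where "m = nat \<lceil>1 + P\<rceil>"
  have m: "1 + P \<le> real m" by (simp add: m_def) linarith
  define e where "e = P + 1 + q * (\<kappa> a + (real m + 1))"
  have "x \<in> kappa_nbhd \<kappa> c e" if x: "x \<in> A" for x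
  proof -
    define r where "r = dist (c 0) x"
    have r: "0 \<le> r" "1 \<le> \<kappa> r" using kappa_ge_1 by (auto simp: r_def)
    have u: "p * \<kappa> (dist (b 0) x) \<le> P * \<kappa> r"
    proof -
      have "\<kappa> (dist (b 0) x) \<le> \<kappa> (r + \<delta>)"
        using dist_triangle[of "b 0" x "c 0"] by (intro kappa_mono) (auto simp: r_def \<delta>_def)
      also have "\<dots> \<le> \<kappa> r + \<kappa> \<delta>" using r by (intro kappa_subadditive) (auto simp: \<delta>_def)
      also have "\<dots> \<le> (1 + \<kappa> \<delta>) * \<kappa> r"
        using r kappa_ge_1[of \<delta>] by (simp add: \<delta>_def distrib_right)
      finally show ?thesis using pq by (simp add: P_def mult.assoc mult_left_mono)
    qed
    have "infdist x (b ` {0..}) \<le> p * \<kappa> (dist (b 0) x)" using 1 x by (auto simp: kappa_nbhd_def)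
    then have "infdist x (b ` {0..}) < P * \<kappa> r + 1" using u by simp
    from infdist_witness[OF _ this] obtain y where y: "y \<in> b ` {0..}" "dist x y < P * \<kappa> r + 1"
      by blast
    have "dist (c 0) y \<le> a + (1 + P) * r"
    proof -
      have "P * \<kappa> r \<le> P * (\<kappa> T + r)" using lin[OF r(1)] P by (intro mult_left_mono)
      then show ?thesis using dist_triangle[of "c 0" y x] y(2) by (simp add: r_def a_def algebra_simps)
    qed
    also have "\<dots> \<le> a + real m * r" using m r by (simp add: mult_right_mono)
    finally have "\<kappa> (dist (c 0) y) \<le> \<kappa> (a + real m * r)" by (intro kappa_mono) auto
    also have "\<dots> \<le> \<kappa> a + \<kappa> (real m * r)" using a r by (intro kappa_subadditive) auto
    also have "\<dots> \<le> \<kappa> a * \<kappa> r + (real m + 1) * \<kappa> r"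
      using kappa_scale[OF r(1), of m] kappa_ge_1[OF a] r by (intro add_mono) auto
    finally have "q * \<kappa> (dist (c 0) y) \<le> q * ((\<kappa> a + (real m + 1)) * \<kappa> r)"
      using pq by (intro mult_left_mono) (auto simp: distrib_right)
    moreover have "infdist y (c ` {0..}) \<le> q * \<kappa> (dist (c 0) y)" using 2 y by (auto simp: kappa_nbhd_def)
    moreover have "infdist x (c ` {0..}) \<le> infdist y (c ` {0..}) + dist x y" by (rule infdist_triangle)
    ultimately have "infdist x (c ` {0..}) \<le> q * ((\<kappa> a + (real m + 1)) * \<kappa> r) + (P * \<kappa> r + \<kappa> r)"
      using y(2) r(2) by linarith
    also have "\<dots> = e * \<kappa> r" by (simp add: e_def algebra_simps)
    finally show ?thesis by (simp add: kappa_nbhd_def r_def)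
  qed
  then show ?thesis by blast
qed

lemma equiv_kappa_fellow_rel:
  "equiv (kappa_morse_rays \<kappa>) (kappa_fellow_rel \<kappa> :: ((real \<Rightarrow> 'x::metric_space) \<times> _) set)"
proof (rule equivI)
  show "refl_on (kappa_morse_rays \<kappa>) (kappa_fellow_rel \<kappa> :: ((real \<Rightarrow> 'x) \<times> _) set)"
    by (auto simp: refl_on_def kappa_fellow_rel_def kappa_nbhd_def intro!: exI[of _ 0])
  show "kappa_fellow_rel \<kappa> \<subseteq> kappa_morse_rays \<kappa> \<times> (kappa_morse_rays \<kappa> :: (real \<Rightarrow> 'x) set)"
    by (auto simp: kappa_fellow_rel_def)
  show "sym (kappa_fellow_rel \<kappa> :: ((real \<Rightarrow> 'x) \<times> _) set)"
    by (auto simp: sym_def kappa_fellow_rel_def)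
  show "trans (kappa_fellow_rel \<kappa> :: ((real \<Rightarrow> 'x) \<times> _) set)"
  proof (rule transI)
    fix a b c :: "real \<Rightarrow> 'x" assume ab: "(a, b) \<in> kappa_fellow_rel \<kappa>" and bc: "(b, c) \<in> kappa_fellow_rel \<kappa>"
    obtain e1 e2 where e: "a ` {0..} \<subseteq> kappa_nbhd \<kappa> b e1" "b ` {0..} \<subseteq> kappa_nbhd \<kappa> a e1"
      "b ` {0..} \<subseteq> kappa_nbhd \<kappa> c e2" "c ` {0..} \<subseteq> kappa_nbhd \<kappa> b e2"
      using ab bc by (auto simp: kappa_fellow_rel_def)
    obtain f1 f2 where f: "a ` {0..} \<subseteq> kappa_nbhd \<kappa> c f1" "c ` {0..} \<subseteq> kappa_nbhd \<kappa> a f2"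
      using kappa_nbhd_trans[OF e(1,3)] kappa_nbhd_trans[OF e(4,2)] by blast
    have "a ` {0..} \<subseteq> kappa_nbhd \<kappa> c (max f1 f2)" "c ` {0..} \<subseteq> kappa_nbhd \<kappa> a (max f1 f2)"
      using f kappa_nbhd_mono[of f1 "max f1 f2" c] kappa_nbhd_mono[of f2 "max f1 f2" a] by auto
    then show "(a, c) \<in> kappa_fellow_rel \<kappa>" using ab bc by (auto simp: kappa_fellow_rel_def)
  qed
qed

end

section \<open>Rays under isometries\<close>

context
  fixes f f' :: "'x::metric_space \<Rightarrow> 'x"
  assumes f: "\<And>x y. dist (f x) (f y) = dist x y" and f': "\<And>x. f (f' x) = x" "\<And>x. f' (f x) = x"
begin

lemma dist_inverse_isometry: "dist (f' x) (f' y) = dist x y"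
  using f[of "f' x" "f' y"] by (simp add: f')

lemma quasi_geodesic_isometry: "quasi_geodesic_on q Q I (f' \<circ> \<alpha>) \<longleftrightarrow> quasi_geodesic_on q Q I \<alpha>"
  by (simp add: quasi_geodesic_on_def dist_inverse_isometry)

lemma isometry_ray_image: "x \<in> (f \<circ> c) ` {0..} \<Longrightarrow> f' x \<in> c ` {0..}"
  by (auto simp: f')

lemma geodesic_ray_isometry: "c \<in> geodesic_rays \<Longrightarrow> f \<circ> c \<in> geodesic_rays"
  by (simp add: geodesic_rays_def geodesic_on_def f)

lemma morse_ray_isometry:
  assumes "morse_ray c"
  shows "morse_ray (f \<circ> c)"
  unfolding morse_ray_def
proof (intro allI impI)
  fix A B :: real assume "1 \<le> A" "0 \<le> B"
  then obtain M where M: "\<And>\<alpha> s t. s \<le> t \<and> quasi_geodesic_on A B {s..t} \<alpha> \<and> \<alpha> s \<in> c ` {0..} \<and> \<alpha> t \<in> c ` {0..} \<Longrightarrow>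
       \<alpha> ` {s..t} \<subseteq> {x. infdist x (c ` {0..}) \<le> M}"
    using assms unfolding morse_ray_def by meson
  have "\<alpha> ` {s..t} \<subseteq> {x. infdist x ((f \<circ> c) ` {0..}) \<le> M}"
    if "s \<le> t \<and> quasi_geodesic_on A B {s..t} \<alpha> \<and> \<alpha> s \<in> (f \<circ> c) ` {0..} \<and> \<alpha> t \<in> (f \<circ> c) ` {0..}" for \<alpha> s t
  proof -
    have "(f' \<circ> \<alpha>) ` {s..t} \<subseteq> {x. infdist x (c ` {0..}) \<le> M}"
      using that isometry_ray_image[of "\<alpha> s" c] isometry_ray_image[of "\<alpha> t" c]
      by (intro M) (simp add: quasi_geodesic_isometry del: image_comp)
    moreover have "infdist (\<alpha> u) ((f \<circ> c) ` {0..}) = infdist (f' (\<alpha> u)) (c ` {0..})" for u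
      using infdist_isometry[of f "f' (\<alpha> u)" "c ` {0..}", OF f] by (simp add: f' image_comp)
    ultimately show ?thesis by auto
  qed
  then show "\<exists>M. \<forall>\<alpha> s t. s \<le> t \<and> quasi_geodesic_on A B {s..t} \<alpha> \<and>
      \<alpha> s \<in> (f \<circ> c) ` {0..} \<and> \<alpha> t \<in> (f \<circ> c) ` {0..} \<longrightarrow>
      \<alpha> ` {s..t} \<subseteq> {x. infdist x ((f \<circ> c) ` {0..}) \<le> M}" by blast
qed

lemma kappa_morse_ray_isometry:
  assumes "c \<in> kappa_morse_rays \<kappa>"
  shows "f \<circ> c \<in> kappa_morse_rays \<kappa>"
proof -
  obtain q0 Q0 m where c: "quasi_geodesic_on q0 Q0 {0..} c" and m: "\<forall>q Q. 0 \<le> (m q Q :: real)"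
    "\<And>q Q \<alpha> s t. s \<le> t \<and> quasi_geodesic_on q Q {s..t} \<alpha> \<and> \<alpha> s \<in> c ` {0..} \<and> \<alpha> t \<in> c ` {0..} \<Longrightarrow>
              \<alpha> ` {s..t} \<subseteq> kappa_nbhd \<kappa> c (m q Q)"
    using assms unfolding kappa_morse_rays_def by blast
  have "\<alpha> ` {s..t} \<subseteq> kappa_nbhd \<kappa> (f \<circ> c) (m q Q)"
    if "s \<le> t \<and> quasi_geodesic_on q Q {s..t} \<alpha> \<and> \<alpha> s \<in> (f \<circ> c) ` {0..} \<and> \<alpha> t \<in> (f \<circ> c) ` {0..}" for \<alpha> s t q Q
  proof -
    have "(f' \<circ> \<alpha>) ` {s..t} \<subseteq> kappa_nbhd \<kappa> c (m q Q)"
      using that isometry_ray_image[of "\<alpha> s" c] isometry_ray_image[of "\<alpha> t" c]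
      by (intro m(2)) (simp add: quasi_geodesic_isometry)
    moreover have "infdist (\<alpha> u) ((f \<circ> c) ` {0..}) = infdist (f' (\<alpha> u)) (c ` {0..})" for u
      using infdist_isometry[of f "f' (\<alpha> u)" "c ` {0..}", OF f] by (simp add: f' image_comp)
    moreover have "dist (f (c 0)) (\<alpha> u) = dist (c 0) (f' (\<alpha> u))" for u
      using f[of "c 0" "f' (\<alpha> u)"] by (simp add: f')
    ultimately show ?thesis by (auto simp: kappa_nbhd_def)
  qed
  moreover have "quasi_geodesic_on q0 Q0 {0..} (f \<circ> c)" using c by (simp add: quasi_geodesic_on_def f)
  ultimately show ?thesis using m(1) unfolding kappa_morse_rays_def by blast
qed

end

section \<open>The common kernel and the algebraic radicals\<close>

context rank_one_action
begin

text \<open>Asking for bounded displacement on all translates of the axis makes the set invariant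
  under conjugation.\<close>

definition axis_kernel :: "'g set"
  where "axis_kernel =
    {g \<in> carrier G. \<forall>k\<in>carrier G. \<exists>B. \<forall>t. dist (\<phi> g (\<phi> k (c t))) (\<phi> k (c t)) \<le> B}"

lemma axis_kernelD:
  "g \<in> axis_kernel \<Longrightarrow> k \<in> carrier G \<Longrightarrow>
    \<exists>B. \<forall>t. dist (\<phi> g (\<phi> k (c t))) (\<phi> k (c t)) \<le> B"
  by (simp add: axis_kernel_def)

lemma axis_kernel_normal: "axis_kernel \<lhd> G"
proof -
  have "subgroup axis_kernel G"
  proof (rule subgroupI)
    show "axis_kernel \<subseteq> carrier G" by (auto simp: axis_kernel_def)
    have "\<one> \<in> axis_kernel" by (auto simp: axis_kernel_def phi_one)
    then show "axis_kernel \<noteq> {}" by blast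
  next
    fix a assume a: "a \<in> axis_kernel"
    then have ac: "a \<in> carrier G" by (simp add: axis_kernel_def)
    have "dist (\<phi> (inv a) y) y = dist (\<phi> a y) y" for y
      using dist_phi_inv[OF ac, of y y] by (simp add: dist_commute)
    then show "inv a \<in> axis_kernel" using a by (simp add: axis_kernel_def)
  next
    fix a b assume ab: "a \<in> axis_kernel" "b \<in> axis_kernel"
    then have abc: "a \<in> carrier G" "b \<in> carrier G" by (simp_all add: axis_kernel_def)
    have le: "dist (\<phi> (a \<otimes> b) y) y \<le> dist (\<phi> b y) y + dist (\<phi> a y) y" for y
      using dist_triangle[of "\<phi> a (\<phi> b y)" y "\<phi> a y"] abc by (simp add: phi_mult phi_isom)
    have "\<exists>B. \<forall>t. dist (\<phi> (a \<otimes> b) (\<phi> k (c t))) (\<phi> k (c t)) \<le> B" if k: "k \<in> carrier G" for k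
    proof -
      obtain A where A: "\<forall>t. dist (\<phi> a (\<phi> k (c t))) (\<phi> k (c t)) \<le> A"
        using axis_kernelD[OF ab(1) k] ..
      obtain B where B: "\<forall>t. dist (\<phi> b (\<phi> k (c t))) (\<phi> k (c t)) \<le> B"
        using axis_kernelD[OF ab(2) k] ..
      have "dist (\<phi> (a \<otimes> b) (\<phi> k (c t))) (\<phi> k (c t)) \<le> B + A" for t
        using le[of "\<phi> k (c t)"] spec[OF A, of t] spec[OF B, of t] by linarith
      then show ?thesis by blast
    qed
    then show "a \<otimes> b \<in> axis_kernel" using abc by (simp add: axis_kernel_def)
  qed
  moreover have "x \<otimes> a \<otimes> inv x \<in> axis_kernel" if x: "x \<in> carrier G" and a: "a \<in> axis_kernel" for x a
  proof -
    have ac: "a \<in> carrier G" using a by (simp add: axis_kernel_def)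
    have "\<exists>B. \<forall>t. dist (\<phi> (x \<otimes> a \<otimes> inv x) (\<phi> k (c t))) (\<phi> k (c t)) \<le> B" if k: "k \<in> carrier G" for k
    proof -
      have "inv x \<otimes> k \<in> carrier G" using x k by simp
      then have "\<exists>B. \<forall>t. dist (\<phi> a (\<phi> (inv x \<otimes> k) (c t))) (\<phi> (inv x \<otimes> k) (c t)) \<le> B"
        using a by (simp add: axis_kernel_def)
      then obtain B where B: "\<forall>t. dist (\<phi> a (\<phi> (inv x \<otimes> k) (c t))) (\<phi> (inv x \<otimes> k) (c t)) \<le> B" ..
      have "dist (\<phi> (x \<otimes> a \<otimes> inv x) y) y = dist (\<phi> a (\<phi> (inv x) y)) (\<phi> (inv x) y)" for y
        using phi_isom[OF x, of "\<phi> a (\<phi> (inv x) y)" "\<phi> (inv x) y"] x ac by (simp add: phi_mult phi_inv)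
      then show ?thesis using B x k by (auto simp: phi_mult)
    qed
    then show ?thesis using x ac by (simp add: axis_kernel_def)
  qed
  ultimately show ?thesis by (simp add: normal_inv_iff)
qed

lemma axis_kernel_finite: "finite axis_kernel"
proof (rule near_normal_finite[OF axis_kernel_normal])
  show "axis_kernel \<subseteq> near"
  proof
    fix g assume g: "g \<in> axis_kernel"
    then obtain B where B: "\<forall>t. dist (\<phi> g (\<phi> \<one> (c t))) (\<phi> \<one> (c t)) \<le> B"
      unfolding axis_kernel_def by blast
    have "ht (\<phi> g (c t)) \<le> B" for t
      using ht_le[of "\<phi> g (c t)" t] B by (auto simp: phi_one intro: order_trans)
    then show "g \<in> near" using g by (auto simp: near_def axis_kernel_def)
  qed
qed

text \<open>The criterion through which the boundary and cone kernels are compared with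
  \<open>axis_kernel\<close>. Displacement is convex along each half of a translated axis, so
  sublinear growth along some sequence of times already bounds it by its value at the start.\<close>

lemma axis_kernelI:
  assumes g: "g \<in> carrier G"
    and sub: "\<And>k s e T. k \<in> carrier G \<Longrightarrow> s \<in> {1, - 1} \<Longrightarrow> e > 0 \<Longrightarrow>
      \<exists>t\<ge>T. dist (\<phi> g (\<phi> k (c (s * t)))) (\<phi> k (c (s * t))) \<le> e * t"
  shows "g \<in> axis_kernel"
proof -
  have "\<exists>B. \<forall>t. dist (\<phi> g (\<phi> k (c t))) (\<phi> k (c t)) \<le> B" if k: "k \<in> carrier G" for k
  proof -
    define F where "F t = dist (\<phi> g (\<phi> k (c t))) (\<phi> k (c t))" for t
    have le: "F (s * t) \<le> F (s * 0)" if s: "s \<in> {1, - 1}" and t: "0 \<le> t" for s t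
    proof (rule convex_sublinear_le[OF _ _ _ t])
      have "geodesic_on {0..} (\<lambda>t. \<phi> g (\<phi> k (c (s * t))))" "geodesic_on {0..} (\<lambda>t. \<phi> k (c (s * t)))"
        using s g k by (auto simp: geodesic_on_def phi_isom dist_line)
      then show "convex_on {0..} (\<lambda>t. F (s * t))" unfolding F_def
        by (intro convex_on_dist_geodesics) auto
      show "\<exists>t\<ge>T. F (s * t) \<le> e * t" if "e > 0" for e T
        using sub[OF k s that] by (simp add: F_def)
    qed (simp add: F_def)
    have "F t \<le> F 0" for t using le[of 1 t] le[of "- 1" "- t"] by (cases "0 \<le> t") auto
    then show ?thesis unfolding F_def by blast
  qed
  then show ?thesis using g by (simp add: axis_kernel_def)
qed

text \<open>A point \<open>\<phi> k (c t)\<close> is \<open>\<phi> x (c u)\<close> with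
  \<open>u\<close> in one period, so \<open>g\<close> displaces it as the conjugate
  \<open>inv x \<otimes> g \<otimes> x\<close> displaces \<open>c u\<close>. Finitely many
  conjugates have bounded displacement at \<open>c 0\<close>, hence on a whole period.\<close>

lemma FC_center_eq: "FC_center G = axis_kernel"
proof
  interpret K: normal axis_kernel G by (rule axis_kernel_normal)
  show "axis_kernel \<subseteq> FC_center G"
  proof
    fix g assume g: "g \<in> axis_kernel"
    have "{inv x \<otimes> g \<otimes> x | x. x \<in> carrier G} \<subseteq> axis_kernel" using K.inv_op_closed1 g by auto
    then show "g \<in> FC_center G"
      using g K.subset axis_kernel_finite finite_subset by (auto simp: FC_center_def)
  qed
  show "FC_center G \<subseteq> axis_kernel"
  proof
    fix g assume "g \<in> FC_center G"
    then have g: "g \<in> carrier G" and fin: "finite {inv x \<otimes> g \<otimes> x | x. x \<in> carrier G}"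
      by (auto simp: FC_center_def)
    define D where "D = Max ((\<lambda>a. dist (\<phi> a (c 0)) (c 0)) ` {inv x \<otimes> g \<otimes> x | x. x \<in> carrier G})"
    have D: "dist (\<phi> (inv x \<otimes> g \<otimes> x) (c 0)) (c 0) \<le> D" if "x \<in> carrier G" for x
      unfolding D_def using fin that by (intro Max_ge) auto
    have "dist (\<phi> g (\<phi> k (c t))) (\<phi> k (c t)) \<le> D + 2 * \<tau>" if k: "k \<in> carrier G" for k t
    proof -
      obtain i where i: "0 \<le> t + of_int i * \<tau>" "t + of_int i * \<tau> \<le> \<tau>"
        using translate_into_period by blast
      define u where "u = t + of_int i * \<tau>"
      have u: "0 \<le> u" "u \<le> \<tau>" using i by (simp_all add: u_def)
      define x where "x = k \<otimes> h [^] (- i)"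
      have x: "x \<in> carrier G" using k h by (simp add: x_def)
      have "\<phi> (h [^] (- i)) (c u) = c t" by (simp add: T_line u_def)
      then have kt: "\<phi> k (c t) = \<phi> x (c u)" using k h by (simp add: x_def phi_mult)
      define a where "a = inv x \<otimes> g \<otimes> x"
      have a: "a \<in> carrier G" using x g by (simp add: a_def)
      have "dist (\<phi> g (\<phi> k (c t))) (\<phi> k (c t)) = dist (\<phi> a (c u)) (c u)"
        unfolding kt a_def using x g by (simp add: phi_mult dist_phi_inv)
      also have "\<dots> \<le> dist (\<phi> a (c u)) (\<phi> a (c 0)) + dist (\<phi> a (c 0)) (c 0) + dist (c 0) (c u)"
        using dist_triangle[of "\<phi> a (c u)" "c u" "\<phi> a (c 0)"] dist_triangle[of "\<phi> a (c 0)" "c u" "c 0"]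
        by linarith
      also have "\<dots> \<le> D + 2 * \<tau>"
        using D[OF x, folded a_def] u by (simp add: phi_isom[OF a] dist_line)
      finally show ?thesis .
    qed
    then have "\<forall>k\<in>carrier G. \<exists>B. \<forall>t. dist (\<phi> g (\<phi> k (c t))) (\<phi> k (c t)) \<le> B"
      by (intro ballI exI allI)
    then show "g \<in> axis_kernel" unfolding axis_kernel_def using g by blast
  qed
qed

lemma finite_normal_subset:
  assumes "N \<lhd> G" "finite N"
  shows "N \<subseteq> axis_kernel"
proof
  interpret N: normal N G by fact
  fix g assume g: "g \<in> N"
  have "{inv x \<otimes> g \<otimes> x | x. x \<in> carrier G} \<subseteq> N" using N.inv_op_closed1 g by auto
  then have "g \<in> FC_center G" using g N.subset assms(2) finite_subset by (auto simp: FC_center_def)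
  then show "g \<in> axis_kernel" by (simp add: FC_center_eq)
qed

lemma finite_radical_eq: "finite_radical G = axis_kernel"
  unfolding finite_radical_def
proof (rule Greatest_equality)
  show "axis_kernel \<lhd> G \<and> finite axis_kernel" using axis_kernel_normal axis_kernel_finite by blast
qed (use finite_normal_subset in blast)

lemma amenable_radical_eq: "amenable_radical G = axis_kernel"
  unfolding amenable_radical_def
proof (rule Greatest_equality)
  show "axis_kernel \<lhd> G \<and> amenable (G\<lparr>carrier := axis_kernel\<rparr>)"
    using axis_kernel_normal axis_kernel_finite finite_subgroup_amenable
    by (auto simp: normal_imp_subgroup)
  show "N \<le> axis_kernel" if "N \<lhd> G \<and> amenable (G\<lparr>carrier := N\<rparr>)" for N
    using that amenable_normal_near near_normal_finite finite_normal_subset by blast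
qed

lemma axis_kernel_displacement: "\<exists>D\<ge>0. \<forall>g\<in>axis_kernel. \<forall>x. dist (\<phi> g x) x \<le> D"
proof -
  obtain D where D: "\<forall>g\<in>axis_kernel. \<forall>x. dist (\<phi> g x) x \<le> D"
    using finite_normal_displacement[OF axis_kernel_normal axis_kernel_finite] by blast
  then have "\<forall>g\<in>axis_kernel. \<forall>x. dist (\<phi> g x) x \<le> max D 0" by (auto intro: le_max_iff_disj[THEN iffD2])
  then show ?thesis by (intro exI[of _ "max D 0"]) auto
qed

section \<open>The kernels on the boundaries\<close>

lemma axis_rays:
  assumes k: "k \<in> carrier G" and s: "s \<in> {1, - 1}"
  shows "(\<lambda>t. \<phi> k (c (s * t))) \<in> geodesic_rays" "morse_ray (\<lambda>t. \<phi> k (c (s * t)))"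
proof -
  have "morse_ray (\<lambda>t. c (s * t))"
    using s morse_ray_line periodic_line.morse_ray_line[OF reverse_line] by auto
  then show "morse_ray (\<lambda>t. \<phi> k (c (s * t)))"
    using morse_ray_isometry[of "\<phi> k" "\<phi> (inv k)" "\<lambda>t. c (s * t)"] k by (simp add: phi_isom phi_inv o_def)
  show "(\<lambda>t. \<phi> k (c (s * t))) \<in> geodesic_rays"
    using k s by (auto simp: geodesic_rays_def geodesic_on_def phi_isom dist_line)
qed

lemma visual_kernel_ge: "axis_kernel \<subseteq> action_kernel G (visual_action \<phi>) visual_boundary"
proof
  fix g assume g: "g \<in> axis_kernel"
  obtain D where "\<forall>g\<in>axis_kernel. \<forall>x. dist (\<phi> g x) x \<le> D" using axis_kernel_displacement by blast
  then have D: "dist x (\<phi> g x) \<le> D" for x using g by (simp add: dist_commute)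
  have gc: "g \<in> carrier G" using g by (simp add: axis_kernel_def)
  have "(p, \<phi> g \<circ> p) \<in> asymptotic_rel" if p: "p \<in> geodesic_rays" for p
    using p D geodesic_ray_isometry[of "\<phi> g" "\<phi> (inv g)" p] gc
    by (auto simp: asymptotic_rel_def phi_isom phi_inv)
  then show "g \<in> action_kernel G (visual_action \<phi>) visual_boundary"
    using gc quotient_fixedI[OF equiv_asymptotic_rel, of "\<lambda>c. \<phi> g \<circ> c"]
    by (auto simp: action_kernel_def visual_action_def visual_boundary_def)
qed

lemma morse_kernel_le: "action_kernel G (visual_action \<phi>) morse_boundary \<subseteq> axis_kernel"
proof
  fix g assume g: "g \<in> action_kernel G (visual_action \<phi>) morse_boundary"
  then have gc: "g \<in> carrier G" by (simp add: action_kernel_def)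
  show "g \<in> axis_kernel"
  proof (rule axis_kernelI[OF gc])
    fix k and s e T :: real assume k: "k \<in> carrier G" and s: "s \<in> {1, - 1}" and e: "e > 0"
    define \<gamma> where "\<gamma> = (\<lambda>t. \<phi> k (c (s * t)))"
    have \<gamma>: "\<gamma> \<in> geodesic_rays" "morse_ray \<gamma>" using axis_rays[OF k s] by (simp_all add: \<gamma>_def)
    have "\<gamma> \<in> asymptotic_rel `` {\<gamma>}" using \<gamma> equiv_class_self[OF equiv_asymptotic_rel] by blast
    then have "asymptotic_rel `` {\<gamma>} \<in> morse_boundary"
      using \<gamma> by (auto simp: morse_boundary_def visual_boundary_def quotient_def)
    then have "quotient_map_by asymptotic_rel (\<lambda>c. \<phi> g \<circ> c) (asymptotic_rel `` {\<gamma>}) = asymptotic_rel `` {\<gamma>}"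
      using g by (simp add: action_kernel_def visual_action_def)
    from quotient_fixedD[OF equiv_asymptotic_rel \<gamma>(1) _ this]
    have "(\<gamma>, \<phi> g \<circ> \<gamma>) \<in> asymptotic_rel"
      using geodesic_ray_isometry[of "\<phi> g" "\<phi> (inv g)" \<gamma>] \<gamma> gc by (simp add: phi_isom phi_inv)
    then obtain C where C: "\<And>t. t \<ge> 0 \<Longrightarrow> dist (\<gamma> t) (\<phi> g (\<gamma> t)) \<le> C" by (auto simp: asymptotic_rel_def)
    define t where "t = max (max T 0) (C / e)"
    have t: "C / e \<le> t" "t \<ge> T" "t \<ge> 0" by (auto simp: t_def)
    then have "C \<le> e * t" using e by (simp add: pos_divide_le_eq mult.commute)
    then show "\<exists>t\<ge>T. dist (\<phi> g (\<phi> k (c (s * t)))) (\<phi> k (c (s * t))) \<le> e * t"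
      using C[of t] t by (intro exI[of _ t]) (simp add: \<gamma>_def dist_commute)
  qed
qed

lemma kappa_kernel_ge:
  assumes \<kappa>: "sublinear_function \<kappa>"
  shows "axis_kernel \<subseteq> action_kernel G (kappa_action \<kappa> \<phi>) (kappa_boundary \<kappa>)"
proof
  fix g assume g: "g \<in> axis_kernel"
  obtain D where D0: "D \<ge> 0" and "\<forall>g\<in>axis_kernel. \<forall>x. dist (\<phi> g x) x \<le> D" using axis_kernel_displacement by blast
  then have D: "dist (\<phi> g x) x \<le> D" for x using g by simp
  have gc: "g \<in> carrier G" using g by (simp add: axis_kernel_def)
  have nb: "x \<in> kappa_nbhd \<kappa> p D" if "y \<in> p ` {0..}" "dist x y \<le> D" for x y p
  proof -
    have "infdist x (p ` {0..}) \<le> D * 1" using infdist_le2[OF that] by simp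
    also have "\<dots> \<le> D * \<kappa> (dist (p 0) x)" using D0 kappa_ge_1[OF \<kappa>] by (intro mult_left_mono) auto
    finally show ?thesis by (simp add: kappa_nbhd_def)
  qed
  have "(p, \<phi> g \<circ> p) \<in> kappa_fellow_rel \<kappa>" if p: "p \<in> kappa_morse_rays \<kappa>" for p
  proof -
    have "p ` {0..} \<subseteq> kappa_nbhd \<kappa> (\<phi> g \<circ> p) D"
      using D by (auto intro!: nb[of "\<phi> g (p t)" for t] simp: dist_commute)
    moreover have "(\<phi> g \<circ> p) ` {0..} \<subseteq> kappa_nbhd \<kappa> p D"
      using D by (auto intro!: nb[of "p t" for t])
    ultimately show ?thesis
      using p kappa_morse_ray_isometry[of "\<phi> g" "\<phi> (inv g)" p \<kappa>] gc
      by (auto simp: kappa_fellow_rel_def phi_isom phi_inv)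
  qed
  then show "g \<in> action_kernel G (kappa_action \<kappa> \<phi>) (kappa_boundary \<kappa>)"
    using gc quotient_fixedI[OF equiv_kappa_fellow_rel[OF \<kappa>], of "\<lambda>c. \<phi> g \<circ> c"]
    by (auto simp: action_kernel_def kappa_action_def kappa_boundary_def)
qed

text \<open>Fellow travelling provides a point \<open>\<gamma> u\<close> near
  \<open>\<phi> g (\<gamma> t)\<close> at an unknown time \<open>u\<close>. Comparing distances to
  \<open>\<gamma> 0\<close> bounds the difference of \<open>u\<close> and \<open>t\<close> by the
  same sublinear error plus \<open>\<delta>\<close>, so the displacement at time \<open>t\<close>
  itself is sublinear.\<close>

lemma kappa_kernel_le:
  assumes \<kappa>: "sublinear_function \<kappa>"
  shows "action_kernel G (kappa_action \<kappa> \<phi>) (kappa_boundary \<kappa>) \<subseteq> axis_kernel"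
proof
  fix g assume g: "g \<in> action_kernel G (kappa_action \<kappa> \<phi>) (kappa_boundary \<kappa>)"
  then have gc: "g \<in> carrier G" by (simp add: action_kernel_def)
  show "g \<in> axis_kernel"
  proof (rule axis_kernelI[OF gc])
    fix k and s e T :: real assume k: "k \<in> carrier G" and s: "s \<in> {1, - 1}" and e: "e > 0"
    define \<gamma> where "\<gamma> = (\<lambda>t. \<phi> k (c (s * t)))"
    have \<gamma>: "\<gamma> \<in> geodesic_rays" "\<gamma> \<in> kappa_morse_rays \<kappa>"
      using axis_rays[OF k s] morse_ray_kappa_morse[OF _ _ \<kappa>] by (simp_all add: \<gamma>_def)
    have "kappa_fellow_rel \<kappa> `` {\<gamma>} \<in> kappa_boundary \<kappa>"
      using \<gamma> by (auto simp: kappa_boundary_def quotient_def)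
    then have "quotient_map_by (kappa_fellow_rel \<kappa>) (\<lambda>c. \<phi> g \<circ> c) (kappa_fellow_rel \<kappa> `` {\<gamma>})
        = kappa_fellow_rel \<kappa> `` {\<gamma>}"
      using g by (simp add: action_kernel_def kappa_action_def)
    from quotient_fixedD[OF equiv_kappa_fellow_rel[OF \<kappa>] \<gamma>(2) _ this]
    have "(\<gamma>, \<phi> g \<circ> \<gamma>) \<in> kappa_fellow_rel \<kappa>"
      using kappa_morse_ray_isometry[of "\<phi> g" "\<phi> (inv g)" \<gamma> \<kappa>] \<gamma> gc by (simp add: phi_isom phi_inv)
    then obtain \<epsilon>0 where "(\<phi> g \<circ> \<gamma>) ` {0..} \<subseteq> kappa_nbhd \<kappa> \<gamma> \<epsilon>0" by (auto simp: kappa_fellow_rel_def)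
    then obtain \<epsilon> where \<epsilon>: "\<epsilon> \<ge> 0" "(\<phi> g \<circ> \<gamma>) ` {0..} \<subseteq> kappa_nbhd \<kappa> \<gamma> \<epsilon>"
      using kappa_nbhd_mono[OF \<kappa>, of \<epsilon>0 "max \<epsilon>0 0" \<gamma>] by (meson max.cobounded1 max.cobounded2 subset_trans)
    define \<delta> where "\<delta> = dist (\<gamma> 0) (\<phi> g (\<gamma> 0))"
    have geod: "dist (\<gamma> a) (\<gamma> b) = \<bar>a - b\<bar>" if "0 \<le> a" "0 \<le> b" for a b
      using \<gamma>(1) that by (auto simp: geodesic_rays_def geodesic_on_def)
    have le: "dist (\<phi> g (\<gamma> t)) (\<gamma> t) \<le> 2 * (\<epsilon> * \<kappa> (t + \<delta>) + 1) + \<delta>" if t: "0 \<le> t" for t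
    proof -
      have d0: "\<bar>dist (\<gamma> 0) (\<phi> g (\<gamma> t)) - t\<bar> \<le> \<delta>"
        using abs_dist_diff_le[of "\<gamma> 0" "\<phi> g (\<gamma> t)" "\<phi> g (\<gamma> 0)"] phi_isom[OF gc, of "\<gamma> t" "\<gamma> 0"] geod[of t 0] t
        by (simp add: \<delta>_def)
      have "infdist (\<phi> g (\<gamma> t)) (\<gamma> ` {0..}) \<le> \<epsilon> * \<kappa> (dist (\<gamma> 0) (\<phi> g (\<gamma> t)))"
        using \<epsilon>(2) t by (auto simp: kappa_nbhd_def)
      also have "\<dots> \<le> \<epsilon> * \<kappa> (t + \<delta>)" using \<epsilon>(1) d0 by (intro mult_left_mono kappa_mono[OF \<kappa>]) auto
      finally have "infdist (\<phi> g (\<gamma> t)) (\<gamma> ` {0..}) < \<epsilon> * \<kappa> (t + \<delta>) + 1" by simp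
      then obtain u where u: "0 \<le> u" "dist (\<phi> g (\<gamma> t)) (\<gamma> u) < \<epsilon> * \<kappa> (t + \<delta>) + 1"
        using infdist_witness[of "\<gamma> ` {0..}"] by auto
      have "\<bar>dist (\<gamma> 0) (\<phi> g (\<gamma> t)) - u\<bar> \<le> dist (\<phi> g (\<gamma> t)) (\<gamma> u)"
        using abs_dist_diff_le[of "\<phi> g (\<gamma> t)" "\<gamma> 0" "\<gamma> u"] geod[of 0 u] u by (simp add: dist_commute)
      then have "dist (\<gamma> u) (\<gamma> t) \<le> dist (\<phi> g (\<gamma> t)) (\<gamma> u) + \<delta>" using d0 geod[OF u(1) t] by linarith
      then show ?thesis using u(2) dist_triangle[of "\<phi> g (\<gamma> t)" "\<gamma> t" "\<gamma> u"] by (simp add: algebra_simps)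
    qed
    \<comment> \<open>The factor \<open>2 * \<epsilon>\<close> in \<open>le\<close> turns this rate
      into at most \<open>e / 2\<close>; the other half of \<open>e * t\<close> absorbs the
      constants.\<close>
    obtain T1 where T1: "T1 > 0" "\<And>t. t \<ge> T1 \<Longrightarrow> \<kappa> t \<le> e / (4 * (\<epsilon> + 1)) * t"
      using kappa_eventually_small[OF \<kappa>, of "e / (4 * (\<epsilon> + 1))"] e \<epsilon>(1) by auto
    define t where "t = max (max T T1) (2 * (2 + 2 * \<delta> * e + \<delta>) / e)"
    have \<delta>: "\<delta> \<ge> 0" by (simp add: \<delta>_def)
    have t: "t \<ge> T" "t \<ge> T1" "2 * (2 + 2 * \<delta> * e + \<delta>) / e \<le> t" by (auto simp: t_def)
    then have t: "t \<ge> T" "t \<ge> T1" "t \<ge> 0" "2 * (2 + 2 * \<delta> * e + \<delta>) \<le> t * e"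
      using T1(1) e by (simp_all add: pos_divide_le_eq)
    have "\<epsilon> * \<kappa> (t + \<delta>) \<le> (\<epsilon> + 1) * (e / (4 * (\<epsilon> + 1)) * (t + \<delta>))"
      using T1(2)[of "t + \<delta>"] t \<delta> \<epsilon>(1) kappa_ge_1[OF \<kappa>, of "t + \<delta>"] by (intro mult_mono) auto
    also have "\<dots> = e * (t + \<delta>) / 4" using \<epsilon>(1) by (simp add: field_simps)
    finally have "dist (\<phi> g (\<gamma> t)) (\<gamma> t) \<le> e * (t + \<delta>) / 2 + 2 + \<delta>" using le[OF t(3)] by simp
    also have "e * (t + \<delta>) / 2 = t * e / 2 + \<delta> * e / 2" by (simp add: algebra_simps)
    also have "t * e / 2 + \<delta> * e / 2 + 2 + \<delta> \<le> t * e"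
    proof -
      have *: "x / 2 + y / 2 + 2 + z \<le> x" if "2 * (2 + 2 * y + z) \<le> x" "0 \<le> y" for x y z :: real
        using that by argo
      show ?thesis using t(4) \<delta> e by (intro *) (simp_all add: mult.assoc)
    qed
    also have "t * e = e * t" by (rule mult.commute)
    finally show "\<exists>t\<ge>T. dist (\<phi> g (\<phi> k (c (s * t)))) (\<phi> k (c (s * t))) \<le> e * t"
      using t by (intro exI[of _ t]) (simp add: \<gamma>_def)
  qed
qed

end

section \<open>Asymptotic cones\<close>

context rank_one_action
begin

context
  fixes S d
  assumes finS: "finite S" and gen: "generating_set G S"
    and d: "mono d" "\<And>n. 0 < d n" "\<not> bdd_above (range (d :: nat \<Rightarrow> real))"
begin

lemma ultra_scale_ge: "eventually (\<lambda>n. r \<le> d n) \<omega>"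
proof -
  obtain m where m: "r < d m" using d(3) by (auto simp: bdd_above_def not_le)
  show ?thesis using ultra_ge[of "real m"]
  proof (rule eventually_mono)
    fix n assume "real m \<le> real n"
    then have "d m \<le> d n" using d(1) by (auto dest: monoD)
    then show "r \<le> d n" using m by simp
  qed
qed

text \<open>The elementary half of the Milnor-Svarc lemma: it converts the word lengths seen by the
  cone into displacements of points of the axis.\<close>

lemma orbit_lipschitz:
  "\<exists>C\<ge>0. \<forall>g\<in>carrier G. dist (\<phi> g (c 0)) (c 0) \<le> C * real (word_length G S g)"
proof -
  define A where "A = S \<union> m_inv G ` S"
  define C where "C = Max (insert 0 ((\<lambda>s. dist (\<phi> s (c 0)) (c 0)) ` A))"
  have fin: "finite (insert 0 ((\<lambda>s. dist (\<phi> s (c 0)) (c 0)) ` A))" using finS by (simp add: A_def)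
  have C: "dist (\<phi> s (c 0)) (c 0) \<le> C" if "s \<in> A" for s
    unfolding C_def using fin that by (intro Max_ge) auto
  have C0: "C \<ge> 0" unfolding C_def using fin by (intro Max_ge) auto
  have Ac: "A \<subseteq> carrier G" unfolding A_def by (rule letters_closed[OF gen])
  have word: "dist (\<phi> (foldr (mult G) ws \<one>) (c 0)) (c 0) \<le> C * real (length ws)" if "set ws \<subseteq> A" for ws
    using that
  proof (induction ws)
    case Nil
    then show ?case by (simp add: phi_one)
  next
    case (Cons s ws)
    then have s: "s \<in> carrier G" "s \<in> A" and w: "foldr (mult G) ws \<one> \<in> carrier G"
      using Ac by (auto intro!: foldr_mult_closed)
    have "dist (\<phi> s (\<phi> (foldr (mult G) ws \<one>) (c 0))) (c 0)
        \<le> dist (\<phi> (foldr (mult G) ws \<one>) (c 0)) (c 0) + dist (\<phi> s (c 0)) (c 0)"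
      using dist_triangle[of "\<phi> s (\<phi> (foldr (mult G) ws \<one>) (c 0))" "c 0" "\<phi> s (c 0)"]
      by (simp add: phi_isom[OF s(1)])
    then show ?case using Cons C[OF s(2)] s w by (simp add: phi_mult algebra_simps)
  qed
  have "dist (\<phi> g (c 0)) (c 0) \<le> C * real (word_length G S g)" if "g \<in> carrier G" for g
    using word_length_witness[OF gen that] word unfolding A_def by metis
  then show ?thesis using C0 by blast
qed

lemma word_length_pow: "real (word_length G S (h [^] (i::int))) \<le> \<bar>of_int i\<bar> * real (word_length G S h)"
proof -
  have nat: "word_length G S (h [^] int n) \<le> n * word_length G S h" for n
  proof (induction n)
    case (Suc n)
    have "h [^] int (Suc n) = h [^] int n \<otimes> h [^] (1::int)"
      using h by (subst int_pow_mult[symmetric]) (auto simp: add.commute)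
    then have "h [^] int (Suc n) = h [^] int n \<otimes> h" using h by simp
    then show ?case using word_length_mult[OF gen, of "h [^] int n" h] Suc h by simp
  qed (simp add: word_length_one[OF gen])
  have "word_length G S (h [^] i) = word_length G S (h [^] int (nat \<bar>i\<bar>))"
  proof (cases "0 \<le> i")
    case False
    then have "h [^] i = inv (h [^] int (nat \<bar>i\<bar>))" using h by (simp add: int_pow_neg[symmetric])
    then show ?thesis using h word_length_inv[OF gen, of "h [^] int (nat \<bar>i\<bar>)"] by simp
  qed simp
  also have "\<dots> \<le> nat \<bar>i\<bar> * word_length G S h" by (rule nat)
  finally have "real (word_length G S (h [^] i)) \<le> real (nat \<bar>i\<bar> * word_length G S h)"
    by (simp only: of_nat_le_iff)
  then show ?thesis by simp
qed

text \<open>Conjugates of an element of the finite normal subgroup have bounded word length, which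
  vanishes after rescaling. Conversely, sequences that run along a translate of the axis at speed
  \<open>d n\<close> are admissible, and along them the cone condition says that the displacement is
  sublinear.\<close>

lemma cone_kernel_eq:
  "action_kernel G (cone_action G S \<omega> d) (asymptotic_cone G S \<omega> d) = axis_kernel"
  unfolding cone_kernel_iff[OF gen d(2,1)]
proof (intro equalityI subsetI CollectI conjI ballI)
  interpret K: normal axis_kernel G by (rule axis_kernel_normal)
  fix g assume g: "g \<in> axis_kernel"
  then show "g \<in> carrier G" using K.subset by blast
  fix x assume x: "x \<in> admissible G S d"
  define C where "C = Max (word_length G S ` axis_kernel)"
  have C: "word_length G S (inv x n \<otimes> g \<otimes> x n) \<le> C" for n
  proof -
    have "x n \<in> carrier G" using x by (simp add: admissible_def)
    then have "inv x n \<otimes> g \<otimes> x n \<in> axis_kernel" using K.inv_op_closed1 g by blast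
    then show ?thesis unfolding C_def using axis_kernel_finite by (intro Max_ge) auto
  qed
  show "((\<lambda>n. real (word_length G S (inv x n \<otimes> g \<otimes> x n)) / d n) \<longlongrightarrow> 0) \<omega>"
  proof (rule tendstoI)
    fix e :: real assume e: "e > 0"
    show "\<forall>\<^sub>F n in \<omega>. dist (real (word_length G S (inv x n \<otimes> g \<otimes> x n)) / d n) 0 < e"
      using ultra_scale_ge[of "(real C + 1) / e"]
    proof (rule eventually_mono)
      fix n assume "(real C + 1) / e \<le> d n"
      then have "real C + 1 \<le> e * d n" using e by (simp add: pos_divide_le_eq mult.commute)
      then have "real (word_length G S (inv x n \<otimes> g \<otimes> x n)) < e * d n" using C[of n] by linarith
      then show "dist (real (word_length G S (inv x n \<otimes> g \<otimes> x n)) / d n) 0 < e"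
        using d(2)[of n] by (simp add: pos_divide_less_eq)
    qed
  qed
next
  fix g assume "g \<in> {g \<in> carrier G. \<forall>x\<in>admissible G S d.
       ((\<lambda>n. real (word_length G S (inv x n \<otimes> g \<otimes> x n)) / d n) \<longlongrightarrow> 0) \<omega>}"
  then have gc: "g \<in> carrier G" and lim: "\<And>x. x \<in> admissible G S d \<Longrightarrow>
       ((\<lambda>n. real (word_length G S (inv x n \<otimes> g \<otimes> x n)) / d n) \<longlongrightarrow> 0) \<omega>" by auto
  obtain C where C: "C \<ge> 0" "\<And>g. g \<in> carrier G \<Longrightarrow> dist (\<phi> g (c 0)) (c 0) \<le> C * real (word_length G S g)"
    using orbit_lipschitz by blast
  show "g \<in> axis_kernel"
  proof (rule axis_kernelI[OF gc])
    fix k and s e T :: real assume k: "k \<in> carrier G" and s: "s \<in> {1, - 1}" and e: "e > 0"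
    define s' :: int where "s' = (if s = 1 then 1 else - 1)"
    have s': "of_int s' = s" "\<bar>s'\<bar> = 1" using s by (auto simp: s'_def)
    define x where "x n = k \<otimes> h [^] (s' * \<lfloor>d n\<rfloor>)" for n
    have xc: "x n \<in> carrier G" for n using k h by (simp add: x_def)
    have "real (word_length G S (x n)) / d n \<le> real (word_length G S k) / d 0 + real (word_length G S h)" for n
    proof -
      have dn: "d 0 \<le> d n" "0 < d n" "0 < d 0" using d(1,2) by (auto dest: monoD)
      have "real (word_length G S (x n)) \<le> real (word_length G S k) + real (word_length G S (h [^] (s' * \<lfloor>d n\<rfloor>)))"
        using word_length_mult[OF gen, of k "h [^] (s' * \<lfloor>d n\<rfloor>)"] k h unfolding x_def
        by (metis int_pow_closed of_nat_add of_nat_mono)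
      also have "real (word_length G S (h [^] (s' * \<lfloor>d n\<rfloor>))) \<le> d n * real (word_length G S h)"
      proof (rule order_trans[OF word_length_pow mult_right_mono])
        have "\<bar>s' * \<lfloor>d n\<rfloor>\<bar> = \<lfloor>d n\<rfloor>" using s' dn by (simp add: abs_mult)
        then show "\<bar>real_of_int (s' * \<lfloor>d n\<rfloor>)\<bar> \<le> d n" by (metis of_int_abs of_int_floor_le)
      qed simp
      finally have "real (word_length G S (x n)) / d n \<le> (real (word_length G S k) + d n * real (word_length G S h)) / d n"
        using dn by (simp add: divide_right_mono)
      also have "\<dots> = real (word_length G S k) / d n + real (word_length G S h)"
        using dn by (simp add: add_divide_distrib)
      also have "real (word_length G S k) / d n \<le> real (word_length G S k) / d 0"
        using dn by (intro divide_left_mono) auto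
      finally show ?thesis by simp
    qed
    then have "x \<in> admissible G S d" using xc by (auto simp: admissible_def)
    then have lim: "((\<lambda>n. real (word_length G S (inv x n \<otimes> g \<otimes> x n)) / d n) \<longlongrightarrow> 0) \<omega>" by (rule lim)
    \<comment> \<open>The orbit map costs the factor \<open>C\<close>, replacing \<open>d n\<close>
      by its integer part costs the factor 2, and each power of \<open>h\<close> moves by
      \<open>\<tau>\<close>. Using \<open>C + 1\<close> avoids division by zero.\<close>
    define \<eta> where "\<eta> = e * \<tau> / (2 * (C + 1))"
    have \<eta>: "\<eta> > 0" using e C(1) period_pos by (simp add: \<eta>_def)
    have C\<eta>: "C * \<eta> \<le> e * \<tau> / 2"
    proof -
      have "C * \<eta> \<le> (C + 1) * \<eta>" using \<eta> by simp
      also have "\<dots> = e * \<tau> / 2" using C(1) by (simp add: \<eta>_def field_simps)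
      finally show ?thesis .
    qed
    have "\<forall>\<^sub>F n in \<omega>. real (word_length G S (inv x n \<otimes> g \<otimes> x n)) / d n < \<eta> \<and> max 1 (T / \<tau> + 1) \<le> d n"
      using order_tendstoD(2)[OF lim \<eta>] ultra_scale_ge by (rule eventually_conj)
    then obtain n where n: "real (word_length G S (inv x n \<otimes> g \<otimes> x n)) / d n < \<eta>" "1 \<le> d n" "T / \<tau> + 1 \<le> d n"
      using eventually_happens'[OF ultra_ne] by fastforce
    define t where "t = of_int \<lfloor>d n\<rfloor> * \<tau>"
    have "T / \<tau> \<le> of_int \<lfloor>d n\<rfloor>" using n(3) by linarith
    then have tT: "T \<le> t" using period_pos by (simp add: t_def pos_divide_le_eq)
    have "1 \<le> \<lfloor>d n\<rfloor>" using n(2) by (simp add: le_floor_iff)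
    then have fl: "d n \<le> 2 * of_int \<lfloor>d n\<rfloor>" by linarith
    have xt: "\<phi> (x n) (c 0) = \<phi> k (c (s * t))"
    proof -
      have "\<phi> (h [^] (s' * \<lfloor>d n\<rfloor>)) (c 0) = c (s * t)"
        using T_line[of "s' * \<lfloor>d n\<rfloor>" 0] s' by (simp add: t_def mult.assoc)
      then show ?thesis using k h by (simp add: x_def phi_mult)
    qed
    define a where "a = inv x n \<otimes> g \<otimes> x n"
    have ac: "a \<in> carrier G" using xc gc by (simp add: a_def)
    have "dist (\<phi> g (\<phi> k (c (s * t)))) (\<phi> k (c (s * t))) = dist (\<phi> a (c 0)) (c 0)"
      unfolding xt[symmetric] a_def using xc gc by (simp add: phi_mult dist_phi_inv)
    also have "\<dots> \<le> C * real (word_length G S a)" by (rule C(2)[OF ac])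
    also have "\<dots> \<le> C * (\<eta> * d n)"
      using n(1) d(2)[of n] C(1) by (intro mult_left_mono) (auto simp: a_def pos_divide_less_eq)
    also have "\<dots> \<le> e * \<tau> / 2 * d n" using mult_right_mono[OF C\<eta>, of "d n"] d(2)[of n] by (simp add: mult.assoc)
    also have "\<dots> \<le> e * \<tau> / 2 * (2 * of_int \<lfloor>d n\<rfloor>)" using fl e period_pos by (intro mult_left_mono) auto
    also have "\<dots> = e * t" by (simp add: t_def)
    finally show "\<exists>t\<ge>T. dist (\<phi> g (\<phi> k (c (s * t)))) (\<phi> k (c (s * t))) \<le> e * t" using tT by blast
  qed
qed

end

end

lemma (in geometric_group_action) translation_powers:
  fixes \<tau> :: real
  assumes h: "h \<in> carrier G" and tr: "\<And>t. \<phi> h (c t) = c (t + \<tau>)"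
  shows "\<phi> (h [^] (i::int)) (c t) = c (t + of_int i * \<tau>)"
proof -
  have nat: "\<phi> (h [^] n) (c t) = c (t + real n * \<tau>)" for n :: nat and t
  proof (induction n arbitrary: t)
    case (Suc n)
    have "\<phi> (h [^] Suc n) (c t) = \<phi> (h [^] n) (c (t + \<tau>))" using h by (simp add: phi_mult tr)
    then show ?case by (simp add: Suc algebra_simps)
  qed (simp add: phi_one)
  show ?thesis
  proof (cases i rule: int_cases2)
    case (nonneg n)
    then show ?thesis using nat[of n t] by (simp add: int_pow_int)
  next
    case (nonpos n)
    have "\<phi> (h [^] n) (c (t - real n * \<tau>)) = c t" by (simp add: nat)
    then have "\<phi> (inv (h [^] n)) (c t) = c (t - real n * \<tau>)" using h phi_inv(2)[of "h [^] n"] by (metis nat_pow_closed)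
    then show ?thesis using h nonpos by (simp add: int_pow_neg_int)
  qed
qed

theorem corollary1p6:
  fixes G :: "('g, 'b) monoid_scheme"
    and S :: "'g set"
    and \<phi> :: "'g \<Rightarrow> 'x::metric_space \<Rightarrow> 'x"
    and \<omega> :: "nat filter"
    and d :: "nat \<Rightarrow> real"
    and \<kappa> :: "real \<Rightarrow> real"
  assumes "group G"
    and "finite S" and "generating_set G S"
    and "proper_space TYPE('x)" and "cat0_space TYPE('x)"
    and "geometric_action G \<phi>"
    and "\<exists>g\<in>carrier G. rank_one_isometry (\<phi> g)"
    and "\<not> virtually_cyclic G"
    and "nonprincipal_ultrafilter \<omega>"
    and "mono d" and "\<forall>n. 0 < d n" and "\<not> bdd_above (range d)"
    and "sublinear_function \<kappa>"
  shows "action_kernel G (cone_action G S \<omega> d) (asymptotic_cone G S \<omega> d)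
           = action_kernel G (visual_action \<phi>) visual_boundary
       \<and> action_kernel G (visual_action \<phi>) visual_boundary = finite_radical G
       \<and> finite_radical G = FC_center G
       \<and> FC_center G = amenable_radical G
       \<and> amenable_radical G = action_kernel G (kappa_action \<kappa> \<phi>) (kappa_boundary \<kappa>)
       \<and> action_kernel G (kappa_action \<kappa> \<phi>) (kappa_boundary \<kappa>)
           = action_kernel G (visual_action \<phi>) morse_boundary"
proof -
  interpret geometric_group_action G \<phi>
    using assms(1,4,6) by (simp add: geometric_group_action_def geometric_group_action_axioms_def)
  obtain geo :: "'x \<Rightarrow> 'x \<Rightarrow> real \<Rightarrow> 'x" where geo: "cat0_geodesics geo"
    using cat0_geodesics_exist[OF assms(5)] by blast
  obtain g c \<sigma> where g: "g \<in> carrier G" "geodesic_on UNIV c" "\<sigma> \<noteq> 0"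
      "\<And>t. \<phi> g (c t) = c (t + \<sigma>)" "\<not> bounds_flat_half_plane c"
    using assms(7) unfolding rank_one_isometry_def axis_of_def by metis
  \<comment> \<open>\<open>periodic_line\<close> requires translation in the positive direction,
    whereas the given axis may be translated backwards.\<close>
  define h where "h = (if \<sigma> > 0 then g else inv\<^bsub>G\<^esub> g)"
  have h: "h \<in> carrier G" using g by (simp add: h_def)
  have "\<phi> (inv\<^bsub>G\<^esub> g) (c t) = c (t - \<sigma>)" for t
    using phi_inv(2)[OF g(1), of "c (t - \<sigma>)"] by (simp add: g(4))
  then have "\<phi> h (c t) = c (t + \<bar>\<sigma>\<bar>)" for t using g by (simp add: h_def)
  note powers = translation_powers[of h c "\<bar>\<sigma>\<bar>", OF h this]
  have line: "periodic_line geo c (\<lambda>i. \<phi> (h [^]\<^bsub>G\<^esub> i)) \<bar>\<sigma>\<bar> \<omega>"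
    using geo g h powers assms(4,9)
    by (simp add: periodic_line_def periodic_line_axioms_def cat0_line_def cat0_line_axioms_def phi_isom)
  interpret rank_one_action G \<phi> geo c h "\<bar>\<sigma>\<bar>" \<omega>
    by (rule rank_one_action.intro[OF geometric_group_action_axioms line])
       (use h assms(8) in \<open>simp add: rank_one_action_axioms_def\<close>)
  have cone: "action_kernel G (cone_action G S \<omega> d) (asymptotic_cone G S \<omega> d) = axis_kernel"
    using assms(2,3,10-12) by (intro cone_kernel_eq) auto
  \<comment> \<open>Morse classes form a subset of the visual boundary, so both kernels lie between
    \<open>axis_kernel\<close> and the kernel on Morse classes, which is contained in
    \<open>axis_kernel\<close>.\<close>
  have "action_kernel G (visual_action \<phi>) visual_boundary \<subseteq> action_kernel G (visual_action \<phi>) morse_boundary"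
    by (auto simp: action_kernel_def morse_boundary_def)
  then have "action_kernel G (visual_action \<phi>) visual_boundary = axis_kernel"
    "action_kernel G (visual_action \<phi>) morse_boundary = axis_kernel"
    using visual_kernel_ge morse_kernel_le by auto
  moreover have "action_kernel G (kappa_action \<kappa> \<phi>) (kappa_boundary \<kappa>) = axis_kernel"
    using kappa_kernel_ge[OF assms(13)] kappa_kernel_le[OF assms(13)] by blast
  ultimately show ?thesis
    by (simp add: cone finite_radical_eq FC_center_eq amenable_radical_eq)
qed

end
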